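(* There exist universal constants $C\ge c>0$ such that, for all integers $n\ge 1$ and all $\epsilon,\delta\in(0,1)$, the following hold, where $$f(n,\epsilon,\delta)= \frac{n^{2/3}\log^{1/3}(1/\delta)}{\epsilon^{4/3}} + \frac{n^{1/2}\log^{1/2}(1/\delta)+\log(1/\delta)}{\epsilon^2}.$$ (1) There is a computationally efficient $(\epsilon,\delta)$-closeness tester for pairs of distributions on $[n]$ that uses at most $C\, f(n,\epsilon,\delta)$ samples. (2) Every $(\epsilon,\delta)$-closeness tester for pairs of distributions on $[n]$ uses at least $c\, f(n,\epsilon,\delta)$ samples.
   Context: For distributions $p,q$ on $[n]$, $d_{\mathrm{TV}}(p,q)=\frac12\sum_{i=1}^n|p_i-q_i|$. An $(\epsilon,\delta)$-closeness tester is an algorithm that receives independent samples from two unknown distributions $p,q$ on $[n]$ and, with probability at least $1-\delta$, outputs "YES" if $p=q$ and outputs "NO" if $d_{\mathrm{TV}}(p,q)\ge\epsilon$ (no requirement otherwise).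
   Formalization: Part (2) is false as stated (for n=1 or δ≥1/2 no samples are needed; no uniform c survives as ε→1 or δ→1/2). It is proved for n≥2, ε≤ε₀, δ≤δ₀, for any ε₀<1 and δ₀<1/2, with c depending only on ε₀, δ₀. Part (1) is unchanged. *)

theory Defs
  imports "HOL-Probability.Probability"
begin

text \<open>Distributions on \<open>[n]\<close> are probability mass functions on \<open>nat\<close> supported in \<open>{1..n}\<close>.\<close>

definition dists :: "nat \<Rightarrow> nat pmf set" where
  "dists n = {p. set_pmf p \<subseteq> {1..n}}"

definition d_TV :: "nat \<Rightarrow> nat pmf \<Rightarrow> nat pmf \<Rightarrow> real" where
  "d_TV n p q = 1/2 * (\<Sum>i = 1..n. \<bar>pmf p i - pmf q i\<bar>)"

text \<open>A tester consists of the numbers \<open>a\<close> and \<open>b\<close> of samples drawn from \<open>p\<close> and \<open>q\<close>, and an arbitrary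
  randomized decision rule, with \<open>True\<close> for YES. It uses \<open>a + b\<close> samples.\<close>

type_synonym rule = "nat list \<Rightarrow> nat list \<Rightarrow> bool pmf"

definition verdict :: "nat \<Rightarrow> nat \<Rightarrow> rule \<Rightarrow> nat pmf \<Rightarrow> nat pmf \<Rightarrow> bool pmf" where
  "verdict a b A p q =
     bind_pmf (replicate_pmf a p) (\<lambda>xs. bind_pmf (replicate_pmf b q) (\<lambda>ys. A xs ys))"

definition closeness_tester :: "nat \<Rightarrow> real \<Rightarrow> real \<Rightarrow> nat \<Rightarrow> nat \<Rightarrow> rule \<Rightarrow> bool" where
  "closeness_tester n \<epsilon> \<delta> a b A \<longleftrightarrow>
     (\<forall>p \<in> dists n. \<forall>q \<in> dists n.
        (p = q \<longrightarrow> pmf (verdict a b A p q) True \<ge> 1 - \<delta>) \<and>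
        (d_TV n p q \<ge> \<epsilon> \<longrightarrow> pmf (verdict a b A p q) False \<ge> 1 - \<delta>))"

definition sample_bound :: "nat \<Rightarrow> real \<Rightarrow> real \<Rightarrow> real" where
  "sample_bound n \<epsilon> \<delta> =
     real n powr (2/3) * ln (1/\<delta>) powr (1/3) / \<epsilon> powr (4/3)
     + (real n powr (1/2) * ln (1/\<delta>) powr (1/2) + ln (1/\<delta>)) / \<epsilon>\<^sup>2"


text \<open>Computational efficiency is measured on a randomized real RAM with unit cost per instruction:
  exact real arithmetic and comparison, fair coin flips, and a random access memory. The only
  constants are naturals, so a program cannot carry advice in a real number. Indirect addressing
  through a register that does not hold a natural number loops forever, so that addressing does
  not provide a rounding operation.\<close>

datatype instr =
    Const nat nat        \<comment> \<open>target register, value\<close>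
  | Add nat nat nat      \<comment> \<open>target register, operand registers (also for the next three)\<close>
  | Sub nat nat nat
  | Mul nat nat nat
  | Div nat nat nat
  | Load nat nat         \<comment> \<open>target register, address register\<close>
  | Store nat nat        \<comment> \<open>address register, source register\<close>
  | Flip nat             \<comment> \<open>target register\<close>
  | JumpLess nat nat nat \<comment> \<open>compared registers, jump target\<close>

type_synonym program = "instr list"

record config =
  pc :: nat
  reg :: "nat \<Rightarrow> real"
  mem :: "nat \<Rightarrow> real"

definition set_reg :: "nat \<Rightarrow> real \<Rightarrow> config \<Rightarrow> config" where
  "set_reg i v c = c\<lparr>pc := Suc (pc c), reg := (reg c)(i := v)\<rparr>"

fun exec :: "instr \<Rightarrow> config \<Rightarrow> config pmf" where
  "exec (Const i k) c = return_pmf (set_reg i (real k) c)"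
| "exec (Add i j k) c = return_pmf (set_reg i (reg c j + reg c k) c)"
| "exec (Sub i j k) c = return_pmf (set_reg i (reg c j - reg c k) c)"
| "exec (Mul i j k) c = return_pmf (set_reg i (reg c j * reg c k) c)"
| "exec (Div i j k) c = return_pmf (set_reg i (reg c j / reg c k) c)"
| "exec (Load i j) c = return_pmf
     (if reg c j \<in> \<nat> then set_reg i (mem c (nat \<lfloor>reg c j\<rfloor>)) c else c)"
| "exec (Store i j) c = return_pmf
     (if reg c i \<in> \<nat> then c\<lparr>pc := Suc (pc c), mem := (mem c)(nat \<lfloor>reg c i\<rfloor> := reg c j)\<rparr> else c)"
| "exec (Flip i) c = map_pmf (\<lambda>h. set_reg i (of_bool h) c) (bernoulli_pmf (1/2))"
| "exec (JumpLess i j l) c = return_pmf (c\<lparr>pc := (if reg c i < reg c j then l else Suc (pc c))\<rparr>)"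

definition halted :: "program \<Rightarrow> config \<Rightarrow> bool" where
  "halted P c \<longleftrightarrow> pc c \<ge> length P"

definition step :: "program \<Rightarrow> config \<Rightarrow> config pmf" where
  "step P c = (if halted P c then return_pmf c else exec (P ! pc c) c)"

fun run :: "program \<Rightarrow> nat \<Rightarrow> config \<Rightarrow> config pmf" where
  "run P 0 c = return_pmf c"
| "run P (Suc t) c = bind_pmf (step P c) (run P t)"

text \<open>On start configuration \<open>c\<close>, program \<open>P\<close> halts within \<open>t\<close> steps for every outcome of the coins, and its
  output, read off the final configuration by \<open>out\<close>, has distribution \<open>D\<close>.\<close>

definition computes :: "program \<Rightarrow> nat \<Rightarrow> config \<Rightarrow> (config \<Rightarrow> 'o) \<Rightarrow> 'o pmf \<Rightarrow> bool" where
  "computes P t c out D \<longleftrightarrow>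
     (\<forall>c' \<in> set_pmf (run P t c). halted P c') \<and> map_pmf out (run P t c) = D"

definition nth0 :: "real list \<Rightarrow> nat \<Rightarrow> real" where
  "nth0 l i = (if i < length l then l ! i else 0)"

definition input :: "nat \<Rightarrow> real \<Rightarrow> real \<Rightarrow> nat list \<Rightarrow> nat list \<Rightarrow> config" where
  "input n \<epsilon> \<delta> xs ys =
     \<lparr>pc = 0,
      reg = nth0 [real n, \<epsilon>, \<delta>, real (length xs), real (length ys)],
      mem = nth0 (map real xs @ map real ys)\<rparr>"

text \<open>A family of testers is efficient if it is uniform in \<open>(n, \<epsilon>, \<delta>)\<close> and runs in time polynomial in
  the number of samples: one program \<open>S\<close> finds the sample sizes from \<open>(n, \<epsilon>, \<delta>)\<close>, and one program \<open>P\<close>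
  maps \<open>(n, \<epsilon>, \<delta>)\<close> and the samples to the verdict.\<close>

definition computationally_efficient ::
  "(nat \<Rightarrow> real \<Rightarrow> real \<Rightarrow> nat) \<Rightarrow> (nat \<Rightarrow> real \<Rightarrow> real \<Rightarrow> nat) \<Rightarrow> (nat \<Rightarrow> real \<Rightarrow> real \<Rightarrow> rule) \<Rightarrow> bool" where
  "computationally_efficient a b A \<longleftrightarrow>
     (\<exists>S P K k. \<forall>n \<ge> 1. \<forall>\<epsilon> \<in> {0<..<1}. \<forall>\<delta> \<in> {0<..<1}.
        let t = K * (1 + a n \<epsilon> \<delta> + b n \<epsilon> \<delta>) ^ k in
          computes S t (input n \<epsilon> \<delta> [] []) (\<lambda>c. (reg c 0, reg c 1))
            (return_pmf (real (a n \<epsilon> \<delta>), real (b n \<epsilon> \<delta>))) \<and>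
          (\<forall>xs ys. length xs = a n \<epsilon> \<delta> \<and> length ys = b n \<epsilon> \<delta> \<and> set xs \<union> set ys \<subseteq> {1..n} \<longrightarrow>
             computes P t (input n \<epsilon> \<delta> xs ys) (\<lambda>c. reg c 0 = 1) (A n \<epsilon> \<delta> xs ys)))"


text \<open>A lower bound by a positive multiple of \<open>sample_bound\<close> cannot hold on all of \<open>n \<ge> 1\<close>,
  \<open>\<epsilon>, \<delta> \<in> (0,1)\<close>. For \<open>n = 1\<close> and for \<open>\<delta> \<ge> 1/2\<close> there are testers without samples (the two facts below).
  For \<open>\<delta> = 1/2 - 1/(16 n)\<close> and \<open>\<epsilon> = 1/2\<close> four samples suffice, and for \<open>\<epsilon>\<close> within \<open>O(1/n)\<close> of \<open>1\<close> and \<open>\<delta> = 1/3\<close>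
  it suffices to look for a collision between \<open>O(sqrt n)\<close> samples from each of \<open>p\<close> and \<open>q\<close>. Hence the
  lower bound is to be read for \<open>n \<ge> 2\<close> and \<open>\<epsilon>\<close>, \<open>\<delta>\<close> bounded away from \<open>1\<close> and \<open>1/2\<close>.\<close>

lemma closeness_tester_domain_size_1:
  assumes "0 < \<epsilon>" "0 < \<delta>"
  shows "closeness_tester 1 \<epsilon> \<delta> 0 0 (\<lambda>_ _. return_pmf True)"
proof -
  have "p = return_pmf 1" if "p \<in> dists 1" for p
    using that set_pmf_subset_singleton[of p 1] by (simp add: dists_def)
  then have eq: "p = q" if "p \<in> dists 1" "q \<in> dists 1" for p q
    using that by metis
  have "d_TV 1 p q = 0" if "p \<in> dists 1" "q \<in> dists 1" for p q
    unfolding eq[OF that] by (simp add: d_TV_def)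
  then show ?thesis
    using assms by (auto simp: closeness_tester_def verdict_def bind_return_pmf)
qed

lemma closeness_tester_fair_coin:
  assumes "\<delta> \<ge> 1/2"
  shows "closeness_tester n \<epsilon> \<delta> 0 0 (\<lambda>_ _. bernoulli_pmf (1/2))"
  using assms by (auto simp: closeness_tester_def verdict_def bind_return_pmf)

end

theory Submission
  imports Defs
begin

text \<open>
  Upper bound. Split the samples of \<open>p\<close> into two blocks with occurrence numbers \<open>X\<^sub>i\<close>, \<open>X'\<^sub>i\<close> of the element
  \<open>i\<close>, those of \<open>q\<close> into blocks with numbers \<open>Y\<^sub>i\<close>, \<open>Y'\<^sub>i\<close>, and reject if the sum of
  \<open>\<bar>X\<^sub>i - Y\<^sub>i\<bar> + \<bar>X'\<^sub>i - Y'\<^sub>i\<bar> - \<bar>X\<^sub>i - X'\<^sub>i\<bar> - \<bar>Y\<^sub>i - Y'\<^sub>i\<bar>\<close> is large. Changing one sample changes the sum by at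
  most 4, so the bounded differences inequality yields the logarithmic dependence on \<open>\<delta>\<close>. The expectation only
  depends on the marginals, so no Poissonization is needed: it is the sum of the energy distances of the
  binomial distributions of \<open>X\<^sub>i\<close> and \<open>Y\<^sub>i\<close>, that is, twice the squared \<open>L\<^sup>2\<close> distance of their distribution
  functions, which vanishes for \<open>p = q\<close> and is bounded below by the Cauchy-Schwarz inequality otherwise.

  Lower bound. Group the domain into pairs. Under the null hypothesis both elements of a pair have equal mass
  under \<open>p = q\<close>; under the alternative hypothesis, \<open>p\<close> and \<open>q\<close> are biased inside the pairs in opposite
  directions. The second moment of the likelihood ratio has to be at least of order \<open>1 / \<delta>\<close>. A single biased
  pair, all pairs with equal mass and random directions of the bias, and a hidden random set of heavy unbiased
  pairs among light biased ones give the three terms of the bound.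
\<close>

subsection \<open>Finite sums over samples\<close>

text \<open>The three terms of the upper bound come from one denominator. For a single element the
  energy distance is at least of order d^2 / (1 + d + s), where d is the difference of the two
  binomial means and s bounds the standard deviation: the distribution functions differ on a window
  with about 1 + d + s integers. Summed over all elements, m^2 \<epsilon>^2 has to exceed sqrt(m k)
  times each of n, m \<epsilon> and sqrt(n m), for k of order log(1/\<delta>). Solved for m, these
  are the term with n^(2/3), the term with log(1/\<delta>) alone and the term with n^(1/2). In the
  lower bound the term with n^(2/3) is the hard one. Repeated hits of light pairs give the bias
  away, so they have to be confused with hits of heavy pairs, and the place of the heavy pairs must
  be unknown under both hypotheses. The null hypothesis is therefore a mixture as well, and the
  likelihood ratio has a mixture in its denominator. Its second moment is controlled sample by
  sample, through the posterior distribution of the hidden set.\<close>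

definition words :: "'a set \<Rightarrow> nat \<Rightarrow> 'a list set" where
  "words X N = {xs. set xs \<subseteq> X \<and> length xs = N}"

lemma finite_words: "finite X \<Longrightarrow> finite (words X N)"
  unfolding words_def by (rule finite_lists_length_eq)

lemma words_0: "words X 0 = {[]}"
  by (auto simp: words_def)

lemma sum_words_Suc:
  assumes "finite X"
  shows "(\<Sum>xs\<in>words X (Suc N). G xs) = (\<Sum>x\<in>X. \<Sum>xs\<in>words X N. G (x # xs))"
proof -
  have "words X (Suc N) = (\<lambda>(x, xs). x # xs) ` (X \<times> words X N)"
    by (auto simp: words_def length_Suc_conv image_iff)
  moreover have "inj_on (\<lambda>(x, xs). x # xs) (X \<times> words X N)"
    by (auto simp: inj_on_def)
  ultimately show ?thesis
    by (simp add: sum.reindex sum.cartesian_product case_prod_unfold)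
qed

lemma sum_words_prod_list:
  fixes F :: "'a \<Rightarrow> 'b::comm_semiring_1"
  assumes "finite X"
  shows "(\<Sum>xs\<in>words X N. \<Prod>x\<leftarrow>xs. F x) = (\<Sum>x\<in>X. F x) ^ N"
proof (induction N)
  case (Suc N)
  then show ?case
    by (simp add: sum_words_Suc[OF assms] flip: sum_distrib_left sum_distrib_right)
qed (simp add: words_0)

text \<open>The weight \<open>G\<close> sees only the first components, so the second components can
  be summed out position by position. This averages the bits of a sample away while its pair indices
  stay fixed.\<close>

lemma sum_words_times:
  fixes F :: "'a \<times> 'b \<Rightarrow> 'c::comm_semiring_1"
  assumes "finite X" "finite Y"
  shows "(\<Sum>zs\<in>words (X \<times> Y) N. G (map fst zs) * (\<Prod>z\<leftarrow>zs. F z)) =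
    (\<Sum>us\<in>words X N. G us * (\<Prod>u\<leftarrow>us. \<Sum>y\<in>Y. F (u, y)))"
proof (induction N arbitrary: G)
  case (Suc N)
  have "(\<Sum>zs\<in>words (X \<times> Y) (Suc N). G (map fst zs) * (\<Prod>z\<leftarrow>zs. F z)) =
    (\<Sum>x\<in>X. \<Sum>y\<in>Y. \<Sum>zs\<in>words (X \<times> Y) N. F (x,y) * (G (x # map fst zs) * (\<Prod>z\<leftarrow>zs. F z)))"
    using assms by (simp add: sum_words_Suc sum.cartesian_product' ac_simps)
  also have "\<dots> = (\<Sum>x\<in>X. \<Sum>y\<in>Y. F (x,y) * (\<Sum>us\<in>words X N. G (x # us) * (\<Prod>u\<leftarrow>us. \<Sum>y\<in>Y. F (u, y))))"
    using Suc[of "\<lambda>us. G (_ # us)"] by (simp flip: sum_distrib_left)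
  also have "\<dots> = (\<Sum>us\<in>words X (Suc N). G us * (\<Prod>u\<leftarrow>us. \<Sum>y\<in>Y. F (u, y)))"
    using assms by (simp add: sum_words_Suc ac_simps flip: sum_distrib_left sum_distrib_right)
     (simp add: sum_distrib_left sum_distrib_right ac_simps)
  finally show ?case .
qed (simp add: words_0)

lemma pmf_replicate_pmf:
  "pmf (replicate_pmf n p) xs = (if length xs = n then \<Prod>x\<leftarrow>xs. pmf p x else 0)"
proof (induction n arbitrary: xs)
  case 0
  then show ?case by (auto simp: pmf_return)
next
  case (Suc n)
  have *: "replicate_pmf (Suc n) p = map_pmf (\<lambda>(x, xs). x # xs) (pair_pmf p (replicate_pmf n p))"
    by (simp add: pair_pmf_def map_pmf_def bind_assoc_pmf bind_return_pmf)
  show ?case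
  proof (cases xs)
    case Nil
    then show ?thesis unfolding *
      by (auto simp: pmf_eq_0_set_pmf)
  next
    case (Cons y ys)
    have "pmf (map_pmf (\<lambda>(x, xs). x # xs) (pair_pmf p (replicate_pmf n p))) ((\<lambda>(x, xs). x # xs) (y, ys))
      = pmf (pair_pmf p (replicate_pmf n p)) (y, ys)"
      by (rule pmf_map_inj') (auto simp: inj_def)
    then show ?thesis unfolding * using Suc Cons by (simp add: pmf_pair)
  qed
qed

lemma expectation_replicate_pmf:
  fixes g :: "'a list \<Rightarrow> real"
  assumes "finite X" "set_pmf p \<subseteq> X"
  shows "measure_pmf.expectation (replicate_pmf n p) g = (\<Sum>xs\<in>words X n. (\<Prod>x\<leftarrow>xs. pmf p x) * g xs)"
proof -
  have "measure_pmf.expectation (replicate_pmf n p) g = (\<Sum>xs\<in>words X n. pmf (replicate_pmf n p) xs * g xs)"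
    using assms by (subst integral_measure_pmf[of "words X n"])
      (auto simp: finite_words[OF assms(1)] set_replicate_pmf lists_eq_set, auto simp: words_def)
  also have "\<dots> = (\<Sum>xs\<in>words X n. (\<Prod>x\<leftarrow>xs. pmf p x) * g xs)"
    by (intro sum.cong) (auto simp: pmf_replicate_pmf words_def)
  finally show ?thesis .
qed

lemma replicate_pmf_map:
  "replicate_pmf n (map_pmf f p) = map_pmf (map f) (replicate_pmf n p)"
proof (induction n)
  case (Suc n)
  then show ?case
    by (simp add: map_pmf_def bind_assoc_pmf bind_return_pmf)
qed simp

lemma ex_pmf_of_weights:
  fixes f :: "'a \<Rightarrow> real"
  assumes "finite X" "\<And>x. x \<in> X \<Longrightarrow> f x \<ge> 0" "sum f X = 1"
  shows "\<exists>p. set_pmf p \<subseteq> X \<and> (\<forall>x\<in>X. pmf p x = f x)"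
proof -
  define g where "g x = (if x \<in> X then f x else 0)" for x
  have "(\<integral>\<^sup>+x. ennreal (g x) \<partial>count_space UNIV) = (\<Sum>x\<in>X. ennreal (g x))"
    using assms by (intro nn_integral_count_space') (auto simp: g_def)
  also have "\<dots> = ennreal (\<Sum>x\<in>X. g x)"
    using assms by (intro sum_ennreal) (auto simp: g_def)
  also have "(\<Sum>x\<in>X. g x) = 1" using assms by (simp add: g_def)
  finally have *: "pmf (embed_pmf g) x = g x" for x
    using assms by (subst pmf_embed_pmf) (auto simp: g_def)
  show ?thesis
    by (rule exI[of _ "embed_pmf g"]) (auto simp: set_pmf_eq * g_def split: if_splits)
qed

lemma pmf_bool_False: "pmf D False = 1 - pmf D True"
  using sum_pmf_eq_1[of "{False, True}" D] subset_UNIV[of "set_pmf D", unfolded UNIV_bool] by simp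

text \<open>The fractional powers are used only through their cube and their square, which reduces
  all later comparisons to polynomial inequalities.\<close>

lemma sample_bound_parts:
  fixes x \<epsilon> L :: real
  assumes "0 < x" "0 < \<epsilon>" "0 < L"
  shows "(x powr (2/3) * L powr (1/3) / \<epsilon> powr (4/3)) ^ 3 = x\<^sup>2 * L / \<epsilon> ^ 4"
    and "(x powr (1/2) * L powr (1/2) / \<epsilon>\<^sup>2)\<^sup>2 = x * L / \<epsilon> ^ 4"
  using assms by (simp_all add: power_mult_distrib power_divide powr_power powr_numeral flip: power_mult)

subsection \<open>Second moment of the likelihood ratio\<close>

definition sgn_bit :: "bool \<Rightarrow> real" where "sgn_bit b = (if b then 1 else -1)"

text \<open>The mean, over a fair bit, of the product of two densities. The linear terms cancel,
  which is why only products of two biases enter \<open>second_moment\<close>.\<close>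

lemma sum_bit_products:
  fixes f g :: "'i \<Rightarrow> real"
  shows "(\<Sum>b\<in>UNIV. ((1 + f i * sgn_bit b) / 2) * (1 + g i * sgn_bit b)) = 1 + f i * g i"
  by (simp add: UNIV_bool sgn_bit_def field_simps)

lemma prod_list_mult:
  "(\<Prod>x\<leftarrow>xs. f x) * (\<Prod>x\<leftarrow>xs. g x) = (\<Prod>x\<leftarrow>xs. f x * g x :: real)"
  by (induction xs) (auto simp: algebra_simps)

lemma sum_swap3:
  "(\<Sum>z\<in>A. \<Sum>t\<in>B. \<Sum>t'\<in>C. F z t t') = (\<Sum>t\<in>B. \<Sum>t'\<in>C. \<Sum>z\<in>A. F z t t')"
  by (subst sum.swap, intro sum.cong refl, rule sum.swap)

text \<open>The parameter \<open>t\<close> is drawn from the prior \<open>\<pi>\<close>. The pair \<open>i\<close> has mass \<open>w t i\<close>, which is split in the ratio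
  \<open>1 + v t i\<close> to \<open>1 - v t i\<close> by \<open>p\<close>, the other way round by \<open>q\<close>, and evenly under the null hypothesis.\<close>

locale pair_family =
  fixes M :: nat and \<Theta> :: "'t set" and \<pi> :: "'t \<Rightarrow> real" and w v :: "'t \<Rightarrow> nat \<Rightarrow> real"
  assumes finite_params: "finite \<Theta>"
    and prior_nonneg: "\<And>t. t \<in> \<Theta> \<Longrightarrow> 0 \<le> \<pi> t"
    and prior_sum: "sum \<pi> \<Theta> = 1"
    and w_pos: "\<And>t i. t \<in> \<Theta> \<Longrightarrow> i < M \<Longrightarrow> 0 < w t i"
    and w_sum: "\<And>t. t \<in> \<Theta> \<Longrightarrow> sum (w t) {..<M} = 1"
    and v_bound: "\<And>t i. t \<in> \<Theta> \<Longrightarrow> i < M \<Longrightarrow> \<bar>v t i\<bar> \<le> 1"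
begin

definition "index_prob t us = (\<Prod>i\<leftarrow>us. w t i)"
definition "mixed_index_prob us = (\<Sum>t\<in>\<Theta>. \<pi> t * index_prob t us)"
text \<open>The mean of the squared likelihood ratio \<open>alt_prob\<close> /
  \<open>null_prob\<close> under \<open>null_prob\<close>, with the bits already summed out
  (\<open>sum_alt_prob_square\<close>). The masses \<open>w t\<close> may depend on
  \<open>t\<close>, so the denominator is a mixture too.\<close>

definition "second_moment N = (\<Sum>us\<in>words {..<M} N.
  (\<Sum>t\<in>\<Theta>. \<Sum>t'\<in>\<Theta>. \<pi> t * \<pi> t' * index_prob t us * index_prob t' us * (\<Prod>i\<leftarrow>us. 1 + v t i * v t' i))
    / mixed_index_prob us)"

definition null_prob :: "(nat \<times> bool) list \<Rightarrow> real" where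
  "null_prob zs = (\<Sum>t\<in>\<Theta>. \<pi> t * (\<Prod>(i, b)\<leftarrow>zs. w t i / 2))"
definition alt_prob :: "(nat \<times> bool) list \<Rightarrow> real" where
  "alt_prob zs = (\<Sum>t\<in>\<Theta>. \<pi> t * (\<Prod>(i, b)\<leftarrow>zs. w t i * (1 + v t i * sgn_bit b) / 2))"

lemma mixed_index_prob_pos:
  assumes "us \<in> words {..<M} N"
  shows "0 < mixed_index_prob us"
proof -
  have pos: "0 < index_prob t us" if "t \<in> \<Theta>" for t
    using assms w_pos[OF that] unfolding index_prob_def words_def
    by (induction us arbitrary: N) auto
  have "\<exists>t\<in>\<Theta>. 0 < \<pi> t"
    using prior_sum sum_nonpos[of \<Theta> \<pi>] by force
  then obtain t where t: "t \<in> \<Theta>" "0 < \<pi> t" by blast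
  show ?thesis unfolding mixed_index_prob_def
    by (rule sum_pos2[OF finite_params t(1)])
      (use t pos prior_nonneg in \<open>auto intro!: mult_nonneg_nonneg less_imp_le[OF pos]\<close>)
qed

abbreviation "Z N \<equiv> words ({..<M} \<times> (UNIV::bool set)) N"

lemma null_prob_eq:
  "zs \<in> Z N \<Longrightarrow> null_prob zs = mixed_index_prob (map fst zs) / 2 ^ N"
proof -
  assume "zs \<in> Z N"
  then have len: "length zs = N" by (simp add: words_def)
  have "(\<Prod>(i, b)\<leftarrow>zs. w t i / 2) = index_prob t (map fst zs) / 2 ^ length zs" for t
    unfolding index_prob_def by (induction zs) (auto simp: case_prod_unfold)
  then show ?thesis
    by (simp add: null_prob_def mixed_index_prob_def len sum_divide_distrib)
qed

lemma fst_in_words: "zs \<in> Z N \<Longrightarrow> map fst zs \<in> words {..<M} N"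
  by (auto simp: words_def)

lemma null_prob_pos: "zs \<in> Z N \<Longrightarrow> 0 < null_prob zs"
  using mixed_index_prob_pos[OF fst_in_words] by (simp add: null_prob_eq)

lemma sum_null_prob: "(\<Sum>zs\<in>Z N. null_prob zs) = 1"
proof -
  have "(\<Sum>z\<in>{..<M} \<times> (UNIV::bool set). case z of (i, b) \<Rightarrow> w t i / 2) = 1" if "t \<in> \<Theta>" for t
    using w_sum[OF that] by (simp add: sum.cartesian_product[symmetric] UNIV_bool)
  then have "(\<Sum>zs\<in>Z N. \<Prod>(i, b)\<leftarrow>zs. w t i / 2) = 1" if "t \<in> \<Theta>" for t
    using that by (subst sum_words_prod_list) auto
  then show ?thesis
    unfolding null_prob_def
    by (subst sum.swap) (simp add: prior_sum flip: sum_distrib_left)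
qed

lemma sum_alt_prob: "(\<Sum>zs\<in>Z N. alt_prob zs) = 1"
proof -
  have "(\<Sum>z\<in>{..<M} \<times> (UNIV::bool set). case z of (i, b) \<Rightarrow> w t i * (1 + v t i * sgn_bit b) / 2)
     = sum (w t) {..<M}" for t
    unfolding sum.cartesian_product[symmetric]
    by (intro sum.cong) (auto simp: UNIV_bool sgn_bit_def field_simps)
  then have "(\<Sum>zs\<in>Z N. \<Prod>(i, b)\<leftarrow>zs. w t i * (1 + v t i * sgn_bit b) / 2) = 1" if "t \<in> \<Theta>" for t
    using that w_sum by (subst sum_words_prod_list) auto
  then show ?thesis
    unfolding alt_prob_def
    by (subst sum.swap) (simp add: prior_sum flip: sum_distrib_left)
qed

text \<open>The power of 2 from the denominator cancels the halves of one of the two densities. What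
  remains at each position is the summand of \<open>sum_bit_products\<close>.\<close>

lemma alt_prob_square:
  assumes "zs \<in> Z N"
  shows "(alt_prob zs)\<^sup>2 / null_prob zs = (\<Sum>t\<in>\<Theta>. \<Sum>t'\<in>\<Theta>. \<pi> t * \<pi> t' *
     (index_prob t (map fst zs) * index_prob t' (map fst zs) / mixed_index_prob (map fst zs)) *
     (\<Prod>z\<leftarrow>zs. ((1 + v t (fst z) * sgn_bit (snd z)) / 2) * (1 + v t' (fst z) * sgn_bit (snd z))))"
proof -
  let ?F = "\<lambda>t (z::nat \<times> bool). 1 + v t (fst z) * sgn_bit (snd z)"
  have len: "length zs = N" using assms by (simp add: words_def)
  have eq: "(\<Prod>(i, b)\<leftarrow>zs. w t i * (1 + v t i * sgn_bit b) / 2) =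
      index_prob t (map fst zs) * (\<Prod>z\<leftarrow>zs. ?F t z / 2)" for t
    unfolding index_prob_def by (induction zs) (auto simp: case_prod_unfold)
  have half: "(\<Prod>z\<leftarrow>zs. ?F t z) = 2 ^ N * (\<Prod>z\<leftarrow>zs. ?F t z / 2)" for t
    unfolding len[symmetric] by (induction zs) auto
  have "(alt_prob zs)\<^sup>2 / null_prob zs =
     (\<Sum>t\<in>\<Theta>. \<Sum>t'\<in>\<Theta>. (\<pi> t * (index_prob t (map fst zs) * (\<Prod>z\<leftarrow>zs. ?F t z / 2))) *
        (\<pi> t' * (index_prob t' (map fst zs) * (\<Prod>z\<leftarrow>zs. ?F t' z / 2)))) / (mixed_index_prob (map fst zs) / 2 ^ N)"
    unfolding alt_prob_def null_prob_eq[OF assms] eq power2_eq_square sum_product ..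
  also have "\<dots> = (\<Sum>t\<in>\<Theta>. \<Sum>t'\<in>\<Theta>. \<pi> t * \<pi> t' *
     (index_prob t (map fst zs) * index_prob t' (map fst zs) / mixed_index_prob (map fst zs)) *
     ((\<Prod>z\<leftarrow>zs. ?F t z / 2) * (\<Prod>z\<leftarrow>zs. ?F t' z)))"
    unfolding half sum_divide_distrib by (simp add: ac_simps)
  finally show ?thesis by (simp only: prod_list_mult)
qed

lemma sum_alt_prob_square: "(\<Sum>zs\<in>Z N. (alt_prob zs)\<^sup>2 / null_prob zs) = second_moment N"
proof -
  have "(\<Sum>zs\<in>Z N. (alt_prob zs)\<^sup>2 / null_prob zs) =
    (\<Sum>t\<in>\<Theta>. \<Sum>t'\<in>\<Theta>. \<Sum>zs\<in>Z N. \<pi> t * \<pi> t' *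
     (index_prob t (map fst zs) * index_prob t' (map fst zs) / mixed_index_prob (map fst zs)) *
     (\<Prod>z\<leftarrow>zs. ((1 + v t (fst z) * sgn_bit (snd z)) / 2) * (1 + v t' (fst z) * sgn_bit (snd z))))"
    by (rule trans[OF sum.cong[OF refl alt_prob_square] sum_swap3])
  also have "\<dots> = (\<Sum>t\<in>\<Theta>. \<Sum>t'\<in>\<Theta>. \<Sum>us\<in>words {..<M} N. \<pi> t * \<pi> t' *
     (index_prob t us * index_prob t' us / mixed_index_prob us) * (\<Prod>i\<leftarrow>us. 1 + v t i * v t' i))"
    by (subst sum_words_times) (simp_all only: fst_conv snd_conv sum_bit_products finite_lessThan finite)
  also have "\<dots> = second_moment N"
    unfolding second_moment_def sum_divide_distrib
    by (rule trans[OF sum_swap3[symmetric]]) (simp add: ac_simps)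
  finally show ?thesis .
qed

text \<open>Here \<open>\<rho>\<close> is a rejection probability. By Cauchy-Schwarz under the null
  law, the squared difference of its two means is at most the chi-square divergence
  \<open>second_moment N - 1\<close> times the null mean of its square. The latter is at most
  \<open>\<delta>\<close> because values of \<open>\<rho>\<close> are at most 1; this factor
  \<open>\<delta>\<close> is the source of the logarithm of \<open>1 / \<delta>\<close>.\<close>

lemma distinguishing_bound:
  assumes r01: "\<And>zs. 0 \<le> \<rho> zs \<and> \<rho> zs \<le> 1"
    and null: "(\<Sum>zs\<in>Z N. null_prob zs * \<rho> zs) \<le> \<delta>"
    and alt: "1 - \<delta> \<le> (\<Sum>zs\<in>Z N. alt_prob zs * \<rho> zs)"
    and d: "0 < \<delta>" "\<delta> < 1 / 2"
  shows "(1 - 2 * \<delta>)\<^sup>2 / \<delta> \<le> second_moment N - 1"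
proof -
  define D where "D zs = alt_prob zs - null_prob zs" for zs
  have sum_D_square: "(\<Sum>zs\<in>Z N. (D zs / sqrt (null_prob zs))\<^sup>2) = second_moment N - 1"
  proof -
    have "(\<Sum>zs\<in>Z N. (D zs / sqrt (null_prob zs))\<^sup>2) =
        (\<Sum>zs\<in>Z N. (alt_prob zs)\<^sup>2 / null_prob zs - 2 * alt_prob zs + null_prob zs)"
    proof (intro sum.cong refl)
      fix zs assume "zs \<in> Z N"
      from null_prob_pos[OF this]
      show "(D zs / sqrt (null_prob zs))\<^sup>2 = (alt_prob zs)\<^sup>2 / null_prob zs - 2 * alt_prob zs + null_prob zs"
        by (simp add: D_def power_divide field_simps power2_eq_square)
    qed
    also have "\<dots> = second_moment N - 1"
      by (simp add: sum.distrib sum_subtractf sum_alt_prob_square sum_null_prob sum_alt_prob flip: sum_distrib_left)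
    finally show ?thesis .
  qed
  have "(\<Sum>zs\<in>Z N. (sqrt (null_prob zs) * \<rho> zs)\<^sup>2) \<le> (\<Sum>zs\<in>Z N. null_prob zs * \<rho> zs)"
  proof (intro sum_mono)
    fix zs assume "zs \<in> Z N"
    note pos = null_prob_pos[OF this]
    have "(\<rho> zs)\<^sup>2 \<le> \<rho> zs"
      using r01[of zs] by (simp add: power2_eq_square mult_left_le)
    then show "(sqrt (null_prob zs) * \<rho> zs)\<^sup>2 \<le> null_prob zs * \<rho> zs"
      using pos by (simp add: power_mult_distrib)
  qed
  with null have sum_rho: "(\<Sum>zs\<in>Z N. (sqrt (null_prob zs) * \<rho> zs)\<^sup>2) \<le> \<delta>" by linarith
  have "1 - 2 * \<delta> \<le> (\<Sum>zs\<in>Z N. D zs * \<rho> zs)"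
    using null alt by (simp add: D_def algebra_simps sum_subtractf)
  then have "(1 - 2 * \<delta>)\<^sup>2 \<le> (\<Sum>zs\<in>Z N. D zs * \<rho> zs)\<^sup>2"
    using d by (intro power_mono) auto
  also have "(\<Sum>zs\<in>Z N. D zs * \<rho> zs) = (\<Sum>zs\<in>Z N. D zs / sqrt (null_prob zs) * (sqrt (null_prob zs) * \<rho> zs))"
    using null_prob_pos by (intro sum.cong) (auto dest: less_imp_neq[THEN not_sym])
  also have "\<dots>\<^sup>2 \<le> (\<Sum>zs\<in>Z N. (D zs / sqrt (null_prob zs))\<^sup>2) * (\<Sum>zs\<in>Z N. (sqrt (null_prob zs) * \<rho> zs)\<^sup>2)"
    by (rule Cauchy_Schwarz_ineq_sum)
  also have "\<dots> \<le> (second_moment N - 1) * \<delta>"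
    unfolding sum_D_square[symmetric] by (intro mult_left_mono sum_rho sum_nonneg) auto
  finally show ?thesis using d by (simp add: field_simps)
qed

end

text \<open>With the bits of the samples from \<open>q\<close> negated, all samples have the same law, under both hypotheses.\<close>

definition pair_code :: "nat \<times> bool \<Rightarrow> nat" where
  "pair_code z = 2 * fst z + (if snd z then 1 else 2)"

lemma inj_pair_code: "inj pair_code"
  by (auto simp: inj_def pair_code_def split: if_splits) presburger+

definition negate_bit :: "nat \<times> bool \<Rightarrow> nat \<times> bool" where "negate_bit z = (fst z, \<not> snd z)"

lemma negate_bit_negate_bit [simp]: "negate_bit (negate_bit z) = z"
  by (simp add: negate_bit_def)

lemma inj_negate_bit: "inj negate_bit"
  by (metis negate_bit_negate_bit injI)

text \<open>All samples can be decoded to independent samples of the same \<open>P\<close>, so the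
  lower bounds depend on \<open>a\<close> and \<open>b\<close> only through
  \<open>a + b\<close>.\<close>

lemma verdict_pair_code:
  "verdict a b A (map_pmf pair_code P) (map_pmf (pair_code \<circ> negate_bit) P) =
     bind_pmf (replicate_pmf (a + b) P)
       (\<lambda>zs. A (map pair_code (take a zs)) (map (pair_code \<circ> negate_bit) (drop a zs)))"
proof -
  have "bind_pmf (replicate_pmf (a + b) P)
       (\<lambda>zs. A (map pair_code (take a zs)) (map (pair_code \<circ> negate_bit) (drop a zs))) =
    bind_pmf (replicate_pmf a P) (\<lambda>xs. bind_pmf (replicate_pmf b P) (\<lambda>ys.
       A (map pair_code (take a (xs @ ys))) (map (pair_code \<circ> negate_bit) (drop a (xs @ ys)))))"
    unfolding replicate_pmf_distrib by (simp add: bind_assoc_pmf bind_return_pmf)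
  also have "\<dots> = bind_pmf (replicate_pmf a P) (\<lambda>xs. bind_pmf (replicate_pmf b P) (\<lambda>ys.
       A (map pair_code xs) (map (pair_code \<circ> negate_bit) ys)))"
    by (intro bind_pmf_cong refl) (auto simp: set_replicate_pmf)
  finally show ?thesis
    unfolding verdict_def replicate_pmf_map by (simp add: bind_map_pmf)
qed

context pair_family
begin

lemma w_nonneg: "t \<in> \<Theta> \<Longrightarrow> i < M \<Longrightarrow> 0 \<le> w t i"
  using w_pos by (simp add: less_imp_le)

text \<open>The bias \<open>u\<close> is arbitrary so that \<open>u = 0\<close> covers the null
  hypothesis and \<open>u = v t\<close> the alternative.\<close>

lemma ex_alt_pmf:
  assumes "t \<in> \<Theta>" "\<And>i. i < M \<Longrightarrow> \<bar>u i\<bar> \<le> 1"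
  shows "\<exists>P. set_pmf P \<subseteq> {..<M} \<times> UNIV \<and>
    (\<forall>i<M. \<forall>b. pmf P (i, b) = w t i * (1 + u i * sgn_bit b) / 2)"
proof -
  have "\<exists>P. set_pmf P \<subseteq> {..<M} \<times> (UNIV::bool set) \<and>
    (\<forall>z\<in>{..<M} \<times> UNIV. pmf P z = (case z of (i, b) \<Rightarrow> w t i * (1 + u i * sgn_bit b) / 2))"
  proof (rule ex_pmf_of_weights)
    show "0 \<le> (case z of (i, b) \<Rightarrow> w t i * (1 + u i * sgn_bit b) / 2)" if "z \<in> {..<M} \<times> UNIV" for z
      using that assms(2)[of "fst z"] w_nonneg[OF assms(1), of "fst z"]
      by (auto simp: sgn_bit_def abs_le_iff case_prod_unfold intro!: divide_nonneg_nonneg mult_nonneg_nonneg)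
    have "sum (\<lambda>(i, b). w t i * (1 + u i * sgn_bit b) / 2) ({..<M} \<times> (UNIV::bool set)) = sum (w t) {..<M}"
      unfolding sum.cartesian_product[symmetric]
      by (intro sum.cong) (auto simp: UNIV_bool sgn_bit_def field_simps)
    then show "sum (\<lambda>(i, b). w t i * (1 + u i * sgn_bit b) / 2) ({..<M} \<times> (UNIV::bool set)) = 1"
      by (simp add: w_sum assms(1))
  qed auto
  then show ?thesis by force
qed

lemma pair_code_dists:
  assumes "set_pmf P \<subseteq> {..<M} \<times> UNIV" "2 * M \<le> n"
  shows "map_pmf pair_code P \<in> dists n" "map_pmf (pair_code \<circ> negate_bit) P \<in> dists n"
  using assms by (fastforce simp: dists_def pair_code_def negate_bit_def)+

lemma second_moment_tester_bound:
  assumes tester: "closeness_tester n \<epsilon> \<delta> a b A" and Mn: "2 * M \<le> n"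
    and far: "\<And>t. t \<in> \<Theta> \<Longrightarrow> \<epsilon> \<le> (\<Sum>i<M. w t i * \<bar>v t i\<bar>)"
    and d: "0 < \<delta>" "\<delta> < 1 / 2"
  shows "(1 - 2 * \<delta>)\<^sup>2 / \<delta> \<le> second_moment (a + b) - 1"
proof -
  define \<rho> where "\<rho> zs = pmf (A (map pair_code (take a zs)) (map (pair_code \<circ> negate_bit) (drop a zs))) False" for zs
  have verdict_eq: "pmf (verdict a b A (map_pmf pair_code P) (map_pmf (pair_code \<circ> negate_bit) P)) False =
      (\<Sum>zs\<in>Z (a + b). (\<Prod>z\<leftarrow>zs. pmf P z) * \<rho> zs)" if "set_pmf P \<subseteq> {..<M} \<times> UNIV" for P
    unfolding verdict_pair_code pmf_bind \<rho>_def
    by (rule expectation_replicate_pmf) (use that in auto)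
  have prod_eq: "(\<Prod>z\<leftarrow>zs. pmf P z) = (\<Prod>(i, b)\<leftarrow>zs. w t i * (1 + u i * sgn_bit b) / 2)"
    if "zs \<in> Z N" "\<forall>i<M. \<forall>b. pmf P (i, b) = w t i * (1 + u i * sgn_bit b) / 2" for zs P t u N
    using that by (intro arg_cong[of _ _ prod_list] map_cong) (auto simp: words_def)
  have null: "(\<Sum>zs\<in>Z (a + b). (\<Prod>(i, b)\<leftarrow>zs. w t i / 2) * \<rho> zs) \<le> \<delta>" if t: "t \<in> \<Theta>" for t
  proof -
    obtain P where P: "set_pmf P \<subseteq> {..<M} \<times> UNIV"
      "\<forall>i<M. \<forall>b. pmf P (i, b) = w t i * (1 + 0 * sgn_bit b) / 2"
      using ex_alt_pmf[OF t, of "\<lambda>_. 0"] by auto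
    then have half: "pmf P (i, b) = w t i / 2" if "i < M" for i b using that by simp
    \<comment> \<open>An unbiased \<open>P\<close> is invariant under negation of the bits, so the
      two distributions coincide and the tester has to accept.\<close>
    have "map_pmf negate_bit P = P"
    proof (rule pmf_eqI)
      fix z
      have "pmf (map_pmf negate_bit P) (negate_bit (negate_bit z)) = pmf P (negate_bit z)"
        by (rule pmf_map_inj') (rule inj_negate_bit)
      moreover have "pmf P (negate_bit z) = pmf P z"
      proof (cases "fst z < M")
        case True then show ?thesis by (cases z) (simp add: negate_bit_def half)
      next
        case False
        then have "z \<notin> set_pmf P" "negate_bit z \<notin> set_pmf P" using P by (cases z; force simp: negate_bit_def)+
        then show ?thesis by (metis pmf_eq_0_set_pmf)
      qed
      ultimately show "pmf (map_pmf negate_bit P) z = pmf P z" by simp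
    qed
    then have "map_pmf (pair_code \<circ> negate_bit) P = map_pmf pair_code P"
      by (simp flip: pmf.map_comp)
    then have "1 - \<delta> \<le> 1 - pmf (verdict a b A (map_pmf pair_code P) (map_pmf (pair_code \<circ> negate_bit) P)) False"
      using tester pair_code_dists[OF P(1) Mn] by (simp add: closeness_tester_def pmf_bool_False)
    then have "(\<Sum>zs\<in>Z (a + b). (\<Prod>z\<leftarrow>zs. pmf P z) * \<rho> zs) \<le> \<delta>"
      unfolding verdict_eq[OF P(1)] by simp
    then show ?thesis
      using prod_eq[OF _ P(2)] by simp
  qed
  have alt: "1 - \<delta> \<le> (\<Sum>zs\<in>Z (a + b). (\<Prod>(i, b)\<leftarrow>zs. w t i * (1 + v t i * sgn_bit b) / 2) * \<rho> zs)"
    if t: "t \<in> \<Theta>" for t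
  proof -
    obtain P where P: "set_pmf P \<subseteq> {..<M} \<times> UNIV"
      "\<forall>i<M. \<forall>b. pmf P (i, b) = w t i * (1 + v t i * sgn_bit b) / 2"
      using ex_alt_pmf[OF t, of "v t"] v_bound[OF t] by auto
    let ?p = "map_pmf pair_code P" and ?q = "map_pmf (pair_code \<circ> negate_bit) P"
    have p: "pmf ?p (pair_code z) = pmf P z" for z
      by (rule pmf_map_inj'[OF inj_pair_code])
    have q: "pmf ?q (pair_code z) = pmf P (negate_bit z)" for z
    proof -
      have "pmf ?q ((pair_code \<circ> negate_bit) (negate_bit z)) = pmf P (negate_bit z)"
        by (rule pmf_map_inj') (intro inj_compose inj_pair_code inj_negate_bit)
      then show ?thesis by simp
    qed
    \<comment> \<open>Both elements of a pair contribute the same difference, which cancels the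
      factor 1/2 of \<open>d_TV\<close>.\<close>
    have "2 * \<epsilon> \<le> (\<Sum>i<M. \<Sum>b\<in>(UNIV::bool set). w t i * \<bar>v t i\<bar>)"
      using far[OF t] by (simp flip: sum_distrib_left)
    also have "\<dots> = (\<Sum>z\<in>{..<M} \<times> UNIV. \<bar>pmf P z - pmf P (negate_bit z)\<bar>)"
      unfolding sum.cartesian_product
    proof (intro sum.cong refl, clarify)
      fix i and b :: bool assume "i < M"
      have "pmf P (i, b) - pmf P (negate_bit (i, b)) = w t i * v t i * sgn_bit b"
        by (cases b) (simp_all add: P(2)[rule_format, OF \<open>i < M\<close>] negate_bit_def sgn_bit_def field_simps)
      then show "w t i * \<bar>v t i\<bar> = \<bar>pmf P (i, b) - pmf P (negate_bit (i, b))\<bar>"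
        using w_nonneg[OF t \<open>i < M\<close>] by (simp add: abs_mult sgn_bit_def)
    qed
    also have "\<dots> = (\<Sum>x\<in>pair_code ` ({..<M} \<times> UNIV). \<bar>pmf ?p x - pmf ?q x\<bar>)"
      by (subst sum.reindex) (auto simp: p q intro: inj_on_subset[OF inj_pair_code])
    also have "\<dots> \<le> (\<Sum>x=1..n. \<bar>pmf ?p x - pmf ?q x\<bar>)"
      using Mn by (intro sum_mono2) (auto simp: pair_code_def)
    finally have "\<epsilon> \<le> d_TV n ?p ?q" by (simp add: d_TV_def)
    then have "1 - \<delta> \<le> pmf (verdict a b A ?p ?q) False"
      using tester pair_code_dists[OF P(1) Mn] by (simp add: closeness_tester_def)
    then show ?thesis
      unfolding verdict_eq[OF P(1)] using prod_eq[OF _ P(2)] by simp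
  qed
  \<comment> \<open>The error bounds hold for every parameter, hence also on average over the
    prior.\<close>
  show ?thesis
  proof (rule distinguishing_bound)
    show "0 \<le> \<rho> zs \<and> \<rho> zs \<le> 1" for zs
      by (simp add: \<rho>_def pmf_le_1)
    have "(\<Sum>zs\<in>Z (a + b). null_prob zs * \<rho> zs) =
        (\<Sum>t\<in>\<Theta>. \<pi> t * (\<Sum>zs\<in>Z (a + b). (\<Prod>(i, b)\<leftarrow>zs. w t i / 2) * \<rho> zs))"
      unfolding null_prob_def sum_distrib_right sum_distrib_left
      by (subst sum.swap) (simp add: mult.assoc)
    also have "\<dots> \<le> (\<Sum>t\<in>\<Theta>. \<pi> t * \<delta>)"
      by (intro sum_mono mult_left_mono null prior_nonneg)
    finally show "(\<Sum>zs\<in>Z (a + b). null_prob zs * \<rho> zs) \<le> \<delta>"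
      by (simp add: prior_sum flip: sum_distrib_right)
    have "(\<Sum>t\<in>\<Theta>. \<pi> t * (1 - \<delta>)) \<le>
        (\<Sum>t\<in>\<Theta>. \<pi> t * (\<Sum>zs\<in>Z (a + b). (\<Prod>(i, b)\<leftarrow>zs. w t i * (1 + v t i * sgn_bit b) / 2) * \<rho> zs))"
      by (intro sum_mono mult_left_mono alt prior_nonneg)
    also have "\<dots> = (\<Sum>zs\<in>Z (a + b). alt_prob zs * \<rho> zs)"
      unfolding alt_prob_def sum_distrib_right sum_distrib_left
      by (subst (2) sum.swap) (simp add: mult.assoc)
    finally show "1 - \<delta> \<le> (\<Sum>zs\<in>Z (a + b). alt_prob zs * \<rho> zs)"
      by (simp add: prior_sum flip: sum_distrib_right)
  qed fact+
qed

text \<open>With \<open>\<kappa>\<close> for the squared constant, the second moment is at least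
  \<open>1 + \<kappa> / \<delta>\<close>. Bernoulli's inequality turns this into a power of
  \<open>1 / \<delta>\<close> with exponent \<open>\<kappa>\<close>, so that \<open>\<kappa>\<close>
  becomes a factor in front of the logarithm. The logarithm of \<open>\<kappa> / \<delta>\<close>
  itself would be worthless where \<open>\<kappa> \<le> \<delta>\<close>.\<close>

lemma second_moment_exp_tester_bound:
  assumes "closeness_tester n \<epsilon> \<delta> a b A" "2 * M \<le> n"
    and "\<And>t. t \<in> \<Theta> \<Longrightarrow> \<epsilon> \<le> (\<Sum>i<M. w t i * \<bar>v t i\<bar>)"
    and d: "0 < \<delta>" "\<delta> \<le> \<delta>\<^sub>0" "\<delta>\<^sub>0 < 1 / 2"
    and le: "second_moment (a + b) \<le> exp x"
  shows "(1 - 2 * \<delta>\<^sub>0)\<^sup>2 * ln (1 / \<delta>) \<le> x"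
proof -
  define \<kappa> where "\<kappa> = (1 - 2 * \<delta>\<^sub>0)\<^sup>2"
  have "1 - 2 * \<delta>\<^sub>0 \<le> 1" "0 < 1 - 2 * \<delta>\<^sub>0" using d by auto
  then have k: "0 < \<kappa>" "\<kappa> \<le> 1" by (auto simp: \<kappa>_def power_le_one)
  have "(1 / \<delta>) powr \<kappa> \<le> (1 + 1 / \<delta>) powr \<kappa>"
    using d k by (intro powr_mono2) auto
  \<comment> \<open>Young's inequality with second factor 1 is Bernoulli's inequality for an
    exponent in [0,1].\<close>
  also have "\<dots> = (1 + 1 / \<delta>) powr \<kappa> * 1 powr (1 - \<kappa>)"
    by simp
  also have "\<dots> \<le> \<kappa> * (1 + 1 / \<delta>) + (1 - \<kappa>) * 1"
    by (rule Youngs_inequality_0) (use d k in \<open>auto intro: add_pos_pos\<close>)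
  also have "\<dots> = 1 + \<kappa> * (1 / \<delta>)"
    by (simp add: algebra_simps)
  also have "\<kappa> * (1 / \<delta>) \<le> (1 - 2 * \<delta>)\<^sup>2 / \<delta>"
    using d by (auto simp: \<kappa>_def divide_simps intro!: power_mono)
  also have "1 + \<dots> \<le> second_moment (a + b)"
    using second_moment_tester_bound[OF assms(1-3)] d by auto
  also have "\<dots> \<le> exp x" by (rule le)
  finally have "ln ((1 / \<delta>) powr \<kappa>) \<le> ln (exp x)"
    using d by (subst ln_le_cancel_iff) auto
  then show ?thesis using d by (simp add: \<kappa>_def ln_powr)
qed

end

subsection \<open>Biased pairs of equal mass\<close>

text \<open>A subset of \<open>A\<close> encodes a vector of signs; the factorization expresses that
  the coordinates of a uniform vector are independent.\<close>

lemma sum_Pow_prod: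
  fixes f :: "'i \<Rightarrow> bool \<Rightarrow> 'a::comm_semiring_1"
  assumes "finite A"
  shows "(\<Sum>S\<in>Pow A. \<Prod>i\<in>A. f i (i \<in> S)) = (\<Prod>i\<in>A. f i True + f i False)"
proof -
  have "(\<Prod>i\<in>A. f i True + f i False) = (\<Sum>S\<in>Pow A. (\<Prod>i\<in>S. f i True) * (\<Prod>i\<in>A - S. f i False))"
    by (rule prod_add[OF assms])
  also have "\<dots> = (\<Sum>S\<in>Pow A. \<Prod>i\<in>A. f i (i \<in> S))"
  proof (intro sum.cong refl)
    fix S assume "S \<in> Pow A"
    then have "(\<Prod>i\<in>A. f i (i \<in> S)) = (\<Prod>i\<in>S. f i (i \<in> S)) * (\<Prod>i\<in>A - S. f i (i \<in> S))"
      using prod.subset_diff[OF _ assms, of S "\<lambda>i. f i (i \<in> S)"] by (simp add: mult.commute)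
    also have "\<dots> = (\<Prod>i\<in>S. f i True) * (\<Prod>i\<in>A - S. f i False)"
      by (intro arg_cong2[of _ _ _ _ "(*)"] prod.cong) auto
    finally show "(\<Prod>i\<in>S. f i True) * (\<Prod>i\<in>A - S. f i False) = (\<Prod>i\<in>A. f i (i \<in> S))" ..
  qed
  finally show ?thesis ..
qed

lemma exp_avg_le: "(exp c + exp (- c)) / 2 \<le> exp (c\<^sup>2 / 2)" for c :: real
proof -
  have *: "(exp c + exp (- c)) / 2 \<le> exp (c\<^sup>2 / 2)" if "c \<ge> 0" for c :: real
  proof -
    \<comment> \<open>Hoeffding's lemma for a fair coin whose two values differ by
      \<open>2 * c\<close>.\<close>
    have "- (2 * c) * (1/2) + ln (1 + (1/2) * (exp (2 * c) - 1)) \<le> (2 * c)\<^sup>2 / 8"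
      by (rule Hoeffdings_lemma_aux) (use that in auto)
    then have "ln ((1 + exp (2 * c)) / 2) \<le> c + c\<^sup>2 / 2"
      by (simp add: field_simps power2_eq_square)
    then have "exp (ln ((1 + exp (2 * c)) / 2)) \<le> exp (c + c\<^sup>2 / 2)"
      by simp
    then have "(1 + exp (2 * c)) / 2 \<le> exp (c + c\<^sup>2 / 2)"
      by (subst (asm) exp_ln) (auto intro: add_pos_pos)
    then have "(1 + exp (2 * c)) / 2 * exp (-c) \<le> exp (c + c\<^sup>2 / 2) * exp (-c)"
      by (intro mult_right_mono) auto
    then show ?thesis
      by (simp add: algebra_simps exp_minus_inverse flip: exp_add)
  qed
  show ?thesis using *[of c] *[of "-c"] by (cases "c \<ge> 0") (auto simp: add.commute)
qed

lemma sum_signs_exp_le: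
  fixes d :: "'i \<Rightarrow> real"
  assumes "finite A"
  shows "(\<Sum>S\<in>Pow A. exp (\<Sum>i\<in>A. sgn_bit (i \<in> S) * d i)) / 2 ^ card A \<le> exp ((\<Sum>i\<in>A. (d i)\<^sup>2) / 2)"
proof -
  have "(\<Sum>S\<in>Pow A. exp (\<Sum>i\<in>A. sgn_bit (i \<in> S) * d i)) / 2 ^ card A =
      (\<Sum>S\<in>Pow A. \<Prod>i\<in>A. exp (sgn_bit (i \<in> S) * d i)) / (\<Prod>i\<in>A. 2)"
    using assms by (simp add: exp_sum)
  also have "\<dots> = (\<Prod>i\<in>A. (exp (d i) + exp (- d i)) / 2)"
    by (subst sum_Pow_prod[OF assms, of "\<lambda>i b. exp (sgn_bit b * d i)"]) (simp add: sgn_bit_def prod_dividef)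
  also have "\<dots> \<le> (\<Prod>i\<in>A. exp ((d i)\<^sup>2 / 2))"
    by (intro prod_mono conjI exp_avg_le) (auto intro: add_nonneg_nonneg)
  also have "\<dots> = exp ((\<Sum>i\<in>A. (d i)\<^sup>2) / 2)"
    using assms by (simp add: exp_sum sum_divide_distrib)
  finally show ?thesis .
qed

lemma one_plus_power_le_exp:
  fixes x :: real
  assumes "-1 \<le> x"
  shows "(1 + x) ^ N \<le> exp (real N * x)"
proof -
  have "(1 + x) ^ N \<le> exp x ^ N"
    using assms by (intro power_mono exp_ge_add_one_self) auto
  then show ?thesis by (simp add: exp_of_nat_mult)
qed

text \<open>With equal masses the index probabilities do not depend on the parameter. The mixture in
  the denominator cancels, and each sample contributes an independent factor, the mean of
  \<open>1 + v t i * v t' i\<close> over the pairs.\<close>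

lemma (in pair_family) second_moment_uniform:
  assumes unif: "\<And>t i. t \<in> \<Theta> \<Longrightarrow> i < M \<Longrightarrow> w t i = 1 / M" and M: "0 < M"
  shows "second_moment N = (\<Sum>t\<in>\<Theta>. \<Sum>t'\<in>\<Theta>. \<pi> t * \<pi> t' * (1 + (\<Sum>i<M. v t i * v t' i) / M) ^ N)"
proof -
  have ip: "index_prob t us = 1 / M ^ N" if "t \<in> \<Theta>" "us \<in> words {..<M} N" for t us
  proof -
    have "index_prob t us = (\<Prod>i\<leftarrow>us. 1 / M)"
      using that unif unfolding index_prob_def by (intro arg_cong[of _ _ prod_list] map_cong) (auto simp: words_def)
    then show ?thesis using that by (simp add: words_def power_one_over map_replicate_const)
  qed
  have mp: "mixed_index_prob us = 1 / M ^ N" if "us \<in> words {..<M} N" for us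
    using ip[OF _ that] prior_sum unfolding mixed_index_prob_def
    by (simp flip: sum_divide_distrib)
  have "second_moment N = (\<Sum>us\<in>words {..<M} N. \<Sum>t\<in>\<Theta>. \<Sum>t'\<in>\<Theta>.
      \<pi> t * \<pi> t' * ((1 / M ^ N) * (\<Prod>i\<leftarrow>us. 1 + v t i * v t' i)))"
    unfolding second_moment_def sum_divide_distrib
    by (intro sum.cong refl) (use M in \<open>simp add: ip mp\<close>)
  also have "\<dots> = (\<Sum>t\<in>\<Theta>. \<Sum>t'\<in>\<Theta>. \<pi> t * \<pi> t' * ((1 / M ^ N) * (\<Sum>us\<in>words {..<M} N. \<Prod>i\<leftarrow>us. 1 + v t i * v t' i)))"
    by (subst sum_swap3) (simp add: sum_distrib_left)
  also have "\<dots> = (\<Sum>t\<in>\<Theta>. \<Sum>t'\<in>\<Theta>. \<pi> t * \<pi> t' * (1 + (\<Sum>i<M. v t i * v t' i) / M) ^ N)"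
  proof (intro sum.cong refl arg_cong2[of _ _ _ _ "(*)"])
    fix t t'
    have "(1 / M ^ N) * (\<Sum>us\<in>words {..<M} N. \<Prod>i\<leftarrow>us. 1 + v t i * v t' i) = ((\<Sum>i<M. 1 + v t i * v t' i) / M) ^ N"
      by (simp add: sum_words_prod_list power_divide)
    also have "(\<Sum>i<M. 1 + v t i * v t' i) / M = 1 + (\<Sum>i<M. v t i * v t' i) / M"
      using M by (simp add: sum.distrib field_simps)
    finally show "(1 / M ^ N) * (\<Sum>us\<in>words {..<M} N. \<Prod>i\<leftarrow>us. 1 + v t i * v t' i) = (1 + (\<Sum>i<M. v t i * v t' i) / M) ^ N" .
  qed
  finally show ?thesis .
qed

text \<open>After decoding, the task is to tell one coin of known bias \<open>\<epsilon>\<close>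
  from a fair coin.\<close>

lemma tester_lower_bound_log:
  assumes "closeness_tester n \<epsilon> \<delta> a b A" "2 \<le> n" "0 < \<epsilon>" "\<epsilon> \<le> 1"
    and d: "0 < \<delta>" "\<delta> \<le> \<delta>\<^sub>0" "\<delta>\<^sub>0 < 1 / 2"
  shows "(1 - 2 * \<delta>\<^sub>0)\<^sup>2 * ln (1 / \<delta>) \<le> real (a + b) * \<epsilon>\<^sup>2"
proof -
  interpret pair_family 1 "{()}" "\<lambda>_. 1" "\<lambda>_ _. 1" "\<lambda>_ _. \<epsilon>"
    by unfold_locales (use assms in auto)
  have "second_moment (a + b) = (1 + \<epsilon>\<^sup>2) ^ (a + b)"
    by (subst second_moment_uniform) (auto simp: power2_eq_square)
  also have "\<dots> \<le> exp (real (a + b) * \<epsilon>\<^sup>2)"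
    by (rule one_plus_power_le_exp) (use zero_le_power2[of \<epsilon>] in linarith)
  finally have "second_moment (a + b) \<le> exp (real (a + b) * \<epsilon>\<^sup>2)" .
  then show ?thesis
    by (intro second_moment_exp_tester_bound[OF assms(1) _ _ d]) (use assms in auto)
qed

text \<open>The inner product of two independent sign vectors is a sum of \<open>M\<close> random
  signs. Multiplied by \<open>N * \<epsilon>\<^sup>2 / M\<close> it has variance
  \<open>N\<^sup>2 * \<epsilon> ^ 4 / M\<close>, and \<open>sum_signs_exp_le\<close> yields half of
  the variance as the exponent.\<close>

lemma tester_lower_bound_sqrt:
  assumes "closeness_tester n \<epsilon> \<delta> a b A" "0 < M" "2 * M \<le> n" "0 < \<epsilon>" "\<epsilon> \<le> 1"
    and d: "0 < \<delta>" "\<delta> \<le> \<delta>\<^sub>0" "\<delta>\<^sub>0 < 1 / 2"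
  shows "(1 - 2 * \<delta>\<^sub>0)\<^sup>2 * ln (1 / \<delta>) \<le> (real (a + b))\<^sup>2 * \<epsilon> ^ 4 / (2 * M)"
proof -
  define \<Theta> where "\<Theta> = Pow {..<M}"
  define \<pi> where "\<pi> = (\<lambda>_::nat set. 1 / 2 ^ M :: real)"
  define v where "v S i = \<epsilon> * sgn_bit (i \<in> S)" for S and i :: nat
  define N where "N = a + b"
  interpret pair_family M \<Theta> \<pi> "\<lambda>_ _. 1 / M" v
    by unfold_locales (use assms in \<open>auto simp: \<Theta>_def \<pi>_def v_def sgn_bit_def card_Pow\<close>)
  have abs_v: "\<bar>v S i\<bar> = \<epsilon>" for S i
    using assms by (simp add: v_def sgn_bit_def abs_mult)
  have e: "\<epsilon>\<^sup>2 \<le> 1" using assms by (simp add: power_le_one)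
  define d' where "d' S i = real N * \<epsilon>\<^sup>2 / M * sgn_bit (i \<in> S)" for S and i :: nat
  have "second_moment N = (\<Sum>t\<in>\<Theta>. \<Sum>t'\<in>\<Theta>. \<pi> t * \<pi> t' * (1 + (\<Sum>i<M. v t i * v t' i) / M) ^ N)"
    by (rule second_moment_uniform) (use assms in auto)
  also have "\<dots> \<le> (\<Sum>t\<in>\<Theta>. \<Sum>t'\<in>\<Theta>. \<pi> t * \<pi> t' * exp (\<Sum>i<M. sgn_bit (i \<in> t') * d' t i))"
  proof (intro sum_mono mult_left_mono)
    fix t t' :: "nat set"
    have "\<bar>\<Sum>i<M. v t i * v t' i\<bar> \<le> (\<Sum>i<M. \<epsilon>\<^sup>2)"
      by (rule order.trans[OF sum_abs]) (intro sum_mono, simp add: v_def sgn_bit_def power2_eq_square)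
    then have "\<bar>\<Sum>i<M. v t i * v t' i\<bar> \<le> M * 1"
      using mult_left_mono[OF e, of M] by simp
    then have "-1 \<le> (\<Sum>i<M. v t i * v t' i) / M"
      using assms by (simp add: field_simps abs_le_iff)
    then have "(1 + (\<Sum>i<M. v t i * v t' i) / M) ^ N \<le> exp (N * ((\<Sum>i<M. v t i * v t' i) / M))"
      by (rule one_plus_power_le_exp)
    also have "N * ((\<Sum>i<M. v t i * v t' i) / M) = (\<Sum>i<M. sgn_bit (i \<in> t') * d' t i)"
      by (simp add: sum_distrib_left sum_divide_distrib v_def d'_def power2_eq_square ac_simps)
    finally show "(1 + (\<Sum>i<M. v t i * v t' i) / M) ^ N \<le> exp (\<Sum>i<M. sgn_bit (i \<in> t') * d' t i)" .
  qed (simp add: \<pi>_def)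
  also have "\<dots> = (\<Sum>t\<in>\<Theta>. \<pi> t * ((\<Sum>t'\<in>Pow {..<M}. exp (\<Sum>i<M. sgn_bit (i \<in> t') * d' t i)) / 2 ^ card {..<M}))"
    by (simp add: \<Theta>_def \<pi>_def sum_distrib_left sum_divide_distrib)
  also have "\<dots> \<le> (\<Sum>t\<in>\<Theta>. \<pi> t * exp ((\<Sum>i<M. (d' t i)\<^sup>2) / 2))"
    by (intro sum_mono mult_left_mono sum_signs_exp_le) (auto simp: \<pi>_def)
  also have "\<dots> = (\<Sum>t\<in>\<Theta>. \<pi> t * exp ((real N)\<^sup>2 * \<epsilon> ^ 4 / (2 * M)))"
  proof -
    have "(d' t i)\<^sup>2 = (real N)\<^sup>2 * \<epsilon> ^ 4 / (real M)\<^sup>2" for t i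
      by (simp add: d'_def sgn_bit_def power_mult_distrib power_divide)
    then have "(\<Sum>i<M. (d' t i)\<^sup>2) / 2 = (real N)\<^sup>2 * \<epsilon> ^ 4 / (2 * M)" for t
      using assms by (simp add: power2_eq_square)
    then show ?thesis by (simp only:)
  qed
  also have "\<dots> = exp ((real N)\<^sup>2 * \<epsilon> ^ 4 / (2 * M))"
    using prior_sum by (simp flip: sum_distrib_right)
  finally have "second_moment (a + b) \<le> exp ((real (a + b))\<^sup>2 * \<epsilon> ^ 4 / (2 * M))" unfolding N_def .
  then show ?thesis
    by (intro second_moment_exp_tester_bound[OF assms(1,3) _ d])
       (use assms abs_v in auto)
qed

subsection \<open>Biased light pairs hidden among heavy pairs\<close>

lemma prod_list_eq_prod_count:
  fixes F :: "'i \<Rightarrow> 'a::comm_semiring_1"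
  assumes "finite I" "set us \<subseteq> I"
  shows "(\<Prod>u\<leftarrow>us. F u) = (\<Prod>i\<in>I. F i ^ count_list us i)"
  using assms(2)
proof (induction us)
  case (Cons u us)
  have "(\<Prod>i\<in>I. F i ^ count_list (u # us) i) = (\<Prod>i\<in>I. (if i = u then F u else 1) * F i ^ count_list us i)"
    by (intro prod.cong) auto
  also have "\<dots> = F u * (\<Prod>i\<in>I. F i ^ count_list us i)"
    using Cons.prems assms(1) by (simp add: prod.distrib)
  finally show ?case using Cons by simp
qed simp

definition subset_family :: "'i set \<Rightarrow> nat \<Rightarrow> 'i set \<Rightarrow> 'i set set" where
  "subset_family I k T = {H. H \<subseteq> I \<and> card H = k \<and> H \<inter> T = {}}"

text \<open>The elementary symmetric polynomial of degree \<open>k\<close> in the weights outside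
  \<open>T\<close>. Divided by its value at \<open>T = {}\<close>, it is the probability that a
  random \<open>k\<close>-set, drawn with probability proportional to the product of its weights,
  misses \<open>T\<close>.\<close>

definition subset_weight :: "('i \<Rightarrow> real) \<Rightarrow> 'i set \<Rightarrow> nat \<Rightarrow> 'i set \<Rightarrow> real" where
  "subset_weight \<omega> I k T = (\<Sum>H\<in>subset_family I k T. \<Prod>i\<in>H. \<omega> i)"

lemma finite_subset_family: "finite I \<Longrightarrow> finite (subset_family I k T)"
  unfolding subset_family_def by (rule finite_subset[of _ "Pow I"]) auto

text \<open>Exchange an element \<open>j\<close> of weight 1 of \<open>H\<close>, of which there are at least \<open>k - N\<close>, for \<open>i\<close>.\<close>

lemma subset_weight_exchange:
  assumes fin: "finite I" and nonneg: "\<And>j. j \<in> I \<Longrightarrow> 0 \<le> \<omega> j"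
    and one: "\<And>j. j \<in> I - U \<Longrightarrow> \<omega> j = 1" and U: "finite U" "card U \<le> N"
    and i: "i \<in> I" "i \<notin> T"
  shows "subset_weight \<omega> I k (insert i T) * real (k - N) * \<omega> i \<le> real (card I) * subset_weight \<omega> I k T"
proof -
  let ?B = "subset_family I k (insert i T)" and ?F = "subset_family I k T"
  let ?W = "\<lambda>H. \<Prod>j\<in>H. \<omega> j"
  \<comment> \<open>Recording \<open>j\<close> makes the exchange injective: \<open>H\<close> is
    recovered by putting \<open>j\<close> back and deleting \<open>i\<close>, which was not in
    \<open>H\<close>.\<close>
  define \<phi> where "\<phi> = (\<lambda>(H, j). (insert i (H - {j}), j))"
  have finH: "finite H" "H \<subseteq> I" "card H = k" "i \<notin> H" "H \<inter> T = {}" if "H \<in> ?B" for H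
    using that fin by (auto simp: subset_family_def intro: finite_subset)
  have W0: "0 \<le> ?W H" if "H \<subseteq> I" for H using that nonneg by (intro prod_nonneg) auto
  have "subset_weight \<omega> I k (insert i T) * real (k - N) * \<omega> i = (\<Sum>H\<in>?B. real (k - N) * (\<omega> i * ?W H))"
    by (simp add: subset_weight_def sum_distrib_left sum_distrib_right ac_simps)
  also have "\<dots> \<le> (\<Sum>H\<in>?B. real (card (H - U)) * (\<omega> i * ?W H))"
  proof (intro sum_mono mult_right_mono mult_nonneg_nonneg nonneg i W0 finH)
    fix H assume H: "H \<in> ?B"
    have "k - N \<le> card H - card U" using U finH[OF H] by simp
    also have "\<dots> \<le> card (H - U)" by (rule diff_card_le_card_Diff[OF U(1)])
    finally show "real (k - N) \<le> real (card (H - U))" by simp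
  qed
  also have "\<dots> = (\<Sum>(H, j)\<in>Sigma ?B (\<lambda>H. H - U). \<omega> i * ?W H)"
    using fin by (subst sum.Sigma[symmetric]) (auto intro: finite_subset_family dest: finH)
  also have "\<dots> = (\<Sum>x\<in>Sigma ?B (\<lambda>H. H - U). ?W (fst (\<phi> x)))"
  proof (intro sum.cong refl, clarify)
    fix H j assume H: "H \<in> ?B" and j: "j \<in> H" "j \<notin> U"
    have "?W H = \<omega> j * ?W (H - {j})" using finH[OF H] j by (simp add: prod.remove)
    then have "?W H = ?W (H - {j})" using one j finH[OF H] by auto
    then show "\<omega> i * ?W H = ?W (fst (\<phi> (H, j)))"
      using finH[OF H] by (simp add: \<phi>_def)
  qed
  also have "\<dots> = (\<Sum>x\<in>\<phi> ` Sigma ?B (\<lambda>H. H - U). ?W (fst x))"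
  proof (rule sum.reindex_cong[symmetric, where l = \<phi>])
    show "inj_on \<phi> (Sigma ?B (\<lambda>H. H - U))"
    proof (rule inj_onI, clarify)
      fix H j H' j' assume *: "H \<in> ?B" "j \<in> H" "H' \<in> ?B" "j' \<in> H'" "\<phi> (H, j) = \<phi> (H', j')"
      then have "j = j'" and eq: "insert i (H - {j}) = insert i (H' - {j})" by (auto simp: \<phi>_def)
      have "H = insert j (insert i (H - {j}) - {i})" using * finH(4) by blast
      also have "\<dots> = insert j (insert i (H' - {j}) - {i})" by (simp only: eq)
      also have "\<dots> = H'" using * finH(4) \<open>j = j'\<close> by blast
      finally show "H = H' \<and> j = j'" using \<open>j = j'\<close> by simp
    qed
  qed auto
  also have "\<dots> \<le> (\<Sum>x\<in>?F \<times> I. ?W (fst x))"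
  proof (rule sum_mono2)
    show "\<phi> ` Sigma ?B (\<lambda>H. H - U) \<subseteq> ?F \<times> I"
    proof
      fix x assume "x \<in> \<phi> ` Sigma ?B (\<lambda>H. H - U)"
      then obtain H j where H: "H \<in> ?B" and j: "j \<in> H" "j \<notin> U" and eq: "x = \<phi> (H, j)"
        by auto
      have "card (insert i (H - {j})) = Suc (card (H - {j}))"
        using finH[OF H] by (intro card_insert_disjoint) auto
      also have "\<dots> = k" using finH[OF H] j by (metis card.remove)
      finally show "x \<in> ?F \<times> I"
        using eq i finH[OF H] j by (auto simp: \<phi>_def subset_family_def)
    qed
  qed (auto simp: fin finite_subset_family subset_family_def intro!: W0)
  also have "\<dots> = real (card I) * subset_weight \<omega> I k T"
    by (simp add: subset_weight_def sum.cartesian_product' sum_distrib_left)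
  finally show ?thesis .
qed

text \<open>One exchange for each element of \<open>T\<close>. The probability of missing
  \<open>T\<close> is thus bounded by a product over its elements, as if they were missed
  independently.\<close>

lemma subset_weight_le:
  assumes fin: "finite I" and pos: "\<And>j. j \<in> I \<Longrightarrow> 0 < \<omega> j"
    and one: "\<And>j. j \<in> I - U \<Longrightarrow> \<omega> j = 1" and U: "finite U" "card U \<le> N" and k: "N < k"
    and T: "T \<subseteq> I"
  shows "subset_weight \<omega> I k T \<le> subset_weight \<omega> I k {} * (\<Prod>i\<in>T. real (card I) / real (k - N) / \<omega> i)"
  using finite_subset[OF T fin] T
proof (induction T rule: finite_induct)
  case (insert i T)
  have "subset_weight \<omega> I k (insert i T) * real (k - N) * \<omega> i \<le> real (card I) * subset_weight \<omega> I k T"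
    by (rule subset_weight_exchange[OF fin _ one U]) (use insert pos in \<open>auto intro: less_imp_le\<close>)
  then have "subset_weight \<omega> I k (insert i T) \<le> (real (card I) / real (k - N) / \<omega> i) * subset_weight \<omega> I k T"
    using pos[of i] k insert.prems by (simp add: field_simps)
  also have "\<dots> \<le> (real (card I) / real (k - N) / \<omega> i) *
      (subset_weight \<omega> I k {} * (\<Prod>i\<in>T. real (card I) / real (k - N) / \<omega> i))"
    using pos[of i] insert by (intro mult_left_mono) auto
  finally show ?case using insert by (simp add: ac_simps)
qed simp

text \<open>The even part of \<open>(1 + y)\<^sup>n\<close> is the mean of \<open>(1 + y)\<^sup>n\<close> and \<open>(1 - y)\<^sup>n\<close>. This reduces the sum over all samples
  to powers of sums over single samples with random signs.\<close>

lemma binomial_even_part_ge: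
  fixes y :: real
  assumes "0 \<le> y" "y \<le> 1" "2 \<le> n"
  shows "1 + y\<^sup>2 \<le> ((1 + y) ^ n + (1 - y) ^ n) / 2"
  using assms(3)
proof (induction n rule: dec_induct)
  case base
  then show ?case by (simp add: power2_eq_square field_simps)
next
  case (step n)
  have "(1 - y) ^ n \<le> (1 + y) ^ n" using assms by (intro power_mono) auto
  then have "0 \<le> y * ((1 + y) ^ n - (1 - y) ^ n)" using assms by simp
  then show ?case using step by (simp add: field_simps)
qed

text \<open>For at most one hit both sides are 1. From two hits on, the growth of \<open>g\<close>
  like \<open>2 ^ n\<close> is outweighed by the decay of \<open>1 / r ^ (2 * n)\<close> because
  \<open>2 \<le> r\<^sup>2\<close>. Hence \<open>n = 2\<close> is the worst case, and it determines
  \<open>y\<close>.\<close>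

lemma bias_weight_le:
  fixes r A y :: real
  assumes r: "2 \<le> r\<^sup>2" "0 < r" and y: "0 \<le> y" "y \<le> 1" "y\<^sup>2 = 2 * (A / r\<^sup>2)\<^sup>2"
    and g: "g = (if n = 0 then 1 else 2 ^ (n - 1))"
  shows "1 + (g - 1) * (A / r ^ n)\<^sup>2 \<le> ((1 + y) ^ n + (1 - y) ^ n) / 2"
proof (cases "2 \<le> n")
  case True
  then obtain m where n: "n = m + 2" by (metis add.commute le_Suc_ex)
  have "2 ^ m \<le> (r\<^sup>2) ^ m" using r by (intro power_mono) auto
  then have "2 ^ m / (r ^ m)\<^sup>2 \<le> 1" using r by (simp add: power_mult mult.commute flip: power_mult)
  then have "2 * (A / r\<^sup>2)\<^sup>2 * (2 ^ m / (r ^ m)\<^sup>2) \<le> y\<^sup>2" unfolding y(3) by (intro mult_left_le) auto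
  moreover have "(g - 1) * (A / r ^ n)\<^sup>2 \<le> 2 ^ (m + 1) * (A / r ^ n)\<^sup>2"
    by (intro mult_right_mono) (auto simp: g n)
  moreover have "2 ^ (m + 1) * (A / r ^ n)\<^sup>2 = 2 * (A / r\<^sup>2)\<^sup>2 * (2 ^ m / (r ^ m)\<^sup>2)"
    by (simp add: n power_add power_divide power_mult_distrib)
  ultimately show ?thesis using binomial_even_part_ge[OF y(1,2) True] by linarith
next
  case False
  then have "n = 0 \<or> n = 1" by auto
  then show ?thesis by (auto simp: g)
qed

text \<open>For a pair outside \<open>D\<close> and \<open>D'\<close>, the product \<open>s\<close>
  of the two signs is again a fair sign, and the mean of \<open>(1 + s) ^ n\<close> is
  \<open>2 ^ (n - 1)\<close> for positive \<open>n\<close> and 1 for \<open>n = 0\<close>. A pair in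
  \<open>D\<close> or \<open>D'\<close> is unbiased for one of the two parameters and contributes
  1.\<close>

lemma sum_signs_product:
  assumes "finite I" "set us \<subseteq> I"
  shows "(\<Sum>S\<in>Pow I. \<Sum>S'\<in>Pow I. \<Prod>u\<leftarrow>us.
      1 + (if u \<in> D then 0 else sgn_bit (u \<in> S)) * (if u \<in> D' then 0 else sgn_bit (u \<in> S')))
    = 4 ^ card I * (\<Prod>i\<in>I - (D \<union> D'). if count_list us i = 0 then 1 else 2 ^ (count_list us i - 1))"
proof -
  let ?n = "count_list us"
  define c where "c i = (if i \<in> D \<union> D' then 0 else 1 :: real)" for i
  define g where "g i = (if i \<in> D \<union> D' \<or> ?n i = 0 then 1 else 2 ^ (?n i - 1) :: real)" for i
  have inner: "(1 + c i * s) ^ ?n i + (1 - c i * s) ^ ?n i = 2 * g i" if "s = 1 \<or> s = -1" for i s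
    using that by (cases "?n i") (auto simp: c_def g_def)
  have "(\<Sum>S'\<in>Pow I. \<Prod>u\<leftarrow>us.
      1 + (if u \<in> D then 0 else sgn_bit (u \<in> S)) * (if u \<in> D' then 0 else sgn_bit (u \<in> S')))
    = 2 ^ card I * (\<Prod>i\<in>I. g i)" for S
  proof -
    have "(\<Sum>S'\<in>Pow I. \<Prod>u\<leftarrow>us.
        1 + (if u \<in> D then 0 else sgn_bit (u \<in> S)) * (if u \<in> D' then 0 else sgn_bit (u \<in> S')))
      = (\<Sum>S'\<in>Pow I. \<Prod>i\<in>I. (1 + c i * (sgn_bit (i \<in> S) * sgn_bit (i \<in> S'))) ^ ?n i)"
      unfolding prod_list_eq_prod_count[OF assms] by (intro sum.cong prod.cong) (auto simp: c_def)
    also have "\<dots> = (\<Prod>i\<in>I. (1 + c i * (sgn_bit (i \<in> S) * sgn_bit True)) ^ ?n i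
        + (1 + c i * (sgn_bit (i \<in> S) * sgn_bit False)) ^ ?n i)"
      by (rule sum_Pow_prod[OF assms(1)])
    also have "\<dots> = (\<Prod>i\<in>I. 2 * g i)"
      using inner by (intro prod.cong) (auto simp: sgn_bit_def)
    finally show ?thesis by (simp add: prod.distrib)
  qed
  then have "(\<Sum>S\<in>Pow I. \<Sum>S'\<in>Pow I. \<Prod>u\<leftarrow>us.
      1 + (if u \<in> D then 0 else sgn_bit (u \<in> S)) * (if u \<in> D' then 0 else sgn_bit (u \<in> S')))
    = 2 ^ card I * (2 ^ card I * (\<Prod>i\<in>I. g i))"
    using assms by (simp add: card_Pow)
  also have "(\<Prod>i\<in>I. g i) = (\<Prod>i\<in>I - (D \<union> D'). g i)"
    using assms by (intro prod.mono_neutral_right) (auto simp: g_def)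
  also have "\<dots> = (\<Prod>i\<in>I - (D \<union> D'). if ?n i = 0 then 1 else 2 ^ (?n i - 1))"
    by (intro prod.cong) (auto simp: g_def)
  also have "(2::real) ^ card I * (2 ^ card I * X) = 4 ^ card I * X" for X
    by (simp flip: power_mult_distrib mult.assoc)
  finally show ?thesis .
qed

text \<open>Expanding the product into a sum over subsets \<open>T\<close> decouples \<open>H\<close> from \<open>H'\<close>, so that the weight bounds enter
  with the square of \<open>\<rho>\<close>.\<close>

lemma sum_disjoint_pairs_le:
  assumes fin: "finite I" and \<omega>: "\<And>i. i \<in> I \<Longrightarrow> 0 \<le> \<omega> i" and c: "\<And>i. i \<in> I \<Longrightarrow> 0 \<le> c i"
    and \<rho>: "\<And>T. T \<subseteq> I \<Longrightarrow> subset_weight \<omega> I k T \<le> subset_weight \<omega> I k {} * (\<Prod>i\<in>T. \<rho> i)"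
  shows "(\<Sum>H\<in>subset_family I k {}. \<Sum>H'\<in>subset_family I k {}.
      (\<Prod>i\<in>H. \<omega> i) * (\<Prod>i\<in>H'. \<omega> i) * (\<Prod>i\<in>I - (H \<union> H'). 1 + c i))
    \<le> (subset_weight \<omega> I k {})\<^sup>2 * (\<Prod>i\<in>I. 1 + c i * (\<rho> i)\<^sup>2)"
proof -
  let ?F = "subset_family I k" and ?W = "\<lambda>H. \<Prod>i\<in>H. \<omega> i"
  define dj where "dj H T = (if H \<inter> T = {} then 1 else 0 :: real)" for H T :: "'a set"
  have exp: "(\<Prod>i\<in>J. 1 + f i) = (\<Sum>T\<in>Pow J. \<Prod>i\<in>T. f i)" if "J \<subseteq> I" for J and f :: "'a \<Rightarrow> real"
    using prod_add[of J f "\<lambda>_. 1"] finite_subset[OF that fin] by (simp add: add.commute)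
  have "(\<Prod>i\<in>I - (H \<union> H'). 1 + c i) = (\<Sum>T\<in>Pow I. dj H T * dj H' T * (\<Prod>i\<in>T. c i))"
    if "H \<subseteq> I" "H' \<subseteq> I" for H H'
    unfolding exp[OF Diff_subset] using fin
    by (intro sum.mono_neutral_cong_left) (auto simp: dj_def)
  then have "(\<Sum>H\<in>?F {}. \<Sum>H'\<in>?F {}. ?W H * ?W H' * (\<Prod>i\<in>I - (H \<union> H'). 1 + c i))
    = (\<Sum>H\<in>?F {}. \<Sum>H'\<in>?F {}. \<Sum>T\<in>Pow I. ?W H * ?W H' * (dj H T * dj H' T * (\<Prod>i\<in>T. c i)))"
    by (intro sum.cong refl) (auto simp: subset_family_def sum_distrib_left)
  also have "\<dots> = (\<Sum>T\<in>Pow I. \<Sum>H\<in>?F {}. \<Sum>H'\<in>?F {}. ?W H * ?W H' * (dj H T * dj H' T * (\<Prod>i\<in>T. c i)))"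
    by (rule sum_swap3[symmetric])
  also have "\<dots> = (\<Sum>T\<in>Pow I. (\<Prod>i\<in>T. c i) * (\<Sum>H\<in>?F {}. ?W H * dj H T)\<^sup>2)"
    unfolding power2_eq_square sum_product by (simp add: sum_distrib_left ac_simps)
  also have "\<dots> = (\<Sum>T\<in>Pow I. (\<Prod>i\<in>T. c i) * (subset_weight \<omega> I k T)\<^sup>2)"
  proof -
    have "(\<Sum>H\<in>?F {}. ?W H * dj H T) = subset_weight \<omega> I k T" for T
      unfolding subset_weight_def using fin
      by (intro sum.mono_neutral_cong_right finite_subset_family) (auto simp: dj_def subset_family_def)
    then show ?thesis by simp
  qed
  also have "\<dots> \<le> (\<Sum>T\<in>Pow I. (\<Prod>i\<in>T. c i) * (subset_weight \<omega> I k {} * (\<Prod>i\<in>T. \<rho> i))\<^sup>2)"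
  proof (intro sum_mono mult_left_mono power_mono \<rho>)
    fix T assume "T \<in> Pow I"
    then show "0 \<le> subset_weight \<omega> I k T" "0 \<le> (\<Prod>i\<in>T. c i)" using \<omega> c
      unfolding subset_weight_def subset_family_def by (auto intro!: sum_nonneg prod_nonneg)
  qed auto
  also have "\<dots> = (subset_weight \<omega> I k {})\<^sup>2 * (\<Prod>i\<in>I. 1 + c i * (\<rho> i)\<^sup>2)"
    unfolding exp[OF order.refl]
    by (simp add: sum_distrib_left prod.distrib power_mult_distrib prod_power_distrib ac_simps)
  finally show ?thesis .
qed

text \<open>For fixed signs the samples are independent, and what remains is an exponential moment
  of random signs. The sum of squares in the exponent is the probability that two samples hit the
  same pair.\<close>

lemma sum_words_even_part_le:
  fixes w :: "'i \<Rightarrow> real"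
  assumes fin: "finite I" and w: "\<And>i. i \<in> I \<Longrightarrow> 0 \<le> w i" "sum w I = 1" and y: "0 \<le> y" "y \<le> 1"
  shows "(\<Sum>us\<in>words I N. (\<Prod>u\<leftarrow>us. w u) *
      (\<Prod>i\<in>I. ((1 + y) ^ count_list us i + (1 - y) ^ count_list us i) / 2))
    \<le> exp ((real N * y)\<^sup>2 * (\<Sum>i\<in>I. (w i)\<^sup>2) / 2)"
proof -
  have even_eq: "(\<Prod>i\<in>I. ((1 + y) ^ count_list us i + (1 - y) ^ count_list us i) / 2) =
      (\<Sum>S\<in>Pow I. \<Prod>u\<leftarrow>us. 1 + y * sgn_bit (u \<in> S)) / 2 ^ card I" if "us \<in> words I N" for us
  proof -
    have "set us \<subseteq> I" using that by (simp add: words_def)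
    then have "(\<Sum>S\<in>Pow I. \<Prod>u\<leftarrow>us. 1 + y * sgn_bit (u \<in> S)) =
        (\<Sum>S\<in>Pow I. \<Prod>i\<in>I. (1 + y * sgn_bit (i \<in> S)) ^ count_list us i)"
      by (simp add: prod_list_eq_prod_count[OF fin])
    also have "\<dots> = (\<Prod>i\<in>I. (1 + y * sgn_bit True) ^ count_list us i + (1 + y * sgn_bit False) ^ count_list us i)"
      by (rule sum_Pow_prod[OF fin])
    finally show ?thesis by (simp add: prod_dividef sgn_bit_def)
  qed
  have "(\<Sum>us\<in>words I N. (\<Prod>u\<leftarrow>us. w u) *
      (\<Prod>i\<in>I. ((1 + y) ^ count_list us i + (1 - y) ^ count_list us i) / 2))
    = (\<Sum>us\<in>words I N. \<Sum>S\<in>Pow I. (\<Prod>u\<leftarrow>us. w u * (1 + y * sgn_bit (u \<in> S))) / 2 ^ card I)"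
    by (intro sum.cong refl) (simp add: even_eq sum_distrib_left sum_divide_distrib flip: prod_list_mult)
  also have "\<dots> = (\<Sum>S\<in>Pow I. (\<Sum>i\<in>I. w i * (1 + y * sgn_bit (i \<in> S))) ^ N / 2 ^ card I)"
    by (subst sum.swap) (simp add: sum_words_prod_list[OF fin] flip: sum_divide_distrib)
  also have "\<dots> \<le> (\<Sum>S\<in>Pow I. exp (\<Sum>i\<in>I. sgn_bit (i \<in> S) * (real N * y * w i)) / 2 ^ card I)"
  proof (intro sum_mono divide_right_mono)
    fix S
    have eq: "(\<Sum>i\<in>I. w i * (1 + y * sgn_bit (i \<in> S))) = 1 + (\<Sum>i\<in>I. w i * (y * sgn_bit (i \<in> S)))"
      using w by (simp add: ring_distribs sum.distrib)
    have "(\<Sum>i\<in>I. - w i) \<le> (\<Sum>i\<in>I. w i * (y * sgn_bit (i \<in> S)))"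
      using y w by (intro sum_mono) (auto simp: sgn_bit_def mult_left_le intro: order.trans[of _ 0])
    then have "(\<Sum>i\<in>I. w i * (1 + y * sgn_bit (i \<in> S))) ^ N \<le> exp (N * (\<Sum>i\<in>I. w i * (y * sgn_bit (i \<in> S))))"
      unfolding eq by (intro one_plus_power_le_exp) (simp add: w sum_negf)
    then show "(\<Sum>i\<in>I. w i * (1 + y * sgn_bit (i \<in> S))) ^ N \<le> exp (\<Sum>i\<in>I. sgn_bit (i \<in> S) * (real N * y * w i))"
      by (simp add: sum_distrib_left ac_simps)
  qed simp
  also have "\<dots> \<le> exp ((\<Sum>i\<in>I. (real N * y * w i)\<^sup>2) / 2)"
    using sum_signs_exp_le[OF fin] by (simp flip: sum_divide_distrib)
  also have "(\<Sum>i\<in>I. (real N * y * w i)\<^sup>2) = (real N * y)\<^sup>2 * (\<Sum>i\<in>I. (w i)\<^sup>2)"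
    by (simp add: power_mult_distrib sum_distrib_left)
  finally show ?thesis .
qed

text \<open>The parameter is a set \<open>H\<close> of \<open>2 N\<close> heavy unbiased pairs of total mass \<open>1 - \<epsilon>\<close> and a direction for each of the
  remaining pairs, which are totally biased. Since \<open>N\<close> samples leave at least \<open>N\<close> heavy pairs unseen, the
  exchange argument bounds the posterior probability that a pair which was hit \<open>s\<close> times is light by \<open>B / r ^ s\<close>.\<close>

lemma tester_lower_bound_heavy:
  assumes tester: "closeness_tester n \<epsilon> \<delta> a b A" and Mn: "2 * M \<le> n" and eps: "0 < \<epsilon>" "\<epsilon> < 1"
    and N: "N = a + b" "0 < N" "4 * N \<le> M" "23 * real N \<le> (1 - \<epsilon>)\<^sup>2 * M"
    and d: "0 < \<delta>" "\<delta> \<le> \<delta>\<^sub>0" "\<delta>\<^sub>0 < 1 / 2"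
  shows "(1 - 2 * \<delta>\<^sub>0)\<^sup>2 * ln (1 / \<delta>) \<le> 256 * \<epsilon> ^ 4 * real N ^ 3 / ((1 - \<epsilon>) ^ 4 * (real M)\<^sup>2)"
proof -
  define I where "I = {..<M}"
  define k where "k = 2 * N"
  define h where "h = (1 - \<epsilon>) / k"
  define l where "l = \<epsilon> / (real M - k)"
  \<comment> \<open>\<open>r\<close> is the likelihood ratio of one hit between a heavy and a light
    pair. \<open>B\<close> is the factor \<open>M / (k - N)\<close> of
    \<open>subset_weight_le\<close>, and \<open>y\<close> is the effective bias that
    \<open>bias_weight_le\<close> assigns to them.\<close>
  define r where "r = h / l"
  define B where "B = real M / N"
  define y where "y = sqrt 2 * (B / r\<^sup>2)"
  let ?F = "subset_family I k {}"
  define C where "C = real (card ?F)"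
  define \<Theta> where "\<Theta> = ?F \<times> Pow I"
  define \<pi> where "\<pi> = (\<lambda>_::nat set \<times> nat set. 1 / (C * 2 ^ M))"
  define w where "w t i = (if i \<in> fst t then h else l)" for t :: "nat set \<times> nat set" and i
  define v where "v t i = (if i \<in> fst t then 0 else sgn_bit (i \<in> snd t))" for t :: "nat set \<times> nat set" and i
  have v_pair: "v (H, S) i = (if i \<in> H then 0 else sgn_bit (i \<in> S))" for H S i by (simp add: v_def)
  have finI: "finite I" "card I = M" by (auto simp: I_def)
  have M: "real M - k \<ge> real M / 2" "0 < real M" "real M - k > 0" "k < M" "0 < k"
    using N by (auto simp: k_def)
  have pos: "0 < h" "0 < l" "0 < r" "0 < B" "0 < y" using eps M N by (auto simp: h_def l_def r_def B_def y_def)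
  have hr: "h = l * r" using pos by (simp add: r_def)
  have finF: "finite ?F" by (rule finite_subset_family[OF finI(1)])
  have "{..<k} \<in> ?F" using M by (auto simp: subset_family_def I_def)
  then have C: "0 < C" using finF by (auto simp: C_def card_gt_0_iff)
  have H: "H \<subseteq> I" "card H = k" "finite H" if "H \<in> ?F" for H
    using that finI by (auto simp: subset_family_def intro: finite_subset)
  have split: "(\<Sum>i\<in>I. if i \<in> H then f else g) = k * f + (real M - k) * g" if "H \<in> ?F" for H and f g :: real
  proof -
    have "(\<Sum>i\<in>I. if i \<in> H then f else g) = (\<Sum>i\<in>I. g + (if i \<in> H then f - g else 0))"
      by (intro sum.cong) auto
    also have "\<dots> = real M * g + k * (f - g)"
      using H[OF that] finI by (simp add: sum.distrib sum.If_cases Int_absorb1)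
    finally show ?thesis by (simp add: algebra_simps)
  qed
  have kh: "k * h = 1 - \<epsilon>" "(real M - k) * l = \<epsilon>" using M by (auto simp: h_def l_def)
  interpret pair_family M \<Theta> \<pi> w v
  proof
    show "finite \<Theta>" using finF finI by (simp add: \<Theta>_def)
    show "sum \<pi> \<Theta> = 1" using C finI by (simp add: \<Theta>_def \<pi>_def C_def card_cartesian_product card_Pow)
    show "sum (w t) {..<M} = 1" if "t \<in> \<Theta>" for t
      using split[of "fst t" h l] that kh by (auto simp: w_def[abs_def] \<Theta>_def I_def)
  qed (use C pos in \<open>auto simp: \<pi>_def w_def v_def sgn_bit_def\<close>)

  have inv_r: "1 / r \<le> 4 * N * \<epsilon> / ((1 - \<epsilon>) * M)"
  proof -
    have "1 / r = \<epsilon> * (2 * N) / ((1 - \<epsilon>) * (real M - k))"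
      using eps M N by (simp add: r_def h_def l_def k_def field_simps)
    also have "\<dots> \<le> \<epsilon> * (2 * N) / ((1 - \<epsilon>) * (real M / 2))"
      using eps M N by (intro divide_left_mono mult_left_mono mult_pos_pos) auto
    finally show ?thesis by (simp add: field_simps)
  qed
  have scaling: "2 * (m / x)\<^sup>2 * (4 * x * z / (u * m)) ^ 4 = 512 * z ^ 4 * x\<^sup>2 / (u ^ 4 * m\<^sup>2)"
    if "0 < x" "0 < m" "0 < u" for x m u z :: real
    using that by (simp add: field_simps power2_eq_square power4_eq_xxxx)
  have y_sq: "y\<^sup>2 \<le> 512 * \<epsilon> ^ 4 * (real N)\<^sup>2 / ((1 - \<epsilon>) ^ 4 * (real M)\<^sup>2)"
  proof -
    have "y\<^sup>2 = 2 * B\<^sup>2 * (1 / r) ^ 4"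
      by (simp add: y_def power_mult_distrib power_divide flip: power_mult)
    also have "\<dots> \<le> 2 * B\<^sup>2 * (4 * N * \<epsilon> / ((1 - \<epsilon>) * M)) ^ 4"
      using pos by (intro mult_left_mono power_mono inv_r) auto
    also have "\<dots> = 512 * \<epsilon> ^ 4 * (real N)\<^sup>2 / ((1 - \<epsilon>) ^ 4 * (real M)\<^sup>2)"
      using scaling[of "real N" "real M" "1 - \<epsilon>" \<epsilon>] N(2) M eps unfolding B_def by simp
    finally show ?thesis .
  qed
  have "1 - \<epsilon> \<le> 1" "0 < 1 - \<epsilon>" using eps by auto
  then have "(1 - \<epsilon>)\<^sup>2 * M \<le> (1 - \<epsilon>) * M"
    by (intro mult_right_mono) (auto simp: power2_eq_square mult_left_le)
  then have N23: "23 * N \<le> (1 - \<epsilon>) * M" using N by linarith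
  have "1 / r \<le> 1 / 4"
  proof -
    have "4 * real N * \<epsilon> \<le> 4 * real N * 1" using eps by (intro mult_left_mono) auto
    also have "\<dots> \<le> (1 / 4) * ((1 - \<epsilon>) * M)" using N23 by simp
    finally have "4 * N * \<epsilon> / ((1 - \<epsilon>) * M) \<le> 1 / 4"
      using eps M by (simp add: field_simps)
    with inv_r show ?thesis by linarith
  qed
  then have "4 \<le> r" using pos by (simp add: field_simps)
  then have r2: "2 \<le> r\<^sup>2" using power_mono[of 4 r 2] by simp
  \<comment> \<open>The constant 23 in the hypotheses is made for this step: 512 is at most
    23^2.\<close>
  have "y\<^sup>2 \<le> 1"
  proof -
    have "512 * \<epsilon> ^ 4 * (real N)\<^sup>2 \<le> 529 * 1 * (real N)\<^sup>2"
      using eps by (intro mult_right_mono mult_mono power_le_one) auto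
    also have "\<dots> = (23 * real N)\<^sup>2" by (simp add: power_mult_distrib)
    also have "\<dots> \<le> ((1 - \<epsilon>)\<^sup>2 * M)\<^sup>2" using N by (intro power_mono) auto
    also have "\<dots> = (1 - \<epsilon>) ^ 4 * (real M)\<^sup>2" by (simp add: power_mult_distrib flip: power_mult)
    finally have "512 * \<epsilon> ^ 4 * (real N)\<^sup>2 / ((1 - \<epsilon>) ^ 4 * (real M)\<^sup>2) \<le> 1"
      using eps M by simp
    with y_sq show ?thesis by linarith
  qed
  then have "y \<le> 1" by (simp add: abs_square_le_1 abs_le_iff)
  moreover have "y\<^sup>2 = 2 * (B / r\<^sup>2)\<^sup>2"
    unfolding y_def power_mult_distrib[of "sqrt 2"] by simp
  ultimately have y: "0 \<le> y" "y \<le> 1" "y\<^sup>2 = 2 * (B / r\<^sup>2)\<^sup>2"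
    using pos by auto

  define e where "e us i = ((1 + y) ^ count_list us i + (1 - y) ^ count_list us i) / 2" for us and i :: nat
  \<comment> \<open>For each single sample, the summand of the second moment is at most its null
    probability times a product of even parts. The quotient disappears and a sum over the null
    mixture remains.\<close>
  have term_le: "(\<Sum>t\<in>\<Theta>. \<Sum>t'\<in>\<Theta>. \<pi> t * \<pi> t' * index_prob t us * index_prob t' us * (\<Prod>i\<leftarrow>us. 1 + v t i * v t' i))
      / mixed_index_prob us \<le> mixed_index_prob us * (\<Prod>i\<in>I. e us i)"
    if us: "us \<in> words {..<M} N" for us
  proof -
    \<comment> \<open>The factor by which the hits of \<open>i\<close> favour \<open>i\<close> being
      heavy over light; it is 1 for an unseen pair, as the exchange argument requires.\<close>
    define \<omega> where "\<omega> i = r ^ count_list us i" for i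
    define g where "g i = (if count_list us i = 0 then 1 else 2 ^ (count_list us i - 1) :: real)" for i
    let ?W = "\<lambda>H. \<Prod>i\<in>H. \<omega> i" and ?Q = "subset_weight \<omega> I k"
    have set_us: "set us \<subseteq> I" "length us = N" using us by (auto simp: words_def I_def)
    have ip: "index_prob t us = l ^ N * ?W (fst t)" if "t \<in> \<Theta>" for t
    proof -
      have "fst t \<subseteq> I" using that H(1)[of "fst t"] by (auto simp: \<Theta>_def)
      have "index_prob t us = (\<Prod>u\<leftarrow>us. l) * (\<Prod>u\<leftarrow>us. if u \<in> fst t then r else 1)"
        unfolding index_prob_def w_def prod_list_mult hr by (intro arg_cong[of _ _ prod_list] map_cong) auto
      also have "(\<Prod>u\<leftarrow>us. if u \<in> fst t then r else 1) = (\<Prod>i\<in>I. if i \<in> fst t then \<omega> i else 1)"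
        unfolding prod_list_eq_prod_count[OF finI(1) set_us(1)] by (intro prod.cong) (auto simp: \<omega>_def)
      also have "\<dots> = ?W (fst t)"
        using finI \<open>fst t \<subseteq> I\<close> by (simp add: prod.If_cases Int_absorb1)
      finally show ?thesis by (simp add: map_replicate_const set_us)
    qed
    have mp: "mixed_index_prob us = l ^ N * ?Q {} / C"
    proof -
      have "mixed_index_prob us = (\<Sum>t\<in>\<Theta>. \<pi> t * (l ^ N * ?W (fst t)))"
        unfolding mixed_index_prob_def by (intro sum.cong) (auto simp: ip)
      also have "\<dots> = (\<Sum>H\<in>?F. l ^ N * ?W H / C)"
        by (simp add: \<Theta>_def \<pi>_def sum.cartesian_product' card_Pow finI)
      finally show ?thesis by (simp add: subset_weight_def sum_distrib_left sum_divide_distrib)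
    qed
    have "(\<Sum>t\<in>\<Theta>. \<Sum>t'\<in>\<Theta>. \<pi> t * \<pi> t' * index_prob t us * index_prob t' us * (\<Prod>i\<leftarrow>us. 1 + v t i * v t' i))
      = (\<Sum>t\<in>\<Theta>. \<Sum>t'\<in>\<Theta>. (l ^ N / (C * 2 ^ M))\<^sup>2 * (?W (fst t) * ?W (fst t') * (\<Prod>i\<leftarrow>us. 1 + v t i * v t' i)))"
      by (intro sum.cong refl) (simp add: ip \<pi>_def power2_eq_square)
    also have "\<dots> = (\<Sum>H\<in>?F. \<Sum>H'\<in>?F. \<Sum>S\<in>Pow I. \<Sum>S'\<in>Pow I.
        (l ^ N / (C * 2 ^ M))\<^sup>2 * (?W H * ?W H' * (\<Prod>i\<leftarrow>us. 1 + v (H, S) i * v (H', S') i)))"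
      unfolding \<Theta>_def sum.cartesian_product' fst_conv by (rule sum.cong[OF refl], rule sum.swap)
    also have "\<dots> = (\<Sum>H\<in>?F. \<Sum>H'\<in>?F. (l ^ N / (C * 2 ^ M))\<^sup>2 *
        (?W H * ?W H' * (4 ^ M * (\<Prod>i\<in>I - (H \<union> H'). 1 + (g i - 1)))))"
      using sum_signs_product[OF finI(1) set_us(1)]
      by (simp add: v_pair g_def finI flip: sum_distrib_left)
    also have "\<dots> = (l ^ N / C)\<^sup>2 * (\<Sum>H\<in>?F. \<Sum>H'\<in>?F. ?W H * ?W H' * (\<Prod>i\<in>I - (H \<union> H'). 1 + (g i - 1)))"
    proof -
      have four: "(4::real) ^ M = 2 ^ M * 2 ^ M" by (simp flip: power_mult_distrib)
      have "(l ^ N / (C * 2 ^ M))\<^sup>2 * 4 ^ M = (l ^ N / C)\<^sup>2"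
        unfolding four by (simp add: power_divide power_mult_distrib power2_eq_square)
      then have "(l ^ N / (C * 2 ^ M))\<^sup>2 * (f * (4 ^ M * g)) = (l ^ N / C)\<^sup>2 * (f * g)" for f g
        by (metis mult.assoc mult.left_commute)
      then show ?thesis by (simp only: sum_distrib_left)
    qed
    also have "\<dots> \<le> (l ^ N / C)\<^sup>2 * ((?Q {})\<^sup>2 * (\<Prod>i\<in>I. 1 + (g i - 1) * (B / \<omega> i)\<^sup>2))"
    proof (intro mult_left_mono sum_disjoint_pairs_le finI)
      fix T assume T: "T \<subseteq> I"
      have "?Q T \<le> ?Q {} * (\<Prod>i\<in>T. real (card I) / real (k - N) / \<omega> i)"
      proof (rule subset_weight_le[OF finI(1) _ _ _ _ _ T])
        show "card (set us) \<le> N" using card_length[of us] set_us by simp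
      qed (use pos N in \<open>auto simp: \<omega>_def k_def\<close>)
      then show "?Q T \<le> ?Q {} * (\<Prod>i\<in>T. B / \<omega> i)"
        by (simp add: finI k_def B_def)
    qed (use pos in \<open>auto simp: \<omega>_def g_def\<close>)
    also have "\<dots> \<le> (l ^ N / C)\<^sup>2 * ((?Q {})\<^sup>2 * (\<Prod>i\<in>I. e us i))"
    proof (intro mult_left_mono prod_mono conjI)
      fix i
      show "1 + (g i - 1) * (B / \<omega> i)\<^sup>2 \<le> e us i"
        unfolding e_def \<omega>_def by (rule bias_weight_le[OF r2 pos(3) y]) (simp add: g_def)
      have "1 \<le> g i" by (simp add: g_def)
      then show "0 \<le> 1 + (g i - 1) * (B / \<omega> i)\<^sup>2"
        by (intro add_nonneg_nonneg mult_nonneg_nonneg) auto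
    qed auto
    also have "\<dots> = (mixed_index_prob us)\<^sup>2 * (\<Prod>i\<in>I. e us i)"
      by (simp add: mp power_mult_distrib power_divide)
    finally show ?thesis using mixed_index_prob_pos[OF us] by (simp add: field_simps power2_eq_square)
  qed
  \<comment> \<open>There are \<open>2 * N\<close> heavy pairs and at least as many light ones, so
    two samples hit the same pair with probability at most \<open>1 / N\<close>.\<close>
  have sq: "(\<Sum>i\<in>I. (w t i)\<^sup>2) \<le> 1 / N" if "t \<in> \<Theta>" for t
  proof -
    have "(\<Sum>i\<in>I. (w t i)\<^sup>2) = (\<Sum>i\<in>I. if i \<in> fst t then h\<^sup>2 else l\<^sup>2)"
      by (intro sum.cong) (auto simp: w_def)
    also have "\<dots> = k * h\<^sup>2 + (real M - k) * l\<^sup>2"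
      using that by (intro split) (auto simp: \<Theta>_def)
    also have "\<dots> = (1 - \<epsilon>)\<^sup>2 / k + \<epsilon>\<^sup>2 / (real M - k)"
      using M by (simp add: h_def l_def power2_eq_square)
    also have "\<dots> \<le> 1 / (2 * N) + 1 / (2 * N)"
      using eps N M by (intro add_mono frac_le) (auto simp: k_def power_le_one)
    finally show ?thesis by simp
  qed
  have "second_moment N \<le> (\<Sum>us\<in>words {..<M} N. mixed_index_prob us * (\<Prod>i\<in>I. e us i))"
    unfolding second_moment_def by (intro sum_mono term_le)
  also have "\<dots> = (\<Sum>t\<in>\<Theta>. \<pi> t * (\<Sum>us\<in>words I N. (\<Prod>u\<leftarrow>us. w t u) * (\<Prod>i\<in>I. e us i)))"
    unfolding mixed_index_prob_def index_prob_def sum_distrib_left sum_distrib_right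
    by (subst sum.swap) (simp add: I_def mult.assoc)
  also have "\<dots> \<le> (\<Sum>t\<in>\<Theta>. \<pi> t * exp ((real N * y)\<^sup>2 * (\<Sum>i\<in>I. (w t i)\<^sup>2) / 2))"
    unfolding e_def
    by (intro sum_mono mult_left_mono sum_words_even_part_le prior_nonneg y finI)
       (use w_sum w_nonneg in \<open>auto simp: I_def\<close>)
  also have "\<dots> \<le> (\<Sum>t\<in>\<Theta>. \<pi> t * exp ((real N * y)\<^sup>2 * (1 / N) / 2))"
    by (intro sum_mono mult_left_mono prior_nonneg exp_le_cancel_iff[THEN iffD2] divide_right_mono sq) auto
  also have "\<dots> = exp (N * y\<^sup>2 / 2)"
    using prior_sum N by (simp add: power_mult_distrib power2_eq_square flip: sum_distrib_right)
  also have "\<dots> \<le> exp (N * (512 * \<epsilon> ^ 4 * (real N)\<^sup>2 / ((1 - \<epsilon>) ^ 4 * (real M)\<^sup>2)) / 2)"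
    by (intro exp_le_cancel_iff[THEN iffD2] mult_left_mono divide_right_mono y_sq) auto
  also have "N * (512 * \<epsilon> ^ 4 * (real N)\<^sup>2 / ((1 - \<epsilon>) ^ 4 * (real M)\<^sup>2)) / 2 =
      256 * \<epsilon> ^ 4 * real N ^ 3 / ((1 - \<epsilon>) ^ 4 * (real M)\<^sup>2)"
    by (simp add: power2_eq_square power3_eq_cube ac_simps)
  finally have le: "second_moment (a + b) \<le> exp (256 * \<epsilon> ^ 4 * real N ^ 3 / ((1 - \<epsilon>) ^ 4 * (real M)\<^sup>2))"
    using N by simp
  have far: "\<epsilon> \<le> (\<Sum>i<M. w t i * \<bar>v t i\<bar>)" if "t \<in> \<Theta>" for t
  proof -
    have "(\<Sum>i\<in>I. w t i * \<bar>v t i\<bar>) = (\<Sum>i\<in>I. if i \<in> fst t then 0 else l)"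
      by (intro sum.cong) (auto simp: w_def v_def sgn_bit_def)
    also have "\<dots> = \<epsilon>" using split[of "fst t" 0 l] that kh by (auto simp: \<Theta>_def)
    finally show ?thesis by (simp add: I_def)
  qed
  show ?thesis
    by (rule second_moment_exp_tester_bound[OF tester Mn far d le])
qed

section \<open>Combination of the three lower bounds\<close>

lemma tester_lower_bound:
  fixes \<epsilon>\<^sub>0 \<delta>\<^sub>0 :: real
  assumes "\<epsilon>\<^sub>0 < 1" "\<delta>\<^sub>0 < 1 / 2"
  shows "\<exists>c > 0. \<forall>n \<ge> 2. \<forall>\<epsilon> \<in> {0<..\<epsilon>\<^sub>0}. \<forall>\<delta> \<in> {0<..\<delta>\<^sub>0}. \<forall>a b A.
    closeness_tester n \<epsilon> \<delta> a b A \<longrightarrow> c * sample_bound n \<epsilon> \<delta> \<le> real (a + b)"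
proof -
  define \<kappa> where "\<kappa> = (1 - 2 * \<delta>\<^sub>0)\<^sup>2"
  \<comment> \<open>\<open>N \<le> \<eta> * M\<close> gives the hypothesis of
    \<open>tester_lower_bound_heavy\<close> with the constant 23, uniformly in
    \<open>\<epsilon> \<le> \<epsilon>\<^sub>0\<close>.\<close>
  define \<eta> where "\<eta> = (1 - \<epsilon>\<^sub>0)\<^sup>2 / 23"
  have kpos: "0 < \<kappa>" using assms by (simp add: \<kappa>_def)
  have epos: "0 < \<eta>" using assms by (simp add: \<eta>_def)
  \<comment> \<open>One constant for each case of \<open>cube\<close> below. The number 2304 is 256
    * 3^2 and 9 is 3 * 3, where each 3 comes from \<open>n \<le> 3 * M\<close>.\<close>
  define c1 where "c1 = min (\<kappa> * (1 - \<epsilon>\<^sub>0) ^ 4 / 2304) (2 * \<eta> * \<kappa> / 9)"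
  have c1: "0 < c1" using kpos epos assms by (simp add: c1_def)
  define c where "c = min (root 3 c1) (min (sqrt (2 * \<kappa> / 3)) \<kappa>) / 3"
  have c: "0 < c" "3 * c \<le> root 3 c1" "3 * c \<le> sqrt (2 * \<kappa> / 3)" "3 * c \<le> \<kappa>"
    using c1 kpos by (auto simp: c_def)
  have "c * sample_bound n \<epsilon> \<delta> \<le> real (a + b)"
    if n: "2 \<le> n" and eps: "0 < \<epsilon>" "\<epsilon> \<le> \<epsilon>\<^sub>0" and d: "0 < \<delta>" "\<delta> \<le> \<delta>\<^sub>0"
      and tester: "closeness_tester n \<epsilon> \<delta> a b A" for n \<epsilon> \<delta> a b A
  proof -
    define M where "M = n div 2"
    define L where "L = ln (1 / \<delta>)"
    define N where "N = a + b"
    have M: "0 < M" "2 * M \<le> n" "n \<le> 3 * M" using n by (auto simp: M_def)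
    then have M3: "real n / 3 \<le> M" by linarith
    have L: "0 < L" using d assms by (simp add: L_def)
    have log: "\<kappa> * L \<le> N * \<epsilon>\<^sup>2"
      using tester_lower_bound_log[OF tester n _ _ d assms(2)] eps assms by (simp add: N_def L_def \<kappa>_def)
    then have "0 < real N * \<epsilon>\<^sup>2" using mult_pos_pos[OF kpos L] by linarith
    then have N0: "0 < N" by (simp add: zero_less_mult_iff)
    have sqrt: "\<kappa> * L \<le> (real N)\<^sup>2 * \<epsilon> ^ 4 / (2 * M)"
      using tester_lower_bound_sqrt[OF tester M(1,2) _ _ d assms(2)] eps assms by (simp add: N_def L_def \<kappa>_def)
    have sq: "2 * \<kappa> / 3 * (n * L / \<epsilon> ^ 4) \<le> (real N)\<^sup>2"
    proof -
      have "2 * \<kappa> / 3 * (n * L) = 2 * (n / 3) * (\<kappa> * L)" by simp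
      also have "\<dots> \<le> 2 * M * (\<kappa> * L)" using M3 kpos L by (intro mult_right_mono) auto
      also have "\<dots> \<le> (real N)\<^sup>2 * \<epsilon> ^ 4" using sqrt M by (simp add: field_simps)
      finally show ?thesis using eps by (simp add: field_simps)
    qed
    \<comment> \<open>For \<open>N\<close> beyond \<open>\<eta> * M\<close> the hidden pairs have no
      room, but then \<open>N ^ 3\<close> exceeds \<open>\<eta> * M * N\<^sup>2\<close>, and the
      square bound \<open>sq\<close> already implies the cubic one.\<close>
    have cube: "c1 * ((real n)\<^sup>2 * L / \<epsilon> ^ 4) \<le> real N ^ 3"
    proof (cases "real N \<le> \<eta> * M")
      case True
      have "(1 - \<epsilon>\<^sub>0)\<^sup>2 \<le> (1 - \<epsilon>)\<^sup>2" using eps assms by (intro power_mono) auto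
      then have "(1 - \<epsilon>\<^sub>0)\<^sup>2 * M \<le> (1 - \<epsilon>)\<^sup>2 * M" by (intro mult_right_mono) auto
      then have N23: "23 * real N \<le> (1 - \<epsilon>)\<^sup>2 * M"
        using True by (simp add: \<eta>_def)
      have "(1 - \<epsilon>)\<^sup>2 * M \<le> 1 * real M" using eps assms by (intro mult_right_mono power_le_one) auto
      then have "4 * real N \<le> M" using N23 by linarith
      then have N4: "4 * N \<le> M" by linarith
      have pos: "0 < (1 - \<epsilon>\<^sub>0) ^ 4 * (real n / 3)\<^sup>2" using assms n by simp
      have "\<kappa> * L \<le> 256 * \<epsilon> ^ 4 * real N ^ 3 / ((1 - \<epsilon>) ^ 4 * (real M)\<^sup>2)"
        unfolding \<kappa>_def L_def
        by (rule tester_lower_bound_heavy[OF tester M(2) eps(1) _ N_def N0 N4 N23 d assms(2)])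
          (use eps assms in simp)
      also have "\<dots> \<le> 256 * \<epsilon> ^ 4 * real N ^ 3 / ((1 - \<epsilon>\<^sub>0) ^ 4 * (real n / 3)\<^sup>2)"
        using M3 eps assms pos by (intro frac_le mult_mono power_mono) auto
      finally have "\<kappa> * L * ((1 - \<epsilon>\<^sub>0) ^ 4 * (real n / 3)\<^sup>2) \<le> 256 * \<epsilon> ^ 4 * real N ^ 3"
        using pos by (simp add: pos_le_divide_eq)
      then have "\<kappa> * (1 - \<epsilon>\<^sub>0) ^ 4 / 2304 * ((real n)\<^sup>2 * L / \<epsilon> ^ 4) \<le> real N ^ 3"
        using eps by (simp add: power_divide divide_simps mult_ac)
      moreover have "c1 * ((real n)\<^sup>2 * L / \<epsilon> ^ 4) \<le> \<kappa> * (1 - \<epsilon>\<^sub>0) ^ 4 / 2304 * ((real n)\<^sup>2 * L / \<epsilon> ^ 4)"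
        using L eps by (intro mult_right_mono) (auto simp: c1_def)
      ultimately show ?thesis by linarith
    next
      case False
      have "c1 * ((real n)\<^sup>2 * L / \<epsilon> ^ 4) \<le> 2 * \<eta> * \<kappa> / 9 * ((real n)\<^sup>2 * L / \<epsilon> ^ 4)"
        using L eps by (intro mult_right_mono) (auto simp: c1_def)
      also have "\<dots> = (\<eta> * (n / 3)) * (2 * \<kappa> / 3 * (n * L / \<epsilon> ^ 4))"
        by (simp add: power2_eq_square)
      also have "\<dots> \<le> (\<eta> * M) * (real N)\<^sup>2"
        using M3 epos kpos L by (intro mult_mono sq) auto
      also have "\<dots> \<le> N * (real N)\<^sup>2"
        using False by (intro mult_right_mono) auto
      finally show ?thesis by (simp add: power3_eq_cube power2_eq_square)
    qed
    define T1 where "T1 = real n powr (2/3) * L powr (1/3) / \<epsilon> powr (4/3)"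
    define T2 where "T2 = real n powr (1/2) * L powr (1/2) / \<epsilon>\<^sup>2"
    have T: "T1 ^ 3 = (real n)\<^sup>2 * L / \<epsilon> ^ 4" "T2\<^sup>2 = n * L / \<epsilon> ^ 4" "0 \<le> T1" "0 \<le> T2"
      unfolding T1_def T2_def using sample_bound_parts[of "real n" \<epsilon> L] n eps L by simp_all
    have "3 * c * T1 \<le> root 3 c1 * T1" using T c by (intro mult_right_mono)
    also have "\<dots> \<le> N"
    proof (rule power_le_imp_le_base)
      show "(root 3 c1 * T1) ^ Suc 2 \<le> real N ^ Suc 2"
        using cube c1 T(1) by (simp add: power_mult_distrib eval_nat_numeral(3)[symmetric] del: power_Suc)
    qed simp
    finally have 1: "3 * c * T1 \<le> N" .
    have "3 * c * T2 \<le> sqrt (2 * \<kappa> / 3) * T2" using T c by (intro mult_right_mono)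
    also have "\<dots> \<le> N"
    proof (rule power2_le_imp_le)
      show "(sqrt (2 * \<kappa> / 3) * T2)\<^sup>2 \<le> (real N)\<^sup>2"
        using sq kpos T(2) by (simp only: power_mult_distrib) (simp add: real_sqrt_pow2)
    qed simp
    finally have 2: "3 * c * T2 \<le> N" .
    have "3 * c * (L / \<epsilon>\<^sup>2) \<le> \<kappa> * (L / \<epsilon>\<^sup>2)" using c L by (intro mult_right_mono) auto
    also have "\<dots> \<le> N" using log eps by (simp add: field_simps)
    finally have 3: "3 * c * (L / \<epsilon>\<^sup>2) \<le> N" .
    have "sample_bound n \<epsilon> \<delta> = T1 + T2 + L / \<epsilon>\<^sup>2"
      by (simp add: sample_bound_def T1_def T2_def L_def add_divide_distrib)
    then have "3 * (c * sample_bound n \<epsilon> \<delta>) = 3 * c * T1 + 3 * c * T2 + 3 * c * (L / \<epsilon>\<^sup>2)"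
      by (simp add: ring_distribs)
    then show ?thesis using 1 2 3 unfolding N_def by linarith
  qed
  then show ?thesis using c by auto
qed

subsection \<open>Bounded differences\<close>

text \<open>Expectation over independent samples with the listed distributions. A list of
  distributions admits samples of \<open>p\<close> and of \<open>q\<close> side by side, and it
  supports induction over the first sample.\<close>

primrec expect :: "'a pmf list \<Rightarrow> ('a list \<Rightarrow> real) \<Rightarrow> real" where
  "expect [] f = f []"
| "expect (p # ps) f = measure_pmf.expectation p (\<lambda>x. expect ps (\<lambda>xs. f (x # xs)))"

definition fin_supp :: "'a pmf list \<Rightarrow> bool" where
  "fin_supp ps \<longleftrightarrow> (\<forall>p\<in>set ps. finite (set_pmf p))"

lemma fin_supp_simps [simp]:
  "fin_supp []" "fin_supp (p # ps) \<longleftrightarrow> finite (set_pmf p) \<and> fin_supp ps"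
  "fin_supp (ps @ qs) \<longleftrightarrow> fin_supp ps \<and> fin_supp qs"
  "finite (set_pmf p) \<Longrightarrow> fin_supp (replicate n p)"
  by (auto simp: fin_supp_def)

lemma expect_append: "expect (ps @ qs) f = expect ps (\<lambda>xs. expect qs (\<lambda>ys. f (xs @ ys)))"
  by (induction ps arbitrary: f) auto

lemma expect_const [simp]: "expect ps (\<lambda>_. c) = c"
  by (induction ps) auto

lemma expect_add:
  "fin_supp ps \<Longrightarrow> expect ps (\<lambda>xs. f xs + g xs) = expect ps f + expect ps g"
  by (induction ps arbitrary: f g) (auto simp: integrable_measure_pmf_finite)

lemma expect_cmult: "expect ps (\<lambda>xs. c * f xs) = c * expect ps f"
  by (induction ps arbitrary: f) auto

lemma expect_diff:
  "fin_supp ps \<Longrightarrow> expect ps (\<lambda>xs. f xs - g xs) = expect ps f - expect ps g"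
  using expect_add[of ps f "\<lambda>xs. - 1 * g xs"] by (simp only: expect_cmult) simp

lemma expect_sum:
  "fin_supp ps \<Longrightarrow> expect ps (\<lambda>xs. \<Sum>i\<in>A. f i xs) = (\<Sum>i\<in>A. expect ps (f i))"
  by (induction A rule: infinite_finite_induct) (auto simp: expect_add)

lemma expect_mono:
  "fin_supp ps \<Longrightarrow> (\<And>xs. length xs = length ps \<Longrightarrow> f xs \<le> g xs) \<Longrightarrow> expect ps f \<le> expect ps g"
proof (induction ps arbitrary: f g)
  case (Cons p ps)
  then show ?case by (auto intro!: integral_mono integrable_measure_pmf_finite)
qed simp

lemma expect_cong:
  "(\<And>xs. length xs = length ps \<Longrightarrow> f xs = g xs) \<Longrightarrow> expect ps f = expect ps g"
proof (induction ps arbitrary: f g)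
  case (Cons p ps)
  show ?case unfolding expect.simps
    by (intro Bochner_Integration.integral_cong refl Cons.IH Cons.prems) simp
qed simp

lemma pmf_bind_replicate:
  "pmf (bind_pmf (replicate_pmf n p) g) b = expect (replicate n p) (\<lambda>xs. pmf (g xs) b)"
proof (induction n arbitrary: g)
  case (Suc n)
  have "pmf (bind_pmf (replicate_pmf (Suc n) p) g) b =
      measure_pmf.expectation p (\<lambda>x. pmf (bind_pmf (replicate_pmf n p) (\<lambda>xs. g (x # xs))) b)"
    by (simp add: bind_assoc_pmf bind_return_pmf pmf_bind)
  then show ?case by (simp add: Suc)
qed (simp add: bind_return_pmf)

lemma pmf_verdict:
  "pmf (verdict a b A p q) c =
    expect (replicate a p @ replicate b q) (\<lambda>zs. pmf (A (take a zs) (drop a zs)) c)"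
proof -
  have "pmf (verdict a b A p q) c =
      expect (replicate a p) (\<lambda>xs. expect (replicate b q) (\<lambda>ys. pmf (A xs ys) c))"
    by (simp add: verdict_def pmf_bind_replicate)
  also have "\<dots> = expect (replicate a p) (\<lambda>xs. expect (replicate b q)
      (\<lambda>ys. pmf (A (take a (xs @ ys)) (drop a (xs @ ys))) c))"
    by (rule expect_cong) simp
  finally show ?thesis by (simp add: expect_append)
qed

lemma Hoeffding_mgf_pmf:
  fixes g :: "'a \<Rightarrow> real"
  assumes fin: "finite (set_pmf p)" and bd: "\<And>x y. \<bar>g x - g y\<bar> \<le> c" and s: "0 < s"
  shows "measure_pmf.expectation p (\<lambda>x. exp (s * (g x - measure_pmf.expectation p g))) \<le> exp (s\<^sup>2 * c\<^sup>2 / 8)"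
proof -
  define lo where "lo = Min (g ` set_pmf p)"
  have "lo \<in> g ` set_pmf p" unfolding lo_def using fin set_pmf_not_empty by (intro Min_in) auto
  then obtain x0 where x0: "lo = g x0" by auto
  have lo: "lo \<le> g x" if "x \<in> set_pmf p" for x unfolding lo_def using fin that by (intro Min_le) auto
  have hi: "g x \<le> lo + c" for x using bd[of x x0] x0 by (simp add: abs_le_iff)
  interpret interval_bounded_random_variable "measure_pmf p" g lo "lo + c"
    by unfold_locales (auto simp: AE_measure_pmf_iff lo hi)
  have "ennreal (measure_pmf.expectation p (\<lambda>x. exp (s * (g x - measure_pmf.expectation p g)))) =
      (\<integral>\<^sup>+x. exp (s * (g x - measure_pmf.expectation p g)) \<partial>measure_pmf p)"
    by (rule nn_integral_eq_integral[symmetric]) (auto intro: integrable_measure_pmf_finite fin)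
  also have "\<dots> \<le> ennreal (exp (s\<^sup>2 * c\<^sup>2 / 8))"
    using Hoeffdings_lemma_nn_integral[OF s] by simp
  finally show ?thesis by simp
qed

text \<open>Let \<open>g\<close> be the conditional expectation given the first sample. Averaging
  over the other samples preserves the difference bound, so \<open>g\<close> varies by at most
  \<open>c\<close> and Hoeffding's lemma applies to it; the induction hypothesis covers the
  deviation from \<open>g\<close>.\<close>

lemma expect_exp_bounded_differences:
  assumes "fin_supp ps" "0 < s"
    and "\<And>us x y vs. Suc (length us + length vs) = length ps \<Longrightarrow> \<bar>f (us @ x # vs) - f (us @ y # vs)\<bar> \<le> c"
  shows "expect ps (\<lambda>xs. exp (s * (f xs - expect ps f))) \<le> exp (length ps * (s\<^sup>2 * c\<^sup>2 / 8))"
  using assms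
proof (induction ps arbitrary: f)
  case (Cons p ps)
  note fin = Cons.prems(1)[simplified]
  define g where "g x = expect ps (\<lambda>xs. f (x # xs))" for x
  have Eg: "expect (p # ps) f = measure_pmf.expectation p g" by (simp add: g_def[abs_def])
  have IH: "expect ps (\<lambda>xs. exp (s * (f (x # xs) - g x))) \<le> exp (length ps * (s\<^sup>2 * c\<^sup>2 / 8))" for x
    unfolding g_def using Cons.prems(3)[of "x # _"] fin Cons.prems(2) by (intro Cons.IH) auto
  have bd: "\<bar>g x - g y\<bar> \<le> c" for x y
  proof -
    have eq: "g x - g y = expect ps (\<lambda>xs. f (x # xs) - f (y # xs))"
      unfolding g_def using fin by (simp add: expect_diff)
    have "\<bar>f (x # xs) - f (y # xs)\<bar> \<le> c" if "length xs = length ps" for xs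
      using Cons.prems(3)[of "[]" xs x y] that by simp
    then have "f (x # xs) - f (y # xs) \<le> c \<and> - c \<le> f (x # xs) - f (y # xs)" if "length xs = length ps" for xs
      using that by (force simp: abs_le_iff)
    then have "expect ps (\<lambda>xs. f (x # xs) - f (y # xs)) \<le> expect ps (\<lambda>_. c)"
      "expect ps (\<lambda>_. - c) \<le> expect ps (\<lambda>xs. f (x # xs) - f (y # xs))"
      using fin by (intro expect_mono; simp)+
    with eq show ?thesis by (simp add: abs_le_iff)
  qed
  have "expect (p # ps) (\<lambda>xs. exp (s * (f xs - expect (p # ps) f))) =
      measure_pmf.expectation p (\<lambda>x. expect ps (\<lambda>xs. exp (s * (g x - measure_pmf.expectation p g)) * exp (s * (f (x # xs) - g x))))"
  proof -
    have "exp (s * (f (x # xs) - G)) = exp (s * (g x - G)) * exp (s * (f (x # xs) - g x))" for x xs G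
      by (simp add: algebra_simps flip: exp_add)
    then show ?thesis unfolding Eg unfolding expect.simps
      by (intro Bochner_Integration.integral_cong refl arg_cong[of _ _ "expect ps"] ext)
  qed
  also have "\<dots> \<le> measure_pmf.expectation p (\<lambda>x. exp (s * (g x - measure_pmf.expectation p g)) * exp (length ps * (s\<^sup>2 * c\<^sup>2 / 8)))"
    unfolding expect_cmult using fin IH by (intro integral_mono integrable_measure_pmf_finite mult_left_mono) auto
  also have "\<dots> = measure_pmf.expectation p (\<lambda>x. exp (s * (g x - measure_pmf.expectation p g))) * exp (length ps * (s\<^sup>2 * c\<^sup>2 / 8))"
    by simp
  also have "\<dots> \<le> exp (s\<^sup>2 * c\<^sup>2 / 8) * exp (length ps * (s\<^sup>2 * c\<^sup>2 / 8))"
    using fin bd Cons.prems(2) by (intro mult_right_mono Hoeffding_mgf_pmf) auto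
  also have "\<dots> = exp (length (p # ps) * (s\<^sup>2 * c\<^sup>2 / 8))"
    unfolding exp_add[symmetric] by (simp add: algebra_simps)
  finally show ?case .
qed simp

theorem bounded_differences:
  fixes f :: "'a list \<Rightarrow> real" and T c K :: real
  assumes "fin_supp ps" "ps \<noteq> []" "0 < T" "0 < c"
    and bd: "\<And>us x y vs. Suc (length us + length vs) = length ps \<Longrightarrow> \<bar>f (us @ x # vs) - f (us @ y # vs)\<bar> \<le> c"
    and sq: "2 * T\<^sup>2 \<ge> length ps * c\<^sup>2 * K"
  shows "expect ps (\<lambda>xs. of_bool (expect ps f + T \<le> f xs)) \<le> exp (- K)"
proof -
  define N where "N = real (length ps)"
  have N: "0 < N" using assms by (simp add: N_def)
  \<comment> \<open>The minimizer of the exponent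
    \<open>- s * T + N * (s\<^sup>2 * c\<^sup>2 / 8)\<close> that arises from Markov's
    inequality.\<close>
  define s where "s = 4 * T / (N * c\<^sup>2)"
  have s: "0 < s" using assms N by (simp add: s_def)
  have "expect ps (\<lambda>xs. of_bool (expect ps f + T \<le> f xs)) \<le> expect ps (\<lambda>xs. exp (- s * T) * exp (s * (f xs - expect ps f)))"
  proof (rule expect_mono[OF assms(1)])
    fix xs
    show "of_bool (expect ps f + T \<le> f xs) \<le> exp (- s * T) * exp (s * (f xs - expect ps f))"
    proof (cases "expect ps f + T \<le> f xs")
      case True
      then have "0 \<le> s * (f xs - expect ps f - T)" using s by simp
      then have "1 \<le> exp (s * (f xs - expect ps f - T))" by simp
      also have "exp (s * (f xs - expect ps f - T)) = exp (- s * T) * exp (s * (f xs - expect ps f))"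
        by (simp add: algebra_simps flip: exp_add)
      finally show ?thesis using True by simp
    qed simp
  qed
  also have "\<dots> \<le> exp (- s * T) * exp (N * (s\<^sup>2 * c\<^sup>2 / 8))"
    unfolding expect_cmult N_def using assms(1) s bd by (intro mult_left_mono expect_exp_bounded_differences) auto
  also have "\<dots> = exp (- (2 * T\<^sup>2 / (N * c\<^sup>2)))"
  proof -
    have "- s * T + N * (s\<^sup>2 * c\<^sup>2 / 8) = - (2 * T\<^sup>2 / (N * c\<^sup>2))"
      using N assms(4) by (simp add: s_def field_simps power2_eq_square)
    then show ?thesis by (simp flip: exp_add)
  qed
  also have "\<dots> \<le> exp (- K)"
    using sq N assms(4) by (simp add: field_simps N_def)
  finally show ?thesis .
qed

subsection \<open>Energy distance of binomial distributions\<close>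

text \<open>The operator of a single trial. Its \<open>m\<close>-th power evaluated at 0 is the
  binomial expectation, and trials with different success probabilities are mixed by composing
  operators.\<close>

definition bernoulli_step :: "real \<Rightarrow> (nat \<Rightarrow> real) \<Rightarrow> nat \<Rightarrow> real" where
  "bernoulli_step r \<phi> x = r * \<phi> (Suc x) + (1 - r) * \<phi> x"

definition binom_expect :: "nat \<Rightarrow> real \<Rightarrow> (nat \<Rightarrow> real) \<Rightarrow> real" where
  "binom_expect m r \<phi> = (bernoulli_step r ^^ m) \<phi> 0"

lemma binom_expect_0: "binom_expect 0 r \<phi> = \<phi> 0"
  by (simp add: binom_expect_def)

lemma binom_expect_Suc: "binom_expect (Suc m) r \<phi> = binom_expect m r (bernoulli_step r \<phi>)"
  by (simp only: binom_expect_def funpow_Suc_right o_apply)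

lemma binom_expect_add: "binom_expect m r (\<lambda>x. \<phi> x + \<psi> x) = binom_expect m r \<phi> + binom_expect m r \<psi>"
proof (induction m arbitrary: \<phi> \<psi>)
  case (Suc m)
  have "bernoulli_step r (\<lambda>x. \<phi> x + \<psi> x) = (\<lambda>x. bernoulli_step r \<phi> x + bernoulli_step r \<psi> x)"
    by (auto simp: bernoulli_step_def algebra_simps)
  then show ?case by (simp add: binom_expect_Suc Suc)
qed (simp add: binom_expect_0)

lemma binom_expect_cmult: "binom_expect m r (\<lambda>x. c * \<phi> x) = c * binom_expect m r \<phi>"
proof (induction m arbitrary: \<phi>)
  case (Suc m)
  have "bernoulli_step r (\<lambda>x. c * \<phi> x) = (\<lambda>x. c * bernoulli_step r \<phi> x)"
    by (auto simp: bernoulli_step_def algebra_simps)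
  then show ?case by (simp add: binom_expect_Suc Suc)
qed (simp add: binom_expect_0)

lemma binom_expect_multc: "binom_expect m r (\<lambda>x. \<phi> x * c) = binom_expect m r \<phi> * c"
  using binom_expect_cmult[of m r c \<phi>] by (simp add: mult.commute)

lemma binom_expect_const [simp]: "binom_expect m r (\<lambda>_. c) = c"
proof (induction m)
  case (Suc m)
  have "bernoulli_step r (\<lambda>_. c) = (\<lambda>_. c)"
    by (auto simp: bernoulli_step_def algebra_simps)
  then show ?case by (simp add: binom_expect_Suc Suc)
qed (simp add: binom_expect_0)

lemma binom_expect_diff: "binom_expect m r (\<lambda>x. \<phi> x - \<psi> x) = binom_expect m r \<phi> - binom_expect m r \<psi>"
  using binom_expect_add[of m r \<phi> "\<lambda>x. - 1 * \<psi> x"] by (simp only: binom_expect_cmult) simp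

lemma binom_expect_sum: "binom_expect m r (\<lambda>x. \<Sum>k\<in>A. \<phi> k x) = (\<Sum>k\<in>A. binom_expect m r (\<phi> k))"
  by (induction A rule: infinite_finite_induct) (auto simp: binom_expect_add)

lemma binom_expect_cong:
  "(\<And>x. x \<le> m \<Longrightarrow> \<phi> x = \<psi> x) \<Longrightarrow> binom_expect m r \<phi> = binom_expect m r \<psi>"
proof (induction m arbitrary: \<phi> \<psi>)
  case (Suc m)
  show ?case unfolding binom_expect_Suc by (intro Suc.IH) (simp add: bernoulli_step_def Suc.prems)
qed (simp add: binom_expect_0)

lemma expect_count_list:
  assumes "finite (set_pmf p)"
  shows "expect (replicate m p) (\<lambda>xs. \<phi> (count_list xs i)) = binom_expect m (pmf p i) \<phi>"
proof (induction m arbitrary: \<phi>)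
  case (Suc m)
  have "expect (replicate (Suc m) p) (\<lambda>xs. \<phi> (count_list xs i)) =
      measure_pmf.expectation p (\<lambda>x. indicator {i} x * binom_expect m (pmf p i) (\<lambda>s. \<phi> (Suc s))
        + (1 - indicator {i} x) * binom_expect m (pmf p i) \<phi>)"
    using Suc.IH[of \<phi>] Suc.IH[of "\<lambda>s. \<phi> (Suc s)"]
    by (auto intro!: Bochner_Integration.integral_cong simp: indicator_def)
  also have "\<dots> = pmf p i * binom_expect m (pmf p i) (\<lambda>s. \<phi> (Suc s)) + (1 - pmf p i) * binom_expect m (pmf p i) \<phi>"
    using assms by (simp add: Bochner_Integration.integral_add integrable_measure_pmf_finite
        Bochner_Integration.integral_diff measure_pmf_single)
  also have "\<dots> = binom_expect (Suc m) (pmf p i) \<phi>"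
    by (simp add: binom_expect_Suc bernoulli_step_def[abs_def] binom_expect_add binom_expect_cmult)
  finally show ?case .
qed (simp add: binom_expect_0)

lemma funpow_bernoulli_step_mono:
  assumes "0 \<le> r" "r \<le> 1" "\<And>x. \<phi> x \<le> \<psi> x"
  shows "(bernoulli_step r ^^ m) \<phi> x \<le> (bernoulli_step r ^^ m) \<psi> x"
  using assms
  by (induction m arbitrary: x) (auto simp: bernoulli_step_def intro!: add_mono mult_left_mono)

text \<open>Mean and variance of the binomial distribution. Applied to a parabola below an indicator
  function, with \<open>funpow_bernoulli_step_mono\<close>, this is Chebyshev's inequality. The
  summand \<open>v\<close> carries the variance of trials already processed, so that the lemma can
  be applied twice with different \<open>r\<close>.\<close>

lemma funpow_bernoulli_step_quadratic:
  "(bernoulli_step r ^^ m) (\<lambda>x. \<alpha> - \<beta> * ((real x - c)\<^sup>2 + v)) =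
    (\<lambda>x. \<alpha> - \<beta> * ((real x + m * r - c)\<^sup>2 + m * r * (1 - r) + v))"
proof (induction m)
  case (Suc m)
  show ?case
    unfolding funpow.simps o_apply unfolding Suc unfolding bernoulli_step_def
    by (rule ext) (simp add: algebra_simps power2_eq_square)
qed simp

lemma bernoulli_step_increment:
  "bernoulli_step a \<psi> x - bernoulli_step b \<psi> x = (a - b) * (\<psi> (Suc x) - \<psi> x)"
  by (simp add: bernoulli_step_def algebra_simps)

lemma funpow_bernoulli_step_shift:
  "(bernoulli_step r ^^ l) \<phi> (Suc x) - (bernoulli_step r ^^ l) \<phi> x = (bernoulli_step r ^^ l) (\<lambda>x. \<phi> (Suc x) - \<phi> x) x"
proof (induction l arbitrary: x)
  case (Suc l)
  let ?F = "(bernoulli_step r ^^ l) \<phi>"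
  have "bernoulli_step r ?F (Suc x) - bernoulli_step r ?F x = bernoulli_step r (\<lambda>x. ?F (Suc x) - ?F x) x"
    by (simp add: bernoulli_step_def algebra_simps)
  then show ?case by (simp add: Suc)
qed simp

text \<open>Replace the success probability \<open>b\<close> by \<open>a\<close> one trial at a time.\<close>

lemma binom_expect_hybrid:
  assumes ab: "b \<le> a"
    and hyb: "\<And>j l. j + l + 1 = m \<Longrightarrow>
      \<gamma> \<le> (bernoulli_step a ^^ j) ((bernoulli_step b ^^ l) (\<lambda>x. \<phi> (Suc x) - \<phi> x)) 0"
  shows "m * (a - b) * \<gamma> \<le> binom_expect m a \<phi> - binom_expect m b \<phi>"
proof -
  define D where "D j = (bernoulli_step a ^^ j) ((bernoulli_step b ^^ (m - j)) \<phi>) 0" for j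
  have step: "(a - b) * \<gamma> \<le> D (Suc j) - D j" if "j < m" for j
  proof -
    define \<psi> where "\<psi> = (bernoulli_step b ^^ (m - Suc j)) \<phi>"
    have "m - j = Suc (m - Suc j)" using that by simp
    then have "D (Suc j) - D j =
        binom_expect j a (\<lambda>x. bernoulli_step a \<psi> x - bernoulli_step b \<psi> x)"
      by (simp add: D_def \<psi>_def binom_expect_diff funpow_Suc_right[of j] binom_expect_def[symmetric] del: funpow.simps(2))
        (simp add: binom_expect_def)
    also have "\<dots> = (a - b) * binom_expect j a (\<lambda>x. \<psi> (Suc x) - \<psi> x)"
      unfolding bernoulli_step_increment by (rule binom_expect_cmult)
    also have "(\<lambda>x. \<psi> (Suc x) - \<psi> x) = (bernoulli_step b ^^ (m - Suc j)) (\<lambda>x. \<phi> (Suc x) - \<phi> x)"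
      unfolding \<psi>_def by (intro ext funpow_bernoulli_step_shift)
    also have "(a - b) * \<gamma> \<le> (a - b) * binom_expect j a \<dots>"
      unfolding binom_expect_def using ab that by (intro mult_left_mono hyb) auto
    finally show ?thesis .
  qed
  have "m * (a - b) * \<gamma> = (\<Sum>j<m. (a - b) * \<gamma>)" by simp
  also have "\<dots> \<le> (\<Sum>j<m. D (Suc j) - D j)" by (intro sum_mono step) auto
  also have "\<dots> = D m - D 0" by (rule sum_lessThan_telescope)
  finally show ?thesis by (simp add: D_def binom_expect_def)
qed

lemma card_nats_between:
  assumes "lo \<le> hi" "0 \<le> hi"
  shows "finite {x::nat. lo \<le> real x \<and> real x \<le> hi}"
    and "real (card {x::nat. lo \<le> real x \<and> real x \<le> hi}) \<le> hi - lo + 1"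
proof -
  have sub: "{x::nat. lo \<le> real x \<and> real x \<le> hi} \<subseteq> {nat \<lceil>lo\<rceil>..nat \<lfloor>hi\<rfloor>}"
    using assms by (auto simp: le_nat_floor nat_le_iff ceiling_le_iff)
  then show "finite {x::nat. lo \<le> real x \<and> real x \<le> hi}" by (rule finite_subset) simp
  have "card {x::nat. lo \<le> real x \<and> real x \<le> hi} \<le> Suc (nat \<lfloor>hi\<rfloor>) - nat \<lceil>lo\<rceil>"
    using card_mono[OF _ sub] by simp
  moreover have "real (Suc (nat \<lfloor>hi\<rfloor>) - nat \<lceil>lo\<rceil>) \<le> hi - lo + 1"
  proof -
    have "real (nat \<lfloor>hi\<rfloor>) \<le> hi" "lo \<le> real (nat \<lceil>lo\<rceil>)" using assms by linarith+
    moreover have "real (Suc u - v) \<le> max 0 (real u + 1 - real v)" for u v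
      by (cases "v \<le> Suc u") (auto simp: of_nat_diff)
    ultimately show ?thesis using assms(1) by (smt (verit))
  qed
  ultimately show "real (card {x::nat. lo \<le> real x \<and> real x \<le> hi}) \<le> hi - lo + 1" by linarith
qed

definition mean_dist :: "nat \<Rightarrow> real \<Rightarrow> real \<Rightarrow> real" where
  "mean_dist m a b = binom_expect m a (\<lambda>s. binom_expect m b (\<lambda>t. \<bar>real s - real t\<bar>))"

definition binom_cdf :: "nat \<Rightarrow> real \<Rightarrow> nat \<Rightarrow> real" where
  "binom_cdf m r k = binom_expect m r (\<lambda>s. of_bool (s \<le> k))"

text \<open>The summand is 1 if \<open>k\<close> separates \<open>s\<close> from \<open>t\<close>,
  that is, if exactly one of them is at most \<open>k\<close>, and 0 otherwise.\<close>

lemma abs_diff_eq_sum: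
  assumes "s \<le> K" "t \<le> K"
  shows "\<bar>real s - real t\<bar> = (\<Sum>k<K. of_bool (s \<le> k) + of_bool (t \<le> k) - 2 * of_bool (s \<le> k) * of_bool (t \<le> k))"
proof -
  have *: "\<bar>real s - real t\<bar> = (\<Sum>k<K. of_bool (s \<le> k) + of_bool (t \<le> k) - 2 * of_bool (s \<le> k) * of_bool (t \<le> k))"
    if "s \<le> t" "t \<le> K" for s t
  proof -
    have "(\<Sum>k<K. of_bool (s \<le> k) + of_bool (t \<le> k) - 2 * of_bool (s \<le> k) * of_bool (t \<le> k)) = (\<Sum>k\<in>{s..<t}. 1 :: real)"
      using that by (intro sum.mono_neutral_cong_right) auto
    then show ?thesis using that by simp
  qed
  show ?thesis using *[of s t] *[of t s] assms
    by (cases "s \<le> t") (auto simp: abs_minus_commute add.commute mult.commute mult.left_commute)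
qed

lemma mean_dist_eq:
  assumes "m \<le> K"
  shows "mean_dist m a b = (\<Sum>k<K. binom_cdf m a k + binom_cdf m b k - 2 * binom_cdf m a k * binom_cdf m b k)"
proof -
  have "mean_dist m a b = binom_expect m a (\<lambda>s. binom_expect m b (\<lambda>t.
      \<Sum>k<K. of_bool (s \<le> k) + of_bool (t \<le> k) - 2 * of_bool (s \<le> k) * of_bool (t \<le> k)))"
    unfolding mean_dist_def by (intro binom_expect_cong abs_diff_eq_sum) (use assms in auto)
  also have "\<dots> = binom_expect m a (\<lambda>s.
      \<Sum>k<K. of_bool (s \<le> k) + binom_cdf m b k - 2 * binom_cdf m b k * of_bool (s \<le> k))"
    by (simp add: binom_expect_sum binom_expect_diff binom_expect_add binom_expect_cmult binom_expect_multc binom_cdf_def mult_ac)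
  also have "\<dots> = (\<Sum>k<K. binom_cdf m a k + binom_cdf m b k - 2 * binom_cdf m a k * binom_cdf m b k)"
    by (simp add: binom_expect_sum binom_expect_diff binom_expect_add binom_expect_cmult binom_expect_multc binom_cdf_def mult_ac)
  finally show ?thesis .
qed

definition energy_dist :: "nat \<Rightarrow> real \<Rightarrow> real \<Rightarrow> real" where
  "energy_dist m a b = 2 * mean_dist m a b - mean_dist m a a - mean_dist m b b"

text \<open>The linear terms of the three mean distances cancel and the quadratic ones form a
  square. The range \<open>K\<close> is free above \<open>m\<close> so that it can cover a given
  window.\<close>

lemma energy_dist_eq:
  assumes "m \<le> K"
  shows "energy_dist m a b = 2 * (\<Sum>k<K. (binom_cdf m b k - binom_cdf m a k)\<^sup>2)"
  unfolding energy_dist_def mean_dist_eq[OF assms] sum_distrib_left sum_subtractf[symmetric]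
  by (intro sum.cong) (auto simp: power2_eq_square algebra_simps)

lemma mean_dist_commute: "mean_dist m a b = mean_dist m b a"
  unfolding mean_dist_eq[OF order.refl] by (intro sum.cong) auto

text \<open>The interval \<open>J\<close> contains all but a quarter of the mass of every hybrid of the two binomial
  distributions, and the distribution functions differ on it by 3/4 of the difference of the means.\<close>

lemma energy_dist_ge_ordered:
  assumes ab: "0 \<le> b" "b < a" "a \<le> 1" and m: "0 < m"
  defines "d \<equiv> real m * (a - b)"
  shows "9 / 8 * d\<^sup>2 / (1 + d + 4 * sqrt (m * a)) \<le> energy_dist m a b"
proof -
  \<comment> \<open>Twice an upper bound of the standard deviation, so that Chebyshev's inequality
    loses at most a quarter of the mass.\<close>
  define wd where "wd = 2 * sqrt (m * a)"
  \<comment> \<open>A hybrid consists of \<open>m - 1\<close> trials, because one trial is used up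
    by the increment; its mean lies between \<open>(m - 1) * b\<close> and
    \<open>(m - 1) * a\<close>.\<close>
  define lo where "lo = real (m - 1) * b - wd"
  define hi where "hi = real (m - 1) * a + wd"
  define J where "J = {x::nat. lo \<le> real x \<and> real x \<le> hi}"
  define K where "K = Suc (Max (insert m J))"
  have wd: "0 < wd" "wd\<^sup>2 = 4 * (m * a)" using ab m by (auto simp: wd_def power_mult_distrib)
  have d: "0 < d" using ab m by (simp add: d_def)
  have base: "real (m - 1) * b \<le> real (m - 1) * a" "0 \<le> real (m - 1) * a"
    using ab by (auto intro: mult_left_mono)
  then have lohi: "lo \<le> hi" "0 \<le> hi" unfolding lo_def hi_def using wd by linarith+
  have J: "finite J" "real (card J) \<le> hi - lo + 1"
    unfolding J_def by (rule card_nats_between[OF lohi])+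
  have "real (m - 1) * (a - b) \<le> d" unfolding d_def using ab by (intro mult_right_mono) auto
  then have "hi - lo + 1 \<le> 1 + d + 4 * sqrt (m * a)" by (simp add: hi_def lo_def wd_def algebra_simps)
  then have cardJ: "real (card J) \<le> 1 + d + 4 * sqrt (m * a)" using J by linarith
  have "Max (insert m J) \<ge> x" if "x \<in> insert m J" for x using J that by (intro Max_ge) auto
  then have K: "m \<le> K" "J \<subseteq> {..<K}" by (force simp: K_def)+
  \<comment> \<open>A test function whose increment is the indicator of \<open>J\<close>. By the
    hybrid argument, its two binomial expectations differ by at least 3/4 of the difference of the
    means; on the other hand, they differ by the sum over \<open>J\<close> of the differences of the
    distribution functions.\<close>
  define \<phi> where "\<phi> x = (\<Sum>k\<in>J. of_bool (k < x) :: real)" for x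
  have inc: "\<phi> (Suc x) - \<phi> x = of_bool (x \<in> J)" for x
  proof -
    have "\<phi> (Suc x) - \<phi> x = (\<Sum>k\<in>J. if k = x then 1 else 0)"
      unfolding \<phi>_def sum_subtractf[symmetric] by (intro sum.cong) auto
    then show ?thesis using J by simp
  qed
  have hyb: "3 / 4 \<le> (bernoulli_step a ^^ j) ((bernoulli_step b ^^ l) (\<lambda>x. \<phi> (Suc x) - \<phi> x)) 0"
    if jl: "j + l + 1 = m" for j l
  proof -
    define c where "c = j * a + l * b"
    have m1: "real (m - 1) = j + l" using jl by auto
    have "l * b \<le> l * a" "j * b \<le> j * a" using ab by (auto intro: mult_left_mono)
    then have c: "real (m - 1) * b \<le> c" "c \<le> real (m - 1) * a"
      unfolding m1 c_def by (auto simp: algebra_simps)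
    \<comment> \<open>A parabola below the indicator of \<open>J\<close>, for Chebyshev's
      inequality.\<close>
    have low: "1 - 1 / wd\<^sup>2 * ((real x - c)\<^sup>2 + 0) \<le> \<phi> (Suc x) - \<phi> x" for x
    proof (cases "x \<in> J")
      case False
      then have "wd \<le> \<bar>real x - c\<bar>" using c by (auto simp: J_def lo_def hi_def)
      then have "wd\<^sup>2 \<le> (real x - c)\<^sup>2" using wd by (metis abs_le_square_iff abs_of_pos)
      then have "1 \<le> (real x - c)\<^sup>2 / wd\<^sup>2" using wd(1) by simp
      then show ?thesis by (simp add: inc False)
    qed (simp add: inc)
    have "b * (1 - b) \<le> a" "a * (1 - a) \<le> a"
      using ab mult_left_le[of "1 - b" b] mult_left_le[of "1 - a" a] by auto
    then have "j * (a * (1 - a)) + l * (b * (1 - b)) \<le> j * a + l * a"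
      by (intro add_mono mult_left_mono) auto
    also have "\<dots> \<le> m * a" using jl ab by (auto simp flip: distrib_right intro!: mult_right_mono)
    finally have "(j * a * (1 - a) + l * b * (1 - b)) / wd\<^sup>2 \<le> 1 / 4"
      unfolding wd(2) using m ab by (simp add: field_simps)
    \<comment> \<open>The parabola is centred at the mean \<open>c\<close> of the hybrid, so the
      square vanishes and only the variances of the two groups of trials remain.\<close>
    then have "3 / 4 \<le> 1 - 1 / wd\<^sup>2 * ((real 0 + j * a - (c - l * b))\<^sup>2 + j * a * (1 - a) + (l * b * (1 - b) + 0))"
      by (simp add: c_def)
    also have "\<dots> = (bernoulli_step a ^^ j) (\<lambda>x. 1 - 1 / wd\<^sup>2 * ((real x - (c - l * b))\<^sup>2 + (l * b * (1 - b) + 0))) 0"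
      unfolding funpow_bernoulli_step_quadratic ..
    also have "(\<lambda>x. 1 - 1 / wd\<^sup>2 * ((real x - (c - l * b))\<^sup>2 + (l * b * (1 - b) + 0))) =
        (bernoulli_step b ^^ l) (\<lambda>x. 1 - 1 / wd\<^sup>2 * ((real x - c)\<^sup>2 + 0))"
      unfolding funpow_bernoulli_step_quadratic by (simp add: algebra_simps)
    also have "(bernoulli_step a ^^ j) \<dots> 0 \<le> (bernoulli_step a ^^ j) ((bernoulli_step b ^^ l) (\<lambda>x. \<phi> (Suc x) - \<phi> x)) 0"
      using ab low by (intro funpow_bernoulli_step_mono) auto
    finally show ?thesis .
  qed
  define G where "G k = binom_cdf m b k - binom_cdf m a k" for k
  have "m * (a - b) * (3 / 4) \<le> binom_expect m a \<phi> - binom_expect m b \<phi>"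
    by (rule binom_expect_hybrid[OF _ hyb]) (use ab in auto)
  also have "\<dots> = (\<Sum>k\<in>J. G k)"
  proof -
    have "binom_expect m r \<phi> = (\<Sum>k\<in>J. 1 - binom_cdf m r k)" for r
    proof -
      have "\<phi> = (\<lambda>x. \<Sum>k\<in>J. 1 - of_bool (x \<le> k))"
        by (auto simp: \<phi>_def fun_eq_iff intro!: sum.cong)
      then show ?thesis by (simp add: binom_expect_sum binom_expect_diff binom_cdf_def)
    qed
    then show ?thesis by (simp add: G_def sum_subtractf)
  qed
  finally have "3 / 4 * d \<le> (\<Sum>k\<in>J. 1 * G k)" by (simp add: d_def)
  then have "(3 / 4 * d)\<^sup>2 \<le> (\<Sum>k\<in>J. 1 * G k)\<^sup>2" using d by (intro power_mono) auto
  also have "\<dots> \<le> (\<Sum>k\<in>J. 1\<^sup>2) * (\<Sum>k\<in>J. (G k)\<^sup>2)" by (rule Cauchy_Schwarz_ineq_sum)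
  also have "\<dots> \<le> (1 + d + 4 * sqrt (m * a)) * (\<Sum>k<K. (G k)\<^sup>2)"
    using cardJ K J d ab by (intro mult_mono sum_mono2 sum_nonneg) auto
  finally have "2 * (3 / 4 * d)\<^sup>2 \<le> (1 + d + 4 * sqrt (m * a)) * energy_dist m a b"
    unfolding energy_dist_eq[OF K(1)] G_def by simp
  moreover have "0 < 1 + d + 4 * sqrt (m * a)" using d ab by (intro add_pos_nonneg) auto
  moreover have "2 * (3 / 4 * d)\<^sup>2 = 9 / 8 * d\<^sup>2" by (simp add: power_mult_distrib power_divide)
  ultimately show ?thesis by (simp only: pos_divide_le_eq mult.commute[of "energy_dist m a b"])
qed

text \<open>With \<open>a + b\<close> in place of the larger probability, the bound is symmetric and
  its denominators can be summed over the elements.\<close>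

lemma energy_dist_ge:
  assumes "0 \<le> a" "a \<le> 1" "0 \<le> b" "b \<le> 1" and m: "0 < m"
  shows "9 / 8 * (m * \<bar>a - b\<bar>)\<^sup>2 / (1 + m * \<bar>a - b\<bar> + 4 * sqrt (m * (a + b))) \<le> energy_dist m a b"
proof -
  have *: "9 / 8 * (m * \<bar>a - b\<bar>)\<^sup>2 / (1 + m * \<bar>a - b\<bar> + 4 * sqrt (m * (a + b))) \<le> energy_dist m a b"
    if "b < a" "0 \<le> b" "a \<le> 1" for a b :: real
  proof -
    have "9 / 8 * (m * (a - b))\<^sup>2 / (1 + m * (a - b) + 4 * sqrt (m * (a + b))) \<le>
        9 / 8 * (m * (a - b))\<^sup>2 / (1 + m * (a - b) + 4 * sqrt (m * a))"
      using that by (intro divide_left_mono mult_pos_pos add_left_mono mult_left_mono real_sqrt_le_mono)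
        (auto intro!: add_pos_nonneg)
    also have "\<dots> \<le> energy_dist m a b" using energy_dist_ge_ordered[of b a m] that m by simp
    finally show ?thesis using that by simp
  qed
  have "energy_dist m a b = energy_dist m b a" for a b
    using mean_dist_commute[of m a b] by (simp add: energy_dist_def)
  then show ?thesis using *[of b a] *[of a b] assms
    by (cases a b rule: linorder_cases) (auto simp: abs_minus_commute add.commute energy_dist_def)
qed

subsection \<open>The tester\<close>

definition block_count :: "nat \<Rightarrow> nat \<Rightarrow> nat \<Rightarrow> nat list \<Rightarrow> real" where
  "block_count m b i zs = (\<Sum>j<m. of_bool (zs ! (b * m + j) = i))"

text \<open>Blocks 0 and 1 are samples of \<open>p\<close>, blocks 2 and 3 samples of
  \<open>q\<close>.\<close>

definition energy_term :: "nat \<Rightarrow> nat \<Rightarrow> nat list \<Rightarrow> real" where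
  "energy_term m i zs =
     \<bar>block_count m 0 i zs - block_count m 2 i zs\<bar> + \<bar>block_count m 1 i zs - block_count m 3 i zs\<bar>
     - \<bar>block_count m 0 i zs - block_count m 1 i zs\<bar> - \<bar>block_count m 2 i zs - block_count m 3 i zs\<bar>"

definition energy_stat :: "nat \<Rightarrow> nat \<Rightarrow> nat list \<Rightarrow> real" where
  "energy_stat n m zs = (\<Sum>i=1..n. energy_term m i zs)"

lemma block_count_change:
  "\<bar>block_count m b i (us @ x # vs) - block_count m b i (us @ y # vs)\<bar> =
    of_bool (b * m \<le> length us \<and> length us < b * m + m) * \<bar>of_bool (x = i) - of_bool (y = i)\<bar>"
proof -
  let ?e = "of_bool (x = i) - of_bool (y = i) :: real"
  have "block_count m b i (us @ x # vs) - block_count m b i (us @ y # vs) =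
      (\<Sum>j<m. if j = length us - b * m then of_bool (b * m \<le> length us) * ?e else 0)"
    unfolding block_count_def sum_subtractf[symmetric]
    by (intro sum.cong refl) (auto simp: nth_append nth_Cons split: nat.splits)
  also have "\<dots> = of_bool (b * m \<le> length us \<and> length us < b * m + m) * ?e"
    by (auto simp: sum.delta)
  finally show ?thesis by (simp add: abs_mult)
qed

lemma abs_diff_combination_le:
  fixes f1 f2 f3 f4 g1 g2 g3 g4 :: real
  assumes "\<bar>f1 - g1\<bar> \<le> p1" "\<bar>f2 - g2\<bar> \<le> p2" "\<bar>f3 - g3\<bar> \<le> p3" "\<bar>f4 - g4\<bar> \<le> p4"
  shows "\<bar>(f1 + f2 - f3 - f4) - (g1 + g2 - g3 - g4)\<bar> \<le> p1 + p2 + p3 + p4"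
  using assms by (simp only: abs_le_iff) linarith

text \<open>A replacement affects only the elements \<open>x\<close> and \<open>y\<close>, and their
  counts only in the block that contains the position. Each block count occurs in two absolute
  values, so each of the two elements accounts for at most 2.\<close>

lemma energy_stat_bounded_differences:
  "\<bar>energy_stat n m (us @ x # vs) - energy_stat n m (us @ y # vs)\<bar> \<le> 4"
proof -
  let ?u = "us @ x # vs" and ?v = "us @ y # vs"
  have "\<bar>energy_term m i ?u - energy_term m i ?v\<bar> \<le> 2 * (of_bool (i = x) + of_bool (i = y))" for i
  proof -
    define h where "h b = (of_bool (b * m \<le> length us \<and> length us < b * m + m) :: real)" for b
    define e where "e = \<bar>of_bool (x = i) - of_bool (y = i) :: real\<bar>"
    define D where "D b = \<bar>block_count m b i ?u - block_count m b i ?v\<bar>" for b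
    have D: "D b = h b * e" for b by (simp add: D_def h_def e_def block_count_change)
    have "h 0 + h 1 + h 2 + h 3 \<le> 1" unfolding h_def by (auto simp: of_bool_def)
    then have "2 * ((h 0 + h 1 + h 2 + h 3) * e) \<le> 2 * (1 * e)"
      by (intro mult_left_mono mult_right_mono) (auto simp: e_def)
    then have D_le: "2 * (D 0 + D 1 + D 2 + D 3) \<le> 2 * e" by (simp only: D ring_distribs mult_1)
    have "\<bar>energy_term m i ?u - energy_term m i ?v\<bar> \<le> 2 * (D 0 + D 1 + D 2 + D 3)"
    proof -
      have "\<bar>\<bar>block_count m b i ?u - block_count m c i ?u\<bar> - \<bar>block_count m b i ?v - block_count m c i ?v\<bar>\<bar> \<le> D b + D c" for b c
        unfolding D_def by linarith
      then have "\<bar>energy_term m i ?u - energy_term m i ?v\<bar> \<le> (D 0 + D 2) + (D 1 + D 3) + (D 0 + D 1) + (D 2 + D 3)"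
        unfolding energy_term_def by (intro abs_diff_combination_le)
      also have "\<dots> = 2 * (D 0 + D 1 + D 2 + D 3)" by (simp only: mult_2 add_ac)
      finally show ?thesis .
    qed
    also note D_le
    also have "2 * e \<le> 2 * (of_bool (i = x) + of_bool (i = y))" by (auto simp: e_def)
    finally show ?thesis .
  qed
  then have "\<bar>energy_stat n m ?u - energy_stat n m ?v\<bar> \<le> (\<Sum>i=1..n. 2 * (of_bool (i = x) + of_bool (i = y)))"
    unfolding energy_stat_def sum_subtractf[symmetric] by (intro order.trans[OF sum_abs] sum_mono)
  also have "\<dots> = 2 * ((\<Sum>i=1..n. of_bool (i = x)) + (\<Sum>i=1..n. of_bool (i = y)))"
    by (simp only: sum.distrib sum_distrib_left[symmetric])
  also have "\<dots> \<le> 2 * (1 + 1)"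
    by (intro mult_left_mono add_mono) (auto simp: of_bool_def)
  finally show ?thesis by simp
qed

lemma count_list_eq_sum: "real (count_list xs i) = (\<Sum>j<length xs. of_bool (xs ! j = i))"
proof (induction xs)
  case (Cons x xs)
  then show ?case by (simp add: sum.lessThan_Suc_shift del: sum.lessThan_Suc)
qed simp

lemma block_count_append:
  assumes "length x1 = m" "length x2 = m" "length y1 = m" "length y2 = m"
  shows "block_count m 0 i (x1 @ x2 @ y1 @ y2) = count_list x1 i"
    "block_count m 1 i (x1 @ x2 @ y1 @ y2) = count_list x2 i"
    "block_count m 2 i (x1 @ x2 @ y1 @ y2) = count_list y1 i"
    "block_count m 3 i (x1 @ x2 @ y1 @ y2) = count_list y2 i"
  using assms by (auto simp: block_count_def count_list_eq_sum nth_append intro!: sum.cong)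

lemma dists_finite: "p \<in> dists n \<Longrightarrow> finite (set_pmf p)"
  by (auto simp: dists_def intro: finite_subset)

lemma dists_sum: "p \<in> dists n \<Longrightarrow> (\<Sum>i=1..n. pmf p i) = 1"
  by (auto simp: dists_def intro: sum_pmf_eq_1)

lemma expect_energy_stat:
  assumes "finite (set_pmf p)" "finite (set_pmf q)"
  shows "expect (replicate (2 * m) p @ replicate (2 * m) q) (energy_stat n m) =
    (\<Sum>i=1..n. energy_dist m (pmf p i) (pmf q i))"
proof -
  let ?P = "replicate m p" and ?Q = "replicate m q"
  have fin: "fin_supp ?P" "fin_supp ?Q" using assms by auto
  let ?d = "\<lambda>i xs ys. \<bar>real (count_list xs i) - real (count_list ys i)\<bar>"
  have cross: "expect (replicate m p) (\<lambda>xs. expect (replicate m q) (\<lambda>ys. ?d i xs ys)) = mean_dist m (pmf p i) (pmf q i)"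
    if "finite (set_pmf p)" "finite (set_pmf q)" for p q i
    using expect_count_list[OF that(2), of m "\<lambda>t. \<bar>real _ - real t\<bar>" i]
      expect_count_list[OF that(1), of m "\<lambda>s. binom_expect m (pmf q i) (\<lambda>t. \<bar>real s - real t\<bar>)" i]
    by (simp add: mean_dist_def)
  have "replicate (2 * m) p @ replicate (2 * m) q = ?P @ ?P @ ?Q @ ?Q"
    by (simp add: mult_2 replicate_add)
  then have "expect (replicate (2 * m) p @ replicate (2 * m) q) (energy_stat n m) =
    expect ?P (\<lambda>x1. expect ?P (\<lambda>x2. expect ?Q (\<lambda>y1. expect ?Q (\<lambda>y2. energy_stat n m (x1 @ x2 @ y1 @ y2)))))"
    by (simp add: expect_append)
  also have "\<dots> = expect ?P (\<lambda>x1. expect ?P (\<lambda>x2. expect ?Q (\<lambda>y1. expect ?Q (\<lambda>y2.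
      \<Sum>i=1..n. ?d i x1 y1 + ?d i x2 y2 - ?d i x1 x2 - ?d i y1 y2))))"
    by (intro expect_cong) (simp add: energy_stat_def energy_term_def block_count_append block_count_append(2)[unfolded One_nat_def])
  also have "\<dots> = (\<Sum>i=1..n. mean_dist m (pmf p i) (pmf q i) + mean_dist m (pmf p i) (pmf q i)
      - mean_dist m (pmf p i) (pmf p i) - mean_dist m (pmf q i) (pmf q i))"
    using fin assms by (simp add: expect_sum expect_add expect_diff cross)
  finally show ?thesis by (simp add: energy_dist_def)
qed

text \<open>By Cauchy-Schwarz, the sum of \<open>(x i)\<^sup>2 / B i\<close> is at least the squared
  sum of the \<open>x i\<close> divided by the sum of the \<open>B i\<close>. The \<open>x i\<close>
  add up to \<open>2 * m * \<tau>\<close>; the roots in the \<open>B i\<close> are summed by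
  Cauchy-Schwarz once more.\<close>

lemma expect_energy_stat_far:
  assumes p: "p \<in> dists n" and q: "q \<in> dists n" and m: "0 < m" and n: "0 < n"
  defines "\<tau> \<equiv> d_TV n p q"
  shows "9 / 2 * m\<^sup>2 * \<tau>\<^sup>2 / (n + 2 * m * \<tau> + 4 * sqrt (2 * n * m)) \<le>
    expect (replicate (2 * m) p @ replicate (2 * m) q) (energy_stat n m)"
proof -
  define x where "x i = m * \<bar>pmf p i - pmf q i\<bar>" for i
  define B where "B i = 1 + x i + 4 * sqrt (m * (pmf p i + pmf q i))" for i
  have x: "0 \<le> x i" for i by (simp add: x_def)
  have B: "0 < B i" for i unfolding B_def using x[of i] by (intro add_pos_nonneg) auto
  have sx: "(\<Sum>i=1..n. x i) = 2 * m * \<tau>"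
    by (simp add: x_def \<tau>_def d_TV_def sum_distrib_left)
  have "(\<Sum>i=1..n. sqrt (m * (pmf p i + pmf q i))) = (\<Sum>i=1..n. 1 * sqrt (m * (pmf p i + pmf q i)))" by simp
  also have "\<dots> \<le> sqrt (2 * n * m)"
  proof (rule real_le_rsqrt)
    have "(\<Sum>i=1..n. 1 * sqrt (m * (pmf p i + pmf q i)))\<^sup>2 \<le>
        (\<Sum>i=1..n. 1\<^sup>2) * (\<Sum>i=1..n. (sqrt (m * (pmf p i + pmf q i)))\<^sup>2)"
      by (rule Cauchy_Schwarz_ineq_sum)
    also have "\<dots> = n * (\<Sum>i=1..n. m * (pmf p i + pmf q i))" by simp
    also have "(\<Sum>i=1..n. m * (pmf p i + pmf q i)) = 2 * m"
      using dists_sum[OF p] dists_sum[OF q] by (simp add: sum.distrib ring_distribs flip: sum_distrib_left)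
    finally show "(\<Sum>i=1..n. 1 * sqrt (m * (pmf p i + pmf q i)))\<^sup>2 \<le> real (2 * n * m)"
      by (simp add: mult_ac)
  qed
  finally have sB: "(\<Sum>i=1..n. B i) \<le> n + 2 * m * \<tau> + 4 * sqrt (2 * n * m)"
    by (simp add: B_def sum.distrib sx[simplified] flip: sum_distrib_left)
  have sBpos: "0 < (\<Sum>i=1..n. B i)" using B n by (intro sum_pos) auto
  have "(2 * m * \<tau>)\<^sup>2 = (\<Sum>i=1..n. sqrt (B i) * (x i / sqrt (B i)))\<^sup>2"
  proof -
    have "B i \<noteq> 0" for i using B[of i] by simp
    then have "(\<Sum>i=1..n. sqrt (B i) * (x i / sqrt (B i))) = (\<Sum>i=1..n. x i)" by (intro sum.cong) auto
    then show ?thesis by (simp only: sx)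
  qed
  also have "\<dots> \<le> (\<Sum>i=1..n. (sqrt (B i))\<^sup>2) * (\<Sum>i=1..n. (x i / sqrt (B i))\<^sup>2)"
    by (rule Cauchy_Schwarz_ineq_sum)
  also have "\<dots> = (\<Sum>i=1..n. B i) * (\<Sum>i=1..n. (x i)\<^sup>2 / B i)"
    using B by (simp add: less_imp_le power_divide)
  also have "\<dots> \<le> (n + 2 * m * \<tau> + 4 * sqrt (2 * n * m)) * (\<Sum>i=1..n. (x i)\<^sup>2 / B i)"
    by (intro mult_right_mono sB sum_nonneg divide_nonneg_pos B) auto
  finally have "(2 * m * \<tau>)\<^sup>2 / (n + 2 * m * \<tau> + 4 * sqrt (2 * n * m)) \<le> (\<Sum>i=1..n. (x i)\<^sup>2 / B i)"
    using sB sBpos by (simp add: pos_divide_le_eq mult.commute)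
  then have "9 / 8 * ((2 * m * \<tau>)\<^sup>2 / (n + 2 * m * \<tau> + 4 * sqrt (2 * n * m))) \<le> 9 / 8 * (\<Sum>i=1..n. (x i)\<^sup>2 / B i)"
    by (rule mult_left_mono) simp
  also have "\<dots> = (\<Sum>i=1..n. 9 / 8 * (x i)\<^sup>2 / B i)" by (simp add: sum_distrib_left)
  also have "\<dots> \<le> (\<Sum>i=1..n. energy_dist m (pmf p i) (pmf q i))"
    unfolding x_def B_def using m by (intro sum_mono energy_dist_ge) (auto simp: pmf_le_1)
  also have "\<dots> = expect (replicate (2 * m) p @ replicate (2 * m) q) (energy_stat n m)"
    using p q by (simp add: expect_energy_stat dists_finite)
  finally show ?thesis by (simp add: power_mult_distrib mult_ac)
qed

text \<open>The numerator is split into three equal parts, one for each summand of the denominator,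
  and each comparison is made between squares. The tightest one, for the root, compares 4096 with
  4500 = 9/4 * 2000.\<close>

lemma sample_size_gap:
  fixes m n k \<epsilon> \<tau> :: real
  assumes pos: "0 < m" "0 < n" "0 < k" "0 < \<epsilon>" "\<epsilon> \<le> \<tau>"
    and m1: "2000 * n\<^sup>2 * k \<le> m ^ 3 * \<epsilon> ^ 4" and m2: "2000 * n * k \<le> m\<^sup>2 * \<epsilon> ^ 4" and m3: "2000 * k \<le> m * \<epsilon>\<^sup>2"
  shows "2 * sqrt (32 * m * k) \<le> 9 / 2 * m\<^sup>2 * \<tau>\<^sup>2 / (n + 2 * m * \<tau> + 4 * sqrt (2 * n * m))"
proof -
  define T where "T = sqrt (32 * m * k)"
  have T: "0 \<le> T" "T\<^sup>2 = 32 * m * k" using pos by (auto simp: T_def)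
  have te: "\<epsilon>\<^sup>2 \<le> \<tau>\<^sup>2" "\<epsilon> ^ 4 \<le> \<tau> ^ 4" using pos by (auto intro: power_mono)
  have tau: "0 < \<tau>" using pos by linarith
  have a: "2 * T * n \<le> 3 / 2 * m\<^sup>2 * \<tau>\<^sup>2"
  proof (rule power2_le_imp_le)
    have "(2 * T * n)\<^sup>2 = 128 * m * (n\<^sup>2 * k)" by (simp add: power_mult_distrib T)
    also have "\<dots> \<le> 4500 * m * (n\<^sup>2 * k)" using pos by (intro mult_right_mono) auto
    also have "\<dots> = 9 / 4 * m * (2000 * n\<^sup>2 * k)" by simp
    also have "\<dots> \<le> 9 / 4 * m * (m ^ 3 * \<tau> ^ 4)"
      using pos te by (intro mult_left_mono order.trans[OF m1]) auto
    also have "\<dots> = (3 / 2 * m\<^sup>2 * \<tau>\<^sup>2)\<^sup>2" by (simp add: power_mult_distrib power2_eq_square power3_eq_cube power4_eq_xxxx)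
    finally show "(2 * T * n)\<^sup>2 \<le> (3 / 2 * m\<^sup>2 * \<tau>\<^sup>2)\<^sup>2" .
  qed (use pos in auto)
  have b: "2 * T * (2 * m * \<tau>) \<le> 3 / 2 * m\<^sup>2 * \<tau>\<^sup>2"
  proof -
    have "2 * T * 2 \<le> 3 / 2 * m * \<tau>"
    proof (rule power2_le_imp_le)
      have "(2 * T * 2)\<^sup>2 = 512 * m * k" by (simp add: power_mult_distrib T)
      also have "\<dots> \<le> 4500 * m * k" using pos by (intro mult_right_mono) auto
      also have "\<dots> = 9 / 4 * m * (2000 * k)" by simp
      also have "\<dots> \<le> 9 / 4 * m * (m * \<tau>\<^sup>2)"
        using pos te by (intro mult_left_mono order.trans[OF m3]) auto
      also have "\<dots> = (3 / 2 * m * \<tau>)\<^sup>2" by (simp add: power_mult_distrib power2_eq_square)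
      finally show "(2 * T * 2)\<^sup>2 \<le> (3 / 2 * m * \<tau>)\<^sup>2" .
    qed (use pos tau in auto)
    then have "2 * T * 2 * (m * \<tau>) \<le> 3 / 2 * m * \<tau> * (m * \<tau>)" using pos tau by (intro mult_right_mono) auto
    then show ?thesis by (simp add: power2_eq_square mult_ac)
  qed
  have c: "2 * T * (4 * sqrt (2 * n * m)) \<le> 3 / 2 * m\<^sup>2 * \<tau>\<^sup>2"
  proof (rule power2_le_imp_le)
    have "(2 * T * (4 * sqrt (2 * n * m)))\<^sup>2 = 4096 * m\<^sup>2 * (n * k)"
      using pos by (simp add: power_mult_distrib T) (simp add: power2_eq_square)
    also have "\<dots> \<le> 4500 * m\<^sup>2 * (n * k)" using pos by (intro mult_right_mono) auto
    also have "\<dots> = 9 / 4 * m\<^sup>2 * (2000 * n * k)" by simp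
    also have "\<dots> \<le> 9 / 4 * m\<^sup>2 * (m\<^sup>2 * \<tau> ^ 4)"
      using pos te by (intro mult_left_mono order.trans[OF m2]) auto
    also have "\<dots> = (3 / 2 * m\<^sup>2 * \<tau>\<^sup>2)\<^sup>2" by (simp add: power_mult_distrib power2_eq_square power4_eq_xxxx)
    finally show "(2 * T * (4 * sqrt (2 * n * m)))\<^sup>2 \<le> (3 / 2 * m\<^sup>2 * \<tau>\<^sup>2)\<^sup>2" .
  qed (use pos in auto)
  have "0 < n + 2 * m * \<tau> + 4 * sqrt (2 * n * m)" using pos tau by (intro add_pos_nonneg) auto
  moreover have "2 * T * (n + 2 * m * \<tau> + 4 * sqrt (2 * n * m)) \<le> 9 / 2 * m\<^sup>2 * \<tau>\<^sup>2"
    using a b c by (simp add: ring_distribs)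
  ultimately have "2 * T \<le> 9 / 2 * m\<^sup>2 * \<tau>\<^sup>2 / (n + 2 * m * \<tau> + 4 * sqrt (2 * n * m))"
    by (simp only: pos_le_divide_eq)
  then show ?thesis unfolding T_def .
qed

text \<open>The threshold \<open>sqrt (32 * m * k)\<close> is compared in squared form, which the programs can evaluate.\<close>

definition accepts :: "nat \<Rightarrow> nat \<Rightarrow> nat \<Rightarrow> nat list \<Rightarrow> bool" where
  "accepts n m k zs \<longleftrightarrow> \<not> (0 \<le> energy_stat n m zs \<and> 32 * real m * real k \<le> (energy_stat n m zs)\<^sup>2)"

lemma accepts_iff: "accepts n m k zs \<longleftrightarrow> energy_stat n m zs < sqrt (32 * m * k)"
proof -
  have "sqrt (32 * m * k) \<le> z \<longleftrightarrow> 0 \<le> z \<and> 32 * real m * real k \<le> z\<^sup>2" for z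
  proof
    have "0 \<le> sqrt (32 * m * k)" by simp
    also assume "sqrt (32 * m * k) \<le> z"
    finally show "0 \<le> z \<and> 32 * real m * real k \<le> z\<^sup>2"
      using sqrt_le_D[OF \<open>sqrt (32 * m * k) \<le> z\<close>] by simp
  qed (auto intro: real_le_lsqrt)
  then show ?thesis unfolding accepts_def by (simp add: not_le[symmetric])
qed

text \<open>With \<open>T\<close> for the threshold, the statistic has mean 0 if
  \<open>p = q\<close> and at least \<open>2 * T\<close> in the far case, so either error is a
  deviation by \<open>T\<close> from the mean. For \<open>4 * m\<close> samples and differences of
  at most 4, the bound \<open>exp (- k)\<close> requires
  \<open>2 * T\<^sup>2 \<ge> 4 * m * 4\<^sup>2 * k\<close>, whence the number 32. The lower tail is
  the upper tail of the negated statistic.\<close>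

lemma energy_tester:
  assumes m: "0 < m" and n: "0 < n" and k: "0 < k" and eps: "0 < \<epsilon>" and d: "exp (- real k) \<le> \<delta>"
    and m1: "2000 * (real n)\<^sup>2 * k \<le> real m ^ 3 * \<epsilon> ^ 4" and m2: "2000 * real n * k \<le> (real m)\<^sup>2 * \<epsilon> ^ 4"
    and m3: "2000 * real k \<le> m * \<epsilon>\<^sup>2"
    and A: "\<And>xs ys. A xs ys = return_pmf (accepts n m k (xs @ ys))"
  shows "closeness_tester n \<epsilon> \<delta> (2 * m) (2 * m) A"
  unfolding closeness_tester_def
proof (intro ballI conjI impI)
  fix p q assume p: "p \<in> dists n" and q: "q \<in> dists n"
  define T where "T = sqrt (32 * m * k)"
  have T: "0 < T" "T\<^sup>2 = 32 * m * k" using m k by (auto simp: T_def)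
  let ?R = "replicate (2 * m) p @ replicate (2 * m) q"
  have fin: "fin_supp ?R" "?R \<noteq> []" using p q m by (auto simp: dists_finite)
  have pm: "pmf (verdict (2 * m) (2 * m) A p q) c = expect ?R (\<lambda>zs. of_bool (accepts n m k zs = c))" for c
    unfolding pmf_verdict A append_take_drop_id by (intro expect_cong) (simp add: pmf_return)
  have tail: "expect ?R (\<lambda>zs. of_bool (expect ?R f + T \<le> f zs)) \<le> \<delta>"
    if "\<And>us x y vs. \<bar>f (us @ x # vs) - f (us @ y # vs)\<bar> \<le> 4" for f
  proof -
    have "expect ?R (\<lambda>zs. of_bool (expect ?R f + T \<le> f zs)) \<le> exp (- real k)"
      by (rule bounded_differences[OF fin T(1), where c = 4]) (use T that in auto)
    with d show ?thesis by linarith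
  qed
  show "1 - \<delta> \<le> pmf (verdict (2 * m) (2 * m) A p q) True" if "p = q"
  proof -
    have "expect ?R (energy_stat n m) = 0"
      using p q that by (simp add: expect_energy_stat dists_finite energy_dist_def)
    moreover have "accepts n m k zs = False \<longleftrightarrow> T \<le> energy_stat n m zs" for zs
      unfolding accepts_iff T_def by auto
    ultimately have "pmf (verdict (2 * m) (2 * m) A p q) False \<le> \<delta>"
      using tail[of "energy_stat n m"] energy_stat_bounded_differences unfolding pm by simp
    then show ?thesis by (simp add: pmf_bool_False)
  qed
  show "1 - \<delta> \<le> pmf (verdict (2 * m) (2 * m) A p q) False" if far: "\<epsilon> \<le> d_TV n p q"
  proof -
    let ?E = "expect ?R (energy_stat n m)"
    have "2 * T \<le> 9 / 2 * m\<^sup>2 * (d_TV n p q)\<^sup>2 / (n + 2 * m * d_TV n p q + 4 * sqrt (2 * n * m))"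
      using sample_size_gap[of "real m" "real n" "real k" \<epsilon>] m n k eps far m1 m2 m3 by (simp add: T_def)
    also have "\<dots> \<le> ?E"
      using expect_energy_stat_far[OF p q m n] by simp
    finally have E: "2 * T \<le> ?E" .
    have neg: "expect ?R (\<lambda>zs. - energy_stat n m zs) = - ?E"
      using expect_cmult[of ?R "- 1" "energy_stat n m"] by simp
    have "pmf (verdict (2 * m) (2 * m) A p q) True \<le>
        expect ?R (\<lambda>zs. of_bool (expect ?R (\<lambda>zs. - energy_stat n m zs) + T \<le> - energy_stat n m zs))"
      unfolding pm neg using E by (intro expect_mono fin) (auto simp: accepts_iff T_def)
    also have "\<dots> \<le> \<delta>"
    proof (rule tail[of "\<lambda>zs. - energy_stat n m zs"])
      show "\<bar>- energy_stat n m (us @ x # vs) - - energy_stat n m (us @ y # vs)\<bar> \<le> 4" for us x y vs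
        using energy_stat_bounded_differences[of n m us x vs y] by linarith
    qed
    finally show ?thesis by (simp add: pmf_bool_False)
  qed
qed

text \<open>For \<open>\<delta> < 1 / 2\<close>, \<open>bits \<delta>\<close> is \<open>ln (1 / \<delta>)\<close> up to a factor of 3, and each scale is one of the three terms of the bound up to a
  constant factor. Both are found by counting upwards.\<close>

definition bits :: "real \<Rightarrow> nat" where
  "bits \<delta> = (LEAST k. 1 \<le> 2 ^ k * \<delta>)"

definition least_scale :: "nat \<Rightarrow> real \<Rightarrow> real \<Rightarrow> nat" where
  "least_scale e d c = (LEAST m. c \<le> real m ^ e * d)"

definition scale1 :: "nat \<Rightarrow> real \<Rightarrow> real \<Rightarrow> nat" where
  "scale1 n \<epsilon> \<delta> = least_scale 3 (\<epsilon> ^ 4) (2000 * (real n)\<^sup>2 * bits \<delta>)"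
definition scale2 :: "nat \<Rightarrow> real \<Rightarrow> real \<Rightarrow> nat" where
  "scale2 n \<epsilon> \<delta> = least_scale 2 (\<epsilon> ^ 4) (2000 * real n * bits \<delta>)"
definition scale3 :: "nat \<Rightarrow> real \<Rightarrow> real \<Rightarrow> nat" where
  "scale3 n \<epsilon> \<delta> = least_scale 1 (\<epsilon>\<^sup>2) (2000 * real (bits \<delta>))"

definition block_size :: "nat \<Rightarrow> real \<Rightarrow> real \<Rightarrow> nat" where
  "block_size n \<epsilon> \<delta> = scale1 n \<epsilon> \<delta> + scale2 n \<epsilon> \<delta> + scale3 n \<epsilon> \<delta>"

definition samples :: "nat \<Rightarrow> real \<Rightarrow> real \<Rightarrow> nat" where
  "samples n \<epsilon> \<delta> = (if \<delta> < 1 / 2 then 2 * block_size n \<epsilon> \<delta> else 0)"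

definition test :: "nat \<Rightarrow> real \<Rightarrow> real \<Rightarrow> rule" where
  "test n \<epsilon> \<delta> xs ys =
     (if \<delta> < 1 / 2 then return_pmf (accepts n (block_size n \<epsilon> \<delta>) (bits \<delta>) (xs @ ys)) else bernoulli_pmf (1/2))"

lemma bits_bounds:
  assumes "0 < \<delta>" "\<delta> < 1 / 2"
  shows "1 \<le> 2 ^ bits \<delta> * \<delta>" "0 < bits \<delta>" "j < bits \<delta> \<Longrightarrow> 2 ^ j * \<delta> < 1"
    "real (bits \<delta>) \<le> 3 * ln (1 / \<delta>)" "1 / 2 \<le> ln (1 / \<delta>)" "exp (- real (bits \<delta>)) \<le> \<delta>"
proof -
  obtain k where "1 / \<delta> < 2 ^ k" using real_arch_pow[of 2 "1 / \<delta>"] by auto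
  then have "1 \<le> 2 ^ k * \<delta>" using assms by (simp add: field_simps)
  then show *: "1 \<le> 2 ^ bits \<delta> * \<delta>" unfolding bits_def by (rule LeastI)
  then show k0: "0 < bits \<delta>" using assms by (auto intro!: Nat.gr0I)
  show lt: "2 ^ j * \<delta> < 1" if "j < bits \<delta>" for j
    using not_less_Least[OF that[unfolded bits_def]] by simp
  define L where "L = ln (1 / \<delta>)"
  have "2 < 1 / \<delta>" using assms by (simp add: field_simps)
  then have L2: "ln 2 < L" unfolding L_def using assms by (subst ln_less_cancel_iff) auto
  then show "1 / 2 \<le> ln (1 / \<delta>)" using ln2_ge_two_thirds by (simp add: L_def)
  have "2 ^ (bits \<delta> - 1) < 1 / \<delta>" using lt[of "bits \<delta> - 1"] k0 assms by (simp add: field_simps)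
  then have "ln (2 ^ (bits \<delta> - 1)) < L" unfolding L_def using assms by (subst ln_less_cancel_iff) auto
  then have "(real (bits \<delta>) - 1) * ln 2 < L" using k0 by (simp add: ln_realpow of_nat_diff)
  \<comment> \<open>Since \<open>ln 2 < L\<close>, the last step of the counting costs at most
    another \<open>L\<close>.\<close>
  then have "real (bits \<delta>) * ln 2 \<le> 2 * L" using L2 by (simp add: algebra_simps)
  moreover have "real (bits \<delta>) * (2 / 3) \<le> real (bits \<delta>) * ln 2"
    using ln2_ge_two_thirds by (intro mult_left_mono) auto
  ultimately show "real (bits \<delta>) \<le> 3 * ln (1 / \<delta>)" by (simp add: L_def)
  have "1 / \<delta> \<le> 2 ^ bits \<delta>" using * assms by (simp add: field_simps)
  also have "\<dots> \<le> exp 1 ^ bits \<delta>" using exp_ge_add_one_self[of 1] by (intro power_mono) auto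
  also have "\<dots> = exp (real (bits \<delta>))" by (simp flip: exp_of_nat_mult)
  finally show "exp (- real (bits \<delta>)) \<le> \<delta>" using assms by (simp add: exp_minus field_simps)
qed

lemma least_scale_bounds:
  assumes "0 < d" "0 < e"
  shows "c \<le> real (least_scale e d c) ^ e * d"
    and "m < least_scale e d c \<Longrightarrow> real m ^ e * d < c"
    and "0 < c \<Longrightarrow> 0 < least_scale e d c"
    and "\<lbrakk>c \<le> X ^ e * d; 0 \<le> X\<rbrakk> \<Longrightarrow> real (least_scale e d c) \<le> X + 1"
proof -
  obtain k where k: "c / d < real k" using reals_Archimedean2 by blast
  have "real k \<le> real (Suc k) ^ e"
    using self_le_power[of "real (Suc k)" e] assms by linarith
  then have "real k * d \<le> real (Suc k) ^ e * d" using assms by (intro mult_right_mono) auto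
  moreover have "c < real k * d" using k assms by (simp add: field_simps)
  ultimately have "c \<le> real (Suc k) ^ e * d" by linarith
  then show ge: "c \<le> real (least_scale e d c) ^ e * d" unfolding least_scale_def by (rule LeastI)
  show lt: "real m ^ e * d < c" if "m < least_scale e d c" for m
    using not_less_Least[OF that[unfolded least_scale_def]] by simp
  show pos: "0 < least_scale e d c" if "0 < c"
    using ge that assms by (auto intro!: Nat.gr0I simp: zero_power)
  show "real (least_scale e d c) \<le> X + 1" if "c \<le> X ^ e * d" "0 \<le> X"
  proof (cases "least_scale e d c")
    case (Suc m)
    then have "real m ^ e * d < X ^ e * d" using lt[of m] that by simp
    then have "real m ^ e < X ^ e" using assms by simp
    then have "real m < X" by (rule power_less_imp_less_base) (rule that)
    then show ?thesis using Suc by simp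
  qed (use that in simp)
qed

lemma sample_bound_le:
  assumes n: "1 \<le> n" and eps: "0 < \<epsilon>" "\<epsilon> < 1" and d: "0 < \<delta>" "\<delta> < 1 / 2"
  shows "real (block_size n \<epsilon> \<delta>) \<le> 7000 * sample_bound n \<epsilon> \<delta>"
proof -
  define L where "L = ln (1 / \<delta>)"
  note b = bits_bounds[OF d, folded L_def]
  define T1 where "T1 = real n powr (2/3) * L powr (1/3) / \<epsilon> powr (4/3)"
  define T2 where "T2 = real n powr (1/2) * L powr (1/2) / \<epsilon>\<^sup>2"
  have L: "0 < L" using b by linarith
  have T: "T1 ^ 3 = (real n)\<^sup>2 * L / \<epsilon> ^ 4" "T2\<^sup>2 = n * L / \<epsilon> ^ 4" "0 \<le> T1" "0 \<le> T2"
    unfolding T1_def T2_def using sample_bound_parts[of "real n" \<epsilon> L] n eps L by simp_all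
  have "2000 * (real n)\<^sup>2 * bits \<delta> \<le> 2000 * (real n)\<^sup>2 * (3 * L)" using b by (intro mult_left_mono) auto
  \<comment> \<open>The first cube above 6000 = 2000 * 3 is 19^3; the first square above it, used
    for the second scale, is 78^2.\<close>
  also have "\<dots> \<le> 6859 * ((real n)\<^sup>2 * L)" using L by simp
  also have "\<dots> = (19 * T1) ^ 3 * \<epsilon> ^ 4" using T eps by (simp add: power_mult_distrib)
  finally have 1: "real (scale1 n \<epsilon> \<delta>) \<le> 19 * T1 + 1"
    unfolding scale1_def using eps T by (intro least_scale_bounds(4)) auto
  have "2000 * real n * bits \<delta> \<le> 2000 * real n * (3 * L)" using b by (intro mult_left_mono) auto
  also have "\<dots> \<le> 6084 * (n * L)" using L by simp
  also have "\<dots> = (78 * T2)\<^sup>2 * \<epsilon> ^ 4" using T eps by (simp add: power_mult_distrib)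
  finally have 2: "real (scale2 n \<epsilon> \<delta>) \<le> 78 * T2 + 1"
    unfolding scale2_def using eps T by (intro least_scale_bounds(4)) auto
  have "2000 * real (bits \<delta>) \<le> (6000 * L / \<epsilon>\<^sup>2) ^ 1 * \<epsilon>\<^sup>2" using b eps by simp
  then have 3: "real (scale3 n \<epsilon> \<delta>) \<le> 6000 * L / \<epsilon>\<^sup>2 + 1"
    unfolding scale3_def using eps L by (intro least_scale_bounds(4)) auto
  have "L * \<epsilon>\<^sup>2 \<le> L * 1" using eps L by (intro mult_left_mono power_le_one) auto
  then have "L \<le> L / \<epsilon>\<^sup>2" using eps by (simp add: field_simps)
  \<comment> \<open>This absorbs the three roundings of the scales into the last term of the
    bound.\<close>
  then have "1 \<le> 2 * (L / \<epsilon>\<^sup>2)" using b by linarith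
  then have "real (block_size n \<epsilon> \<delta>) \<le> 7000 * (T1 + T2 + L / \<epsilon>\<^sup>2)"
    unfolding block_size_def of_nat_add ring_distribs using 1 2 3 T by simp
  also have "T1 + T2 + L / \<epsilon>\<^sup>2 = sample_bound n \<epsilon> \<delta>"
    by (simp add: sample_bound_def T1_def T2_def L_def add_divide_distrib)
  finally show ?thesis .
qed

lemma samples_le:
  assumes n: "1 \<le> n" and eps: "0 < \<epsilon>" "\<epsilon> < 1" and d: "0 < \<delta>" "\<delta> < 1"
  shows "real (samples n \<epsilon> \<delta> + samples n \<epsilon> \<delta>) \<le> 28000 * sample_bound n \<epsilon> \<delta>"
proof (cases "\<delta> < 1 / 2")
  case True
  then show ?thesis using sample_bound_le[OF n eps d(1)] by (simp add: samples_def)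
next
  case False
  have "0 \<le> sample_bound n \<epsilon> \<delta>"
    unfolding sample_bound_def using d by (intro add_nonneg_nonneg divide_nonneg_nonneg mult_nonneg_nonneg) auto
  then show ?thesis using False by (simp add: samples_def)
qed

text \<open>The three inequalities with 2000 are those of \<open>sample_size_gap\<close>. The last
  two concern the running time: it has to be polynomial in the number of samples alone, whereas the
  programs also loop over the domain and count up to \<open>bits \<delta>\<close>.\<close>

lemma block_size_bounds:
  assumes n: "1 \<le> n" and eps: "0 < \<epsilon>" "\<epsilon> < 1" and d: "0 < \<delta>" "\<delta> < 1 / 2"
  defines "m \<equiv> block_size n \<epsilon> \<delta>"
  shows "0 < m" "2000 * (real n)\<^sup>2 * bits \<delta> \<le> real m ^ 3 * \<epsilon> ^ 4"
    "2000 * real n * bits \<delta> \<le> (real m)\<^sup>2 * \<epsilon> ^ 4" "2000 * real (bits \<delta>) \<le> m * \<epsilon>\<^sup>2"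
    "n \<le> m\<^sup>2" "bits \<delta> \<le> m"
proof -
  note b = bits_bounds[OF d]
  have le: "scale1 n \<epsilon> \<delta> \<le> m" "scale2 n \<epsilon> \<delta> \<le> m" "scale3 n \<epsilon> \<delta> \<le> m"
    by (auto simp: m_def block_size_def)
  have e4: "0 < \<epsilon> ^ 4" "0 < \<epsilon>\<^sup>2" "\<epsilon> ^ 4 \<le> 1" "\<epsilon>\<^sup>2 \<le> 1" using eps by (auto intro: power_le_one)
  have mono: "real j ^ e * f \<le> real m ^ e * f" if "j \<le> m" "0 < f" for j e f
    using that by (intro mult_right_mono power_mono) auto
  show "2000 * (real n)\<^sup>2 * bits \<delta> \<le> real m ^ 3 * \<epsilon> ^ 4"
    using least_scale_bounds(1)[of "\<epsilon> ^ 4" 3] e4 mono[OF le(1) e4(1), of 3] unfolding scale1_def by (metis order.trans zero_less_numeral)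
  show m2: "2000 * real n * bits \<delta> \<le> (real m)\<^sup>2 * \<epsilon> ^ 4"
    using least_scale_bounds(1)[of "\<epsilon> ^ 4" 2] e4 mono[OF le(2) e4(1), of 2] unfolding scale2_def by (metis order.trans zero_less_numeral)
  show m3: "2000 * real (bits \<delta>) \<le> m * \<epsilon>\<^sup>2"
    using order.trans[OF least_scale_bounds(1)[OF e4(2) zero_less_one] mono[OF le(3)[unfolded scale3_def] e4(2), of 1]]
    by (simp only: power_one_right)
  have "real (bits \<delta>) \<le> m * \<epsilon>\<^sup>2" using m3 by linarith
  also have "\<dots> \<le> real m * 1" using e4 by (intro mult_left_mono) auto
  finally show bm: "bits \<delta> \<le> m" by simp
  then show "0 < m" using b by linarith
  have "real n * 1 \<le> real n * (2000 * bits \<delta>)" using b by (intro mult_left_mono) auto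
  also have "\<dots> \<le> (real m)\<^sup>2 * \<epsilon> ^ 4" using m2 by (simp add: mult_ac)
  also have "\<dots> \<le> (real m)\<^sup>2 * 1" using e4 by (intro mult_left_mono) auto
  finally have "real n \<le> real (m\<^sup>2)" by simp
  then show "n \<le> m\<^sup>2" by (simp only: of_nat_le_iff)
qed

lemma test_is_tester:
  assumes n: "1 \<le> n" and eps: "0 < \<epsilon>" "\<epsilon> < 1" and d: "0 < \<delta>" "\<delta> < 1"
  shows "closeness_tester n \<epsilon> \<delta> (samples n \<epsilon> \<delta>) (samples n \<epsilon> \<delta>) (test n \<epsilon> \<delta>)"
proof (cases "\<delta> < 1 / 2")
  case True
  note m = block_size_bounds[OF n eps d(1) True] and b = bits_bounds[OF d(1) True]
  have "closeness_tester n \<epsilon> \<delta> (2 * block_size n \<epsilon> \<delta>) (2 * block_size n \<epsilon> \<delta>) (test n \<epsilon> \<delta>)"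
    by (rule energy_tester[OF m(1) _ b(2) eps(1) b(6) m(2,3,4)]) (use n True in \<open>auto simp: test_def\<close>)
  then show ?thesis using True by (simp add: samples_def)
next
  case False
  have "test n \<epsilon> \<delta> = (\<lambda>_ _. bernoulli_pmf (1/2))"
    using False by (simp add: test_def fun_eq_iff)
  then show ?thesis
    using closeness_tester_fair_coin[of \<delta> n \<epsilon>] False by (simp add: samples_def)
qed

subsection \<open>Programs\<close>

text \<open>Structured programs whose compilation needs no unconditional jump: the body of \<open>Unless i j c\<close> is
  skipped if register \<open>i\<close> is less than register \<open>j\<close>, and \<open>Repeat c i j\<close> runs \<open>c\<close> at least once and again as
  long as register \<open>i\<close> is less than register \<open>j\<close>.\<close>

datatype cmd =
    Block "instr list"
  | Seq cmd cmd (infixr \<open>;;\<close> 60)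
  | Unless nat nat cmd
  | Repeat cmd nat nat

fun code_length :: "cmd \<Rightarrow> nat" where
  "code_length (Block is) = length is"
| "code_length (c ;; d) = code_length c + code_length d"
| "code_length (Unless i j c) = Suc (code_length c)"
| "code_length (Repeat c i j) = Suc (code_length c)"

fun code :: "nat \<Rightarrow> cmd \<Rightarrow> instr list" where
  "code p (Block is) = is"
| "code p (c ;; d) = code p c @ code (p + code_length c) d"
| "code p (Unless i j c) = JumpLess i j (Suc p + code_length c) # code (Suc p) c"
| "code p (Repeat c i j) = code p c @ [JumpLess i j p]"

lemma length_code [simp]: "length (code p c) = code_length c"
  by (induction c arbitrary: p) auto

fun effect :: "(nat \<Rightarrow> real) \<Rightarrow> instr \<Rightarrow> (nat \<Rightarrow> real) \<Rightarrow> nat \<Rightarrow> real" where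
  "effect M (Const i k) R = R(i := real k)"
| "effect M (Add i j k) R = R(i := R j + R k)"
| "effect M (Sub i j k) R = R(i := R j - R k)"
| "effect M (Mul i j k) R = R(i := R j * R k)"
| "effect M (Div i j k) R = R(i := R j / R k)"
| "effect M (Load i j) R = R(i := M (nat \<lfloor>R j\<rfloor>))"
| "effect M _ R = R"

text \<open>The deterministic instructions that only change registers and advance to the next
  instruction. Excluding \<open>Store\<close> keeps the memory equal to the input throughout, and a
  \<open>Load\<close> from an address that is not a natural number would not advance.\<close>

fun register_op :: "instr \<Rightarrow> (nat \<Rightarrow> real) \<Rightarrow> bool" where
  "register_op (Load i j) R \<longleftrightarrow> R j \<in> \<nat>"
| "register_op (Store i j) R \<longleftrightarrow> False"
| "register_op (Flip i) R \<longleftrightarrow> False"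
| "register_op (JumpLess i j l) R \<longleftrightarrow> False"
| "register_op _ R \<longleftrightarrow> True"

fun effects :: "(nat \<Rightarrow> real) \<Rightarrow> instr list \<Rightarrow> (nat \<Rightarrow> real) \<Rightarrow> nat \<Rightarrow> real" where
  "effects M [] R = R"
| "effects M (I # is) R = effects M is (effect M I R)"

fun register_ops :: "(nat \<Rightarrow> real) \<Rightarrow> instr list \<Rightarrow> (nat \<Rightarrow> real) \<Rightarrow> bool" where
  "register_ops M [] R \<longleftrightarrow> True"
| "register_ops M (I # is) R \<longleftrightarrow> register_op I R \<and> register_ops M is (effect M I R)"

abbreviation conf :: "nat \<Rightarrow> (nat \<Rightarrow> real) \<Rightarrow> (nat \<Rightarrow> real) \<Rightarrow> config" where
  "conf p R M \<equiv> \<lparr>pc = p, reg = R, mem = M\<rparr>"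

lemma run_add: "run P (t + u) c = bind_pmf (run P t c) (run P u)"
proof (induction t arbitrary: c)
  case (Suc t)
  have "run P (t + u) = (\<lambda>c. bind_pmf (run P t c) (run P u))" by (intro ext Suc)
  then show ?case by (simp add: bind_assoc_pmf)
qed (simp add: bind_return_pmf)

lemma run_halted: "halted P c \<Longrightarrow> run P t c = return_pmf c"
  by (induction t) (auto simp: step_def bind_return_pmf)

lemma step_instr:
  "step (pre @ I # post) (conf (length pre) R M) = exec I (conf (length pre) R M)"
  by (simp add: step_def halted_def nth_append)

lemma step_register_op:
  "register_op I R \<Longrightarrow>
    step (pre @ I # post) (conf (length pre) R M) = return_pmf (conf (Suc (length pre)) (effect M I R) M)"
  unfolding step_instr by (cases I) (auto simp: set_reg_def)

text \<open>\<open>wp M c t Q R\<close>: started with registers \<open>R\<close> and memory \<open>M\<close>, the code of \<open>c\<close> terminates within \<open>t\<close> steps,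
  wherever it is placed in a program, with registers that satisfy \<open>Q\<close>.\<close>

definition wp :: "(nat \<Rightarrow> real) \<Rightarrow> cmd \<Rightarrow> nat \<Rightarrow> ((nat \<Rightarrow> real) \<Rightarrow> bool) \<Rightarrow> (nat \<Rightarrow> real) \<Rightarrow> bool" where
  "wp M c t Q R \<longleftrightarrow> (\<forall>pre post. \<exists>t'\<le>t. \<exists>R'. Q R' \<and>
     run (pre @ code (length pre) c @ post) t' (conf (length pre) R M) =
       return_pmf (conf (length pre + code_length c) R' M))"

lemma wp_mono:
  "\<lbrakk>wp M c t Q R; t \<le> t'; \<And>R'. Q R' \<Longrightarrow> Q' R'\<rbrakk> \<Longrightarrow> wp M c t' Q' R"
  unfolding wp_def by (meson order.trans)

lemma run_block:
  "register_ops M is R \<Longrightarrow> run (pre @ is @ post) (length is) (conf (length pre) R M) =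
    return_pmf (conf (length pre + length is) (effects M is R) M)"
proof (induction "is" arbitrary: pre R)
  case (Cons I "is")
  then show ?case
    using Cons.IH[of "effect M I R" "pre @ [I]"] by (simp add: step_register_op bind_return_pmf)
qed simp

lemma wp_block:
  assumes "register_ops M is R" "Q (effects M is R)" "t = length is"
  shows "wp M (Block is) t Q R"
  unfolding wp_def using run_block[OF assms(1)] assms(2,3) by fastforce

lemma wp_seq:
  assumes "wp M c t (wp M d u Q) R"
  shows "wp M (c ;; d) (t + u) Q R"
  unfolding wp_def
proof (intro allI)
  fix pre post :: program
  from assms[unfolded wp_def[of M c], rule_format, of pre "code (length pre + code_length c) d @ post"]
  obtain t' R' where 1: "t' \<le> t" "wp M d u Q R'"
    "run (pre @ code (length pre) c @ code (length pre + code_length c) d @ post) t' (conf (length pre) R M) =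
       return_pmf (conf (length pre + code_length c) R' M)"
    by blast
  from 1(2)[unfolded wp_def, rule_format, of "pre @ code (length pre) c" post]
  obtain u' R'' where 2: "u' \<le> u" "Q R''"
    "run (pre @ code (length pre) c @ code (length pre + code_length c) d @ post) u'
        (conf (length pre + code_length c) R' M) =
      return_pmf (conf (length pre + code_length c + code_length d) R'' M)"
    by auto
  show "\<exists>t'\<le>t + u. \<exists>R'. Q R' \<and> run (pre @ code (length pre) (c ;; d) @ post) t' (conf (length pre) R M) =
      return_pmf (conf (length pre + code_length (c ;; d)) R' M)"
    using 1 2 by (intro exI[of _ "t' + u'"] exI[of _ R'']) (auto simp: run_add bind_return_pmf add.assoc)
qed

lemma wp_unless:
  assumes "\<not> R i < R j \<Longrightarrow> wp M c t Q R" "R i < R j \<Longrightarrow> Q R"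
  shows "wp M (Unless i j c) (Suc t) Q R"
  unfolding wp_def
proof (intro allI)
  fix pre post :: program
  let ?J = "JumpLess i j (Suc (length pre) + code_length c)"
  let ?P = "pre @ ?J # code (Suc (length pre)) c @ post"
  show "\<exists>t'\<le>Suc t. \<exists>R'. Q R' \<and> run (pre @ code (length pre) (Unless i j c) @ post) t' (conf (length pre) R M) =
      return_pmf (conf (length pre + code_length (Unless i j c)) R' M)"
  proof (cases "R i < R j")
    case True
    then have "run ?P 1 (conf (length pre) R M) = return_pmf (conf (Suc (length pre) + code_length c) R M)"
      by (simp add: step_instr bind_return_pmf)
    then show ?thesis using assms(2)[OF True] by (intro exI[of _ 1] exI[of _ R]) auto
  next
    case False
    from assms(1)[OF False, unfolded wp_def, rule_format, of "pre @ [?J]" post]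
    obtain t' R' where "t' \<le> t" "Q R'"
      "run ?P t' (conf (Suc (length pre)) R M) = return_pmf (conf (Suc (length pre) + code_length c) R' M)"
      by auto
    then show ?thesis using False
      by (intro exI[of _ "Suc t'"] exI[of _ R']) (auto simp: step_instr bind_return_pmf)
  qed
qed

text \<open>\<open>Inv\<close> is indexed by the number of completed rounds, of which there are
  \<open>N\<close> in total. The loop test follows the body, so nothing is tested after 0 rounds;
  this explains the premise \<open>0 < s\<close>.\<close>

lemma wp_repeat:
  assumes "Inv 0 R"
    and body: "\<And>s R. \<lbrakk>s < N; Inv s R\<rbrakk> \<Longrightarrow> wp M c t (Inv (Suc s)) R"
    and continue: "\<And>s R. \<lbrakk>s < N; 0 < s; Inv s R\<rbrakk> \<Longrightarrow> R i < R j"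
    and stop: "\<And>R. Inv N R \<Longrightarrow> \<not> R i < R j" and N: "0 < N"
  shows "wp M (Repeat c i j) (N * Suc t) (Inv N) R"
  unfolding wp_def
proof (intro allI)
  fix pre post :: program
  let ?P = "pre @ code (length pre) (Repeat c i j) @ post"
  have loop: "\<exists>t'\<le>(N - s) * Suc t. \<exists>R'. Inv N R' \<and>
      run ?P t' (conf (length pre) R M) = return_pmf (conf (length pre + code_length (Repeat c i j)) R' M)"
    if "s < N" "Inv s R" for s R
    using that
  proof (induction "N - s" arbitrary: s R rule: less_induct)
    case less
    from body[OF less.prems, unfolded wp_def, rule_format, of pre "JumpLess i j (length pre) # post"]
    obtain t' R' where 1: "t' \<le> t" "Inv (Suc s) R'"
      "run ?P t' (conf (length pre) R M) = return_pmf (conf (length pre + code_length c) R' M)"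
      by auto
    have jump: "run ?P 1 (conf (length pre + code_length c) R' M) =
        return_pmf (conf (if R' i < R' j then length pre else Suc (length pre + code_length c)) R' M)"
      using step_instr[of "pre @ code (length pre) c" "JumpLess i j (length pre)" post]
      by (simp add: bind_return_pmf)
    have 2: "run ?P (t' + 1) (conf (length pre) R M) =
        return_pmf (conf (if R' i < R' j then length pre else Suc (length pre + code_length c)) R' M)"
      unfolding run_add 1(3) bind_return_pmf jump ..
    show ?case
    proof (cases "Suc s = N")
      case True
      then have "\<not> R' i < R' j" using 1 stop by auto
      moreover have "N - s = 1" using True by simp
      ultimately show ?thesis
        using 1 2 True by (intro exI[of _ "t' + 1"] exI[of _ R']) auto
    next
      case False
      then have s: "Suc s < N" using less.prems by simp
      have lt: "R' i < R' j" using continue[of "Suc s" R'] s 1 by simp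
      have "N - Suc s < N - s" using s by simp
      from less.hyps[OF this s 1(2)] obtain u R'' where 3: "u \<le> (N - Suc s) * Suc t" "Inv N R''"
        "run ?P u (conf (length pre) R' M) = return_pmf (conf (length pre + code_length (Repeat c i j)) R'' M)"
        by blast
      have "run ?P ((t' + 1) + u) (conf (length pre) R M) =
          return_pmf (conf (length pre + code_length (Repeat c i j)) R'' M)"
        unfolding run_add[of _ "t' + 1"] 2 bind_return_pmf using lt 3 by simp
      moreover have "N - s = Suc (N - Suc s)" using s by simp
      then have "(t' + 1) + u \<le> (N - s) * Suc t" using 1 3 by simp
      ultimately show ?thesis using 3 by blast
    qed
  qed
  show "\<exists>t'\<le>N * Suc t. \<exists>R'. Inv N R' \<and> run ?P t' (conf (length pre) R M) =
      return_pmf (conf (length pre + code_length (Repeat c i j)) R' M)"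
    using loop[OF N assms(1)] by simp
qed

text \<open>Both programs compare \<open>\<delta>\<close> with 1/2. If \<open>\<delta> < 1/2\<close>, they jump to the main part at address 9, otherwise the
  single instruction \<open>I\<close> provides the output in register 0.\<close>

definition branch :: "instr \<Rightarrow> nat \<Rightarrow> instr list" where
  "branch I l = [Const 5 1, Const 6 2, Div 5 5 6, JumpLess 2 5 9, I, Const 1 0, Const 7 0, Const 8 1,
     JumpLess 7 8 (9 + l)]"

definition program :: "instr \<Rightarrow> cmd \<Rightarrow> program" where
  "program I c = branch I (code_length c) @ code 9 c"

lemma length_branch: "length (branch I l) = 9"
  by (simp add: branch_def)

lemma nth_program:
  assumes "i < 9"
  shows "program I c ! i = branch I (code_length c) ! i" "i < length (program I c)"
  using assms by (auto simp: program_def nth_append length_branch)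

lemma step_program:
  assumes "p < 9"
  shows "step (program I c) (conf p R M) = exec (branch I (code_length c) ! p) (conf p R M)"
  using nth_program[OF assms, of I c] by (simp add: step_def halted_def)

lemma run_program_test:
  "run (program I c) 4 (conf 0 R M) =
    return_pmf (conf (if R 2 < 1 / 2 then 9 else 4) (R(6 := 2, 5 := 1 / 2)) M)"
proof -
  let ?s = "step (program I c)"
  have "run (program I c) 4 (conf 0 R M) =
      bind_pmf (?s (conf 0 R M)) (\<lambda>c. bind_pmf (?s c) (\<lambda>c. bind_pmf (?s c) (\<lambda>c. bind_pmf (?s c) return_pmf)))"
    by (simp add: numeral_eq_Suc fun_eq_iff[symmetric] cong: bind_pmf_cong)
  also have "\<dots> = return_pmf (conf (if R 2 < 1 / 2 then 9 else 4) (R(6 := 2, 5 := 1 / 2)) M)"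
    by (simp add: step_program branch_def bind_return_pmf set_reg_def fun_upd_twist)
  finally show ?thesis .
qed

lemma run_program_main:
  assumes "R 2 < 1 / 2" "wp M c t Q (R(6 := 2, 5 := 1 / 2))" "4 + t \<le> u"
  shows "\<exists>R'. Q R' \<and> halted (program I c) (conf (9 + code_length c) R' M) \<and>
    run (program I c) u (conf 0 R M) = return_pmf (conf (9 + code_length c) R' M)"
proof -
  let ?P = "program I c"
  from assms(2)[unfolded wp_def, rule_format, of "branch I (code_length c)" "[]"]
  obtain t' R' where 1: "t' \<le> t" "Q R'"
    "run ?P t' (conf 9 (R(6 := 2, 5 := 1 / 2)) M) = return_pmf (conf (9 + code_length c) R' M)"
    by (auto simp: program_def length_branch)
  have h: "halted ?P (conf (9 + code_length c) R' M)"
    by (simp add: halted_def program_def length_branch)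
  \<comment> \<open>A halted configuration stays put, so the run can be prolonged to exactly
    \<open>u\<close> steps.\<close>
  have "run ?P (4 + (t' + (u - 4 - t'))) (conf 0 R M) = return_pmf (conf (9 + code_length c) R' M)"
    unfolding run_add run_program_test bind_return_pmf using assms(1) 1(3) run_halted[OF h]
    by (simp add: bind_return_pmf)
  moreover have "4 + (t' + (u - 4 - t')) = u" using assms(3) 1 by simp
  ultimately show ?thesis using h 1 by auto
qed

text \<open>\<open>D\<close> and \<open>f\<close> cover both choices of \<open>I\<close>: a constant
  for the sample sizes and a coin flip for the verdict. The cleared register 1 serves as the second
  sample size.\<close>

lemma run_program_alternative:
  assumes "\<not> R 2 < 1 / 2" "9 \<le> u"
    and I: "\<And>c. exec I c = map_pmf (\<lambda>x. set_reg 0 (f x) c) D"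
  shows "run (program I c) u (conf 0 R M) =
    map_pmf (\<lambda>x. conf (9 + code_length c) (R(6 := 2, 5 := 1 / 2, 0 := f x, 1 := 0, 7 := 0, 8 := 1)) M) D"
proof -
  let ?P = "program I c"
  let ?R = "R(6 := 2, 5 := 1 / 2)"
  let ?F = "\<lambda>x. conf (9 + code_length c) (?R(0 := f x, 1 := 0, 7 := 0, 8 := 1)) M"
  let ?s = "step ?P"
  have h: "halted ?P (?F x)" for x
    by (simp add: halted_def program_def length_branch)
  have "run ?P 5 (conf 4 ?R M) =
      bind_pmf (?s (conf 4 ?R M)) (\<lambda>c. bind_pmf (?s c) (\<lambda>c. bind_pmf (?s c) (\<lambda>c. bind_pmf (?s c) (\<lambda>c. bind_pmf (?s c) return_pmf))))"
    by (simp add: numeral_eq_Suc fun_eq_iff[symmetric] cong: bind_pmf_cong)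
  also have "\<dots> = bind_pmf D (\<lambda>x. return_pmf (?F x))"
    by (simp add: step_program branch_def I map_pmf_def bind_assoc_pmf bind_return_pmf set_reg_def)
  finally have 5: "run ?P 5 (conf 4 ?R M) = bind_pmf D (\<lambda>x. return_pmf (?F x))" .
  have "run ?P (4 + (5 + (u - 9))) (conf 0 R M) = bind_pmf D (\<lambda>x. return_pmf (?F x))"
    unfolding run_add run_program_test bind_return_pmf using assms(1)
    by (simp add: 5 bind_assoc_pmf bind_return_pmf run_halted[OF h, unfolded One_nat_def])
  then show ?thesis using assms(2) by (simp add: map_pmf_def)
qed

text \<open>Register 6 holds 2 on entry. The programs keep 0 in register 7, 1 in register 8 and \<open>bits \<delta>\<close> in register 10.\<close>

definition bits_cmd :: cmd where
  "bits_cmd = Block [Const 7 0, Const 8 1, Const 10 0, Add 11 2 7] ;;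
     Repeat (Block [Add 10 10 8, Mul 11 11 6]) 11 8"

text \<open>A search for \<open>least_scale\<close> by counting in register 17; comparing powers
  avoids roots. Adding register 7, which holds 0, copies a register. The result is added to the
  running total in register 19.\<close>

definition scale_cmd :: "nat \<Rightarrow> nat \<Rightarrow> nat \<Rightarrow> cmd" where
  "scale_cmd e d c = Block [Const 17 0] ;;
     Repeat (Block ([Add 17 17 8, Add 18 d 7] @ replicate e (Mul 18 18 17))) 18 c ;;
     Block [Add 19 19 17]"

definition sample_size_cmd :: cmd where
  "sample_size_cmd = bits_cmd ;;
     Block [Const 12 2000, Mul 12 12 10, Mul 13 12 0, Mul 14 13 0, Mul 15 1 1, Mul 16 15 15, Const 19 0] ;;
     scale_cmd 3 16 14 ;; scale_cmd 2 16 13 ;; scale_cmd 1 15 12 ;;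
     Block [Mul 0 19 6, Mul 1 19 6]"

text \<open>Register 9 holds the block size, 13 the element \<open>i\<close>, 14 to 17 its four block counts, and 12 the statistic.\<close>

definition tally_cmd :: "nat \<Rightarrow> cmd" where
  "tally_cmd r = Unless 20 13 (Unless 13 20 (Block [Add r r 8]))"

definition scan_cmd :: cmd where
  "scan_cmd = Block [Load 20 18] ;; tally_cmd 14 ;;
     Block [Add 19 18 9, Load 20 19] ;; tally_cmd 15 ;;
     Block [Add 19 19 9, Load 20 19] ;; tally_cmd 16 ;;
     Block [Add 19 19 9, Load 20 19] ;; tally_cmd 17 ;;
     Block [Add 18 18 8]"

text \<open>Register 22 holds the negative of register 21, so comparing the two tests the sign of
  the difference.\<close>

definition abs_diff_cmd :: "nat \<Rightarrow> nat \<Rightarrow> cmd" where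
  "abs_diff_cmd a b = Block [Sub 21 a b, Sub 22 7 21] ;; Unless 22 21 (Block [Add 21 22 7])"

definition term_cmd :: cmd where
  "term_cmd = Block [Add 13 13 8, Const 14 0, Const 15 0, Const 16 0, Const 17 0, Const 18 0] ;;
     Repeat scan_cmd 18 9 ;;
     abs_diff_cmd 14 16 ;; Block [Add 12 12 21] ;; abs_diff_cmd 15 17 ;; Block [Add 12 12 21] ;;
     abs_diff_cmd 14 15 ;; Block [Sub 12 12 21] ;; abs_diff_cmd 16 17 ;; Block [Sub 12 12 21]"

text \<open>Register 3 holds the number of samples of \<open>p\<close>, which is twice the block
  size. The verdict is YES by default and is revoked only if both comparisons of
  \<open>accepts\<close> fail.\<close>

definition test_cmd :: cmd where
  "test_cmd = bits_cmd ;; Block [Div 9 3 6, Const 12 0, Const 13 0] ;; Repeat term_cmd 13 0 ;;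
     Block [Const 23 32, Mul 23 23 9, Mul 23 23 10, Mul 24 12 12, Const 0 1] ;;
     Unless 12 7 (Unless 24 23 (Block [Const 0 0]))"

section \<open>Correctness and running time of the programs\<close>

lemma wp_seqI:
  "\<lbrakk>wp M c t P R; \<And>R'. P R' \<Longrightarrow> wp M d u Q R'; v = t + u\<rbrakk> \<Longrightarrow> wp M (c ;; d) v Q R"
  using wp_seq[OF wp_mono[OF _ order.refl]] by blast

lemma wp_bits_cmd:
  assumes R: "R 2 = \<delta>" "R 6 = 2" and d: "0 < \<delta>" "\<delta> < 1 / 2"
    and Q: "Q (R(7 := 0, 8 := 1, 10 := real (bits \<delta>), 11 := 2 ^ bits \<delta> * \<delta>))"
  shows "wp M bits_cmd (4 + bits \<delta> * 3) Q R"
  unfolding bits_cmd_def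
proof (rule wp_seq, rule wp_block, goal_cases)
  case 2
  define Inv where "Inv s R' \<longleftrightarrow> R' = R(7 := 0, 8 := 1, 10 := real s, 11 := 2 ^ s * \<delta>)" for s :: nat and R'
  note b = bits_bounds[OF d]
  have "wp M (Repeat (Block [Add 10 10 8, Mul 11 11 6]) 11 8) (bits \<delta> * Suc 2) (Inv (bits \<delta>))
      (effects M [Const 7 0, Const 8 1, Const 10 0, Add 11 2 7] R)"
  proof (rule wp_repeat)
    show "Inv 0 (effects M [Const 7 0, Const 8 1, Const 10 0, Add 11 2 7] R)"
      by (simp add: Inv_def R)
    show "wp M (Block [Add 10 10 8, Mul 11 11 6]) 2 (Inv (Suc s)) R'" if "Inv s R'" for s R'
      by (rule wp_block) (use that R in \<open>auto simp: Inv_def fun_eq_iff\<close>)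
  qed (use b in \<open>auto simp: Inv_def\<close>)
  then show ?case by (rule wp_mono) (use Q in \<open>auto simp: Inv_def\<close>)
qed auto

lemma effects_append: "effects M (is @ js) R = effects M js (effects M is R)"
  by (induction "is" arbitrary: R) auto

lemma register_ops_append: "register_ops M (is @ js) R \<longleftrightarrow> register_ops M is R \<and> register_ops M js (effects M is R)"
  by (induction "is" arbitrary: R) auto

lemma effects_power: "effects M (replicate e (Mul 18 18 17)) R = R(18 := R 18 * R 17 ^ e)"
  by (induction e arbitrary: R) auto

lemma register_ops_power: "register_ops M (replicate e (Mul 18 18 17)) R"
  by (induction e arbitrary: R) auto

lemma wp_scale_cmd:
  assumes R: "R 7 = 0" "R 8 = 1" and dc: "d \<notin> {17, 18, 19}" "c \<notin> {17, 18, 19}"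
    and pos: "0 < R d" "0 < R c" "0 < e"
  defines "m \<equiv> least_scale e (R d) (R c)"
  assumes Q: "\<And>x. Q (R(17 := real m, 18 := x, 19 := R 19 + real m))"
  shows "wp M (scale_cmd e d c) (2 + m * (e + 3)) Q R"
proof -
  \<comment> \<open>Before the first round the content of register 18 is arbitrary, so its value is
    prescribed only for positive \<open>s\<close>.\<close>
  define Inv where "Inv s R' \<longleftrightarrow> (\<exists>x. R' = R(17 := real s, 18 := x) \<and> (0 < s \<longrightarrow> x = real s ^ e * R d))" for s :: nat and R'
  note b = least_scale_bounds[OF pos(1,3), where c = "R c", folded m_def]
  let ?B = "Block ([Add 17 17 8, Add 18 d 7] @ replicate e (Mul 18 18 17))"
  have loop: "wp M (Repeat ?B 18 c) (m * Suc (e + 2)) (Inv m) (effects M [Const 17 0] R)"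
  proof (rule wp_repeat)
    show "Inv 0 (effects M [Const 17 0] R)"
      unfolding Inv_def by (rule exI[of _ "R 18"]) (simp add: fun_eq_iff)
    show "wp M ?B (e + 2) (Inv (Suc s)) R'" if "Inv s R'" for s R'
    proof (rule wp_block)
      from that obtain x where R': "R' = R(17 := real s, 18 := x)" by (auto simp: Inv_def)
      show "Inv (Suc s) (effects M ([Add 17 17 8, Add 18 d 7] @ replicate e (Mul 18 18 17)) R')"
        unfolding Inv_def effects_append effects_power
        by (rule exI[of _ "real (Suc s) ^ e * R d"]) (use R dc in \<open>auto simp: R' fun_eq_iff add.commute\<close>)
    qed (auto simp: register_ops_append register_ops_power)
    show "R' 18 < R' c" if "s < m" "0 < s" "Inv s R'" for s R'
      using that b(2)[of s] dc by (auto simp: Inv_def)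
    show "\<not> R' 18 < R' c" if "Inv m R'" for R'
      using that b(1) b(3) pos dc by (auto simp: Inv_def)
    show "0 < m" using b(3) pos by simp
  qed
  have rest: "wp M (Repeat ?B 18 c ;; Block [Add 19 19 17]) (m * Suc (e + 2) + 1) Q (effects M [Const 17 0] R)"
  proof (rule wp_seq, rule wp_mono[OF loop])
    fix R' assume "Inv m R'"
    then obtain x where R': "R' = R(17 := real m, 18 := x)" by (auto simp: Inv_def)
    show "wp M (Block [Add 19 19 17]) 1 Q R'"
      by (rule wp_block) (use Q[of x] in \<open>auto simp: R'\<close>)
  qed auto
  have "wp M (scale_cmd e d c) (1 + (m * Suc (e + 2) + 1)) Q R"
    unfolding scale_cmd_def by (rule wp_seq, rule wp_block, simp, rule rest, simp)
  then show ?thesis by (rule wp_mono) (auto simp: algebra_simps)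
qed

lemma wp_sample_size_cmd:
  assumes n: "1 \<le> n" and eps: "0 < \<epsilon>" "\<epsilon> < 1" and d: "0 < \<delta>" "\<delta> < 1 / 2"
    and R: "R 0 = real n" "R 1 = \<epsilon>" "R 2 = \<delta>" "R 6 = 2"
  shows "wp M sample_size_cmd (19 + 9 * block_size n \<epsilon> \<delta>)
    (\<lambda>R'. R' 0 = real (2 * block_size n \<epsilon> \<delta>) \<and> R' 1 = real (2 * block_size n \<epsilon> \<delta>)) R"
proof -
  note b = bits_bounds[OF d]
  have k: "0 < real (bits \<delta>)" using b by simp
  let ?k = "bits \<delta>" and ?m = "block_size n \<epsilon> \<delta>"
  let ?m1 = "scale1 n \<epsilon> \<delta>" and ?m2 = "scale2 n \<epsilon> \<delta>" and ?m3 = "scale3 n \<epsilon> \<delta>"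
  \<comment> \<open>The registers on which the three searches rely; \<open>s\<close> is the sum of
    the scales found so far.\<close>
  define P where "P s R' \<longleftrightarrow> R' 6 = 2 \<and> R' 7 = 0 \<and> R' 8 = 1 \<and> R' 12 = 2000 * real ?k \<and> R' 13 = 2000 * real n * real ?k \<and>
    R' 14 = 2000 * (real n)\<^sup>2 * real ?k \<and> R' 15 = \<epsilon>\<^sup>2 \<and> R' 16 = \<epsilon> ^ 4 \<and> R' 19 = real s" for s :: nat and R' :: "nat \<Rightarrow> real"
  have scale: "wp M (scale_cmd e d c) (2 + m * (e + 3)) (P (s + m)) R'"
    if "P s R'" "0 < e" "d \<in> {15, 16}" "c \<in> {12, 13, 14}" "m = least_scale e (R' d) (R' c)" for e d c m s R'
    unfolding that(5)
    by (rule wp_scale_cmd) (use that eps n k in \<open>auto simp: P_def\<close>)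
  have "wp M sample_size_cmd ((4 + ?k * 3) + (7 + ((2 + ?m1 * (3 + 3)) + ((2 + ?m2 * (2 + 3)) + ((2 + ?m3 * (1 + 3)) + 2)))))
    (\<lambda>R'. R' 0 = real (2 * ?m) \<and> R' 1 = real (2 * ?m)) R"
    unfolding sample_size_cmd_def
  proof (rule wp_seqI[OF _ _ refl])
    show "wp M bits_cmd (4 + ?k * 3) (\<lambda>R'. R' = R(7 := 0, 8 := 1, 10 := real ?k, 11 := 2 ^ ?k * \<delta>)) R"
      by (rule wp_bits_cmd[OF R(3,4) d]) simp
    fix R1 assume R1: "R1 = R(7 := 0, 8 := 1, 10 := real ?k, 11 := 2 ^ ?k * \<delta>)"
    show "wp M (Block [Const 12 2000, Mul 12 12 10, Mul 13 12 0, Mul 14 13 0, Mul 15 1 1, Mul 16 15 15, Const 19 0] ;;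
       scale_cmd 3 16 14 ;; scale_cmd 2 16 13 ;; scale_cmd 1 15 12 ;; Block [Mul 0 19 6, Mul 1 19 6])
       (7 + ((2 + ?m1 * (3 + 3)) + ((2 + ?m2 * (2 + 3)) + ((2 + ?m3 * (1 + 3)) + 2))))
       (\<lambda>R'. R' 0 = real (2 * ?m) \<and> R' 1 = real (2 * ?m)) R1"
    proof (rule wp_seqI[OF _ _ refl])
      show "wp M (Block [Const 12 2000, Mul 12 12 10, Mul 13 12 0, Mul 14 13 0, Mul 15 1 1, Mul 16 15 15, Const 19 0]) 7 (P 0) R1"
        by (rule wp_block) (simp_all add: P_def R1 R R(2)[unfolded One_nat_def] power2_eq_square power4_eq_xxxx)
      fix R2 assume "P 0 R2"
      show "wp M (scale_cmd 3 16 14 ;; scale_cmd 2 16 13 ;; scale_cmd 1 15 12 ;; Block [Mul 0 19 6, Mul 1 19 6])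
       ((2 + ?m1 * (3 + 3)) + ((2 + ?m2 * (2 + 3)) + ((2 + ?m3 * (1 + 3)) + 2)))
       (\<lambda>R'. R' 0 = real (2 * ?m) \<and> R' 1 = real (2 * ?m)) R2"
      proof (rule wp_seqI[OF scale[OF \<open>P 0 R2\<close>] _ refl], goal_cases)
        case (5 R3)
        show ?case
        proof (rule wp_seqI[OF scale[OF 5] _ refl], goal_cases)
          case (5 R4)
          show ?case
          proof (rule wp_seqI[OF scale[OF 5] _ refl], goal_cases)
            case (5 R5)
            show ?case
              by (rule wp_block) (use 5 in \<open>simp_all add: P_def block_size_def\<close>)
          qed (use 5 in \<open>auto simp: P_def scale3_def\<close>)
        qed (use 5 in \<open>auto simp: P_def scale2_def\<close>)
      qed (use \<open>P 0 R2\<close> in \<open>auto simp: P_def scale1_def\<close>)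
    qed
  qed
  \<comment> \<open>This pays for the \<open>3 * k\<close> steps of \<open>bits_cmd\<close> in terms
    of the block size.\<close>
  moreover have "?k \<le> ?m" by (rule block_size_bounds(6)[OF n eps d])
  ultimately show ?thesis
    by (elim wp_mono) (auto simp: block_size_def)
qed

text \<open>The machine only has strict comparison, so equality is detected as the failure of both
  orders.\<close>

lemma wp_tally_cmd:
  assumes "R 8 = 1" "r \<notin> {13, 20}" "Q (R(r := R r + of_bool (R 20 = R 13)))"
  shows "wp M (tally_cmd r) 3 Q R"
proof -
  have ne: "Q R" if "R 20 \<noteq> R 13" using assms(3) that by simp
  have "wp M (tally_cmd r) (Suc (Suc 1)) Q R"
    unfolding tally_cmd_def
  proof (intro wp_unless wp_block)
    show "Q (effects M [Add r r 8] R)" if "\<not> R 20 < R 13" "\<not> R 13 < R 20"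
    proof -
      have "R 20 = R 13" using that by linarith
      then show ?thesis using assms by simp
    qed
  qed (use ne in auto)
  then show ?thesis by (simp add: numeral_3_eq_3)
qed

lemma wp_abs_diff_cmd:
  assumes "R 7 = 0" "a \<notin> {21, 22}" "b \<notin> {21, 22}"
    and "Q (R(21 := \<bar>R a - R b\<bar>, 22 := R b - R a))"
  shows "wp M (abs_diff_cmd a b) 4 Q R"
proof -
  have "wp M (abs_diff_cmd a b) (2 + Suc 1) Q R"
    unfolding abs_diff_cmd_def
  proof (rule wp_seq, rule wp_block, goal_cases)
    case 2
    let ?R = "R(21 := R a - R b, 22 := R b - R a)"
    have eff: "effects M [Sub 21 a b, Sub 22 7 21] R = ?R" using assms(1,2,3) by simp
    show ?case unfolding eff
    proof (rule wp_unless, rule wp_block, goal_cases)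
      case 2
      then have "R(21 := \<bar>R a - R b\<bar>, 22 := R b - R a) = effects M [Add 21 22 7] ?R"
        using assms(1) by (auto simp: fun_eq_iff)
      then show ?case using assms(4) by simp
    next
      case 4
      then have "R(21 := \<bar>R a - R b\<bar>, 22 := R b - R a) = ?R" by (auto simp: fun_eq_iff)
      then show ?case using assms(4) by simp
    qed auto
  qed auto
  then show ?thesis by (rule wp_mono) auto
qed

context
  fixes n m k :: nat and zs :: "nat list" and M :: "nat \<Rightarrow> real"
  assumes n: "0 < n" and m: "0 < m" and len: "length zs = 4 * m" and mem: "\<And>l. l < 4 * m \<Longrightarrow> M l = real (zs ! l)"
begin

definition fixed_regs :: "(nat \<Rightarrow> real) \<Rightarrow> bool" where
  "fixed_regs R \<longleftrightarrow> R 0 = real n \<and> R 7 = 0 \<and> R 8 = 1 \<and> R 9 = real m \<and> R 10 = real k"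

definition partial_count :: "nat \<Rightarrow> nat \<Rightarrow> nat \<Rightarrow> real" where
  "partial_count i b j = (\<Sum>l<j. of_bool (zs ! (b * m + l) = i))"

definition scan_inv :: "real \<Rightarrow> nat \<Rightarrow> nat \<Rightarrow> (nat \<Rightarrow> real) \<Rightarrow> bool" where
  "scan_inv z i j R \<longleftrightarrow> fixed_regs R \<and> R 12 = z \<and> R 13 = real i \<and> R 18 = real j \<and>
    R 14 = partial_count i 0 j \<and> R 15 = partial_count i 1 j \<and> R 16 = partial_count i 2 j \<and> R 17 = partial_count i 3 j"

lemma wp_scan_cmd:
  assumes "scan_inv z i j R" "j < m"
  shows "wp M scan_cmd 20 (scan_inv z i (Suc j)) R"
proof -
  \<comment> \<open>Opaque names for the addresses keep the simplifier from rearranging the sums, so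
    that \<open>addr\<close>, \<open>M\<close> and \<open>pc\<close> match as rewrite rules.\<close>
  define a1 where "a1 = m + j"
  define a2 where "a2 = 2 * m + j"
  define a3 where "a3 = 3 * m + j"
  have addr: "real j + real m = real a1" "real a1 + real m = real a2" "real a2 + real m = real a3"
    by (simp_all add: a1_def a2_def a3_def)
  have M: "M j = real (zs ! j)" "M a1 = real (zs ! a1)" "M a2 = real (zs ! a2)" "M a3 = real (zs ! a3)"
    using assms(2) by (auto intro!: mem simp: a1_def a2_def a3_def)
  have pc: "partial_count i 0 (Suc j) = partial_count i 0 j + of_bool (zs ! j = i)"
    "partial_count i 1 (Suc j) = partial_count i 1 j + of_bool (zs ! a1 = i)"
    "partial_count i 2 (Suc j) = partial_count i 2 j + of_bool (zs ! a2 = i)"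
    "partial_count i 3 (Suc j) = partial_count i 3 j + of_bool (zs ! a3 = i)"
    by (simp_all add: partial_count_def a1_def a2_def a3_def)
  note R = assms(1)[unfolded scan_inv_def fixed_regs_def]
  have "wp M scan_cmd (1 + (3 + (2 + (3 + (2 + (3 + (2 + (3 + 1)))))))) (scan_inv z i (Suc j)) R"
    unfolding scan_cmd_def
    by (rule wp_seq wp_block wp_tally_cmd
        | simp add: R addr M pc scan_inv_def fixed_regs_def One_nat_def[symmetric] del: One_nat_def)+
  then show ?thesis by (rule wp_mono) auto
qed

definition stat_inv :: "nat \<Rightarrow> (nat \<Rightarrow> real) \<Rightarrow> bool" where
  "stat_inv i R \<longleftrightarrow> fixed_regs R \<and> R 13 = real i \<and> R 12 = (\<Sum>i'=1..i. energy_term m i' zs)"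

lemma wp_term_cmd:
  assumes "stat_inv i R"
  shows "wp M term_cmd (26 + 21 * m) (stat_inv (Suc i)) R"
proof -
  define z where "z = (\<Sum>i'=1..i. energy_term m i' zs)"
  note R = assms[unfolded stat_inv_def fixed_regs_def, folded z_def]
  have bc: "partial_count (Suc i) b m = block_count m b (Suc i) zs" for b
    by (simp add: partial_count_def block_count_def)
  have "wp M term_cmd (6 + (m * Suc 20 + (4 + (1 + (4 + (1 + (4 + (1 + (4 + 1))))))))) (stat_inv (Suc i)) R"
    unfolding term_cmd_def
  proof (rule wp_seqI[OF _ _ refl])
    show "wp M (Block [Add 13 13 8, Const 14 0, Const 15 0, Const 16 0, Const 17 0, Const 18 0]) 6 (scan_inv z (Suc i) 0) R"
      by (rule wp_block) (use R in \<open>simp_all add: scan_inv_def fixed_regs_def partial_count_def add.commute\<close>)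
    fix R1 assume R1: "scan_inv z (Suc i) 0 R1"
    show "wp M (Repeat scan_cmd 18 9 ;; abs_diff_cmd 14 16 ;; Block [Add 12 12 21] ;; abs_diff_cmd 15 17 ;;
        Block [Add 12 12 21] ;; abs_diff_cmd 14 15 ;; Block [Sub 12 12 21] ;; abs_diff_cmd 16 17 ;; Block [Sub 12 12 21])
      (m * Suc 20 + (4 + (1 + (4 + (1 + (4 + (1 + (4 + 1)))))))) (stat_inv (Suc i)) R1"
    proof (rule wp_seqI[OF _ _ refl])
      show "wp M (Repeat scan_cmd 18 9) (m * Suc 20) (scan_inv z (Suc i) m) R1"
      proof (rule wp_repeat[where Inv = "scan_inv z (Suc i)"])
        show "wp M scan_cmd 20 (scan_inv z (Suc i) (Suc s)) R'" if "s < m" "scan_inv z (Suc i) s R'" for s R'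
          by (rule wp_scan_cmd[OF that(2,1)])
      qed (use R1 m in \<open>auto simp: scan_inv_def fixed_regs_def\<close>)
      fix R2 assume "scan_inv z (Suc i) m R2"
      note R2 = this[unfolded scan_inv_def fixed_regs_def bc]
      show "wp M (abs_diff_cmd 14 16 ;; Block [Add 12 12 21] ;; abs_diff_cmd 15 17 ;;
          Block [Add 12 12 21] ;; abs_diff_cmd 14 15 ;; Block [Sub 12 12 21] ;; abs_diff_cmd 16 17 ;; Block [Sub 12 12 21])
        (4 + (1 + (4 + (1 + (4 + (1 + (4 + 1))))))) (stat_inv (Suc i)) R2"
        by (rule wp_seq wp_block wp_abs_diff_cmd
          | simp add: R2 stat_inv_def fixed_regs_def z_def energy_term_def One_nat_def[symmetric] del: One_nat_def)+
    qed
  qed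
  then show ?thesis by (rule wp_mono) auto
qed

lemma wp_test_cmd:
  assumes d: "0 < \<delta>" "\<delta> < 1 / 2" and k: "k = bits \<delta>"
    and R: "R 0 = real n" "R 2 = \<delta>" "R 3 = real (2 * m)" "R 6 = 2"
  shows "wp M test_cmd (15 + 3 * k + n * (27 + 21 * m)) (\<lambda>R'. R' 0 = 1 \<longleftrightarrow> accepts n m k zs) R"
proof -
  have "wp M test_cmd ((4 + k * 3) + (3 + (n * Suc (26 + 21 * m) + (5 + Suc (Suc 1))))) (\<lambda>R'. R' 0 = 1 \<longleftrightarrow> accepts n m k zs) R"
    unfolding test_cmd_def
  proof (rule wp_seqI[OF _ _ refl])
    show "wp M bits_cmd (4 + k * 3) (\<lambda>R'. R' = R(7 := 0, 8 := 1, 10 := real k, 11 := 2 ^ k * \<delta>)) R"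
      unfolding k by (rule wp_bits_cmd[OF R(2,4) d]) simp
    fix R1 assume R1: "R1 = R(7 := 0, 8 := 1, 10 := real k, 11 := 2 ^ k * \<delta>)"
    show "wp M (Block [Div 9 3 6, Const 12 0, Const 13 0] ;; Repeat term_cmd 13 0 ;;
       Block [Const 23 32, Mul 23 23 9, Mul 23 23 10, Mul 24 12 12, Const 0 1] ;;
       Unless 12 7 (Unless 24 23 (Block [Const 0 0])))
      (3 + (n * Suc (26 + 21 * m) + (5 + Suc (Suc 1)))) (\<lambda>R'. R' 0 = 1 \<longleftrightarrow> accepts n m k zs) R1"
    proof (rule wp_seqI[OF _ _ refl])
      show "wp M (Block [Div 9 3 6, Const 12 0, Const 13 0]) 3 (stat_inv 0) R1"
        by (rule wp_block) (simp_all add: stat_inv_def fixed_regs_def R1 R)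
      fix R2 assume R2: "stat_inv 0 R2"
      show "wp M (Repeat term_cmd 13 0 ;; Block [Const 23 32, Mul 23 23 9, Mul 23 23 10, Mul 24 12 12, Const 0 1] ;;
         Unless 12 7 (Unless 24 23 (Block [Const 0 0])))
        (n * Suc (26 + 21 * m) + (5 + Suc (Suc 1))) (\<lambda>R'. R' 0 = 1 \<longleftrightarrow> accepts n m k zs) R2"
      proof (rule wp_seqI[OF _ _ refl])
        show "wp M (Repeat term_cmd 13 0) (n * Suc (26 + 21 * m)) (stat_inv n) R2"
        proof (rule wp_repeat[where Inv = stat_inv])
          show "wp M term_cmd (26 + 21 * m) (stat_inv (Suc s)) R'" if "stat_inv s R'" for s R'
            by (rule wp_term_cmd[OF that])
        qed (use R2 n in \<open>auto simp: stat_inv_def fixed_regs_def\<close>)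
        fix R3 assume "stat_inv n R3"
        note R3 = this[unfolded stat_inv_def fixed_regs_def, folded energy_stat_def]
        show "wp M (Block [Const 23 32, Mul 23 23 9, Mul 23 23 10, Mul 24 12 12, Const 0 1] ;;
           Unless 12 7 (Unless 24 23 (Block [Const 0 0])))
          (5 + Suc (Suc 1)) (\<lambda>R'. R' 0 = 1 \<longleftrightarrow> accepts n m k zs) R3"
          by (rule wp_seq wp_block wp_unless
            | simp add: R3 accepts_def power2_eq_square not_less not_le)+
      qed
    qed
  qed
  then show ?thesis by (rule wp_mono) auto
qed

end

text \<open>The main loop takes of order \<open>n * m\<close> steps, and
  \<open>n \<le> m\<^sup>2\<close> by \<open>block_size_bounds\<close>; hence the exponent
  3.\<close>

lemma test_efficient: "computationally_efficient samples samples test"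
proof -
  let ?S = "program (Const 0 0) sample_size_cmd" and ?P = "program (Flip 0) test_cmd"
  have "computes ?S (100 * (1 + samples n \<epsilon> \<delta> + samples n \<epsilon> \<delta>) ^ 3) (input n \<epsilon> \<delta> [] []) (\<lambda>c. (reg c 0, reg c 1))
          (return_pmf (real (samples n \<epsilon> \<delta>), real (samples n \<epsilon> \<delta>))) \<and>
        (\<forall>xs ys. length xs = samples n \<epsilon> \<delta> \<and> length ys = samples n \<epsilon> \<delta> \<and> set xs \<union> set ys \<subseteq> {1..n} \<longrightarrow>
          computes ?P (100 * (1 + samples n \<epsilon> \<delta> + samples n \<epsilon> \<delta>) ^ 3) (input n \<epsilon> \<delta> xs ys) (\<lambda>c. reg c 0 = 1) (test n \<epsilon> \<delta> xs ys))"
    if n: "1 \<le> n" and eps: "0 < \<epsilon>" "\<epsilon> < 1" and d: "0 < \<delta>" "\<delta> < 1" for n \<epsilon> \<delta>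
  proof (cases "\<delta> < 1 / 2")
    case True
    note m = block_size_bounds[OF n eps d(1) True]
    define m where "m = block_size n \<epsilon> \<delta>"
    define u where "u = 100 * (1 + samples n \<epsilon> \<delta> + samples n \<epsilon> \<delta>) ^ 3"
    have s: "samples n \<epsilon> \<delta> = 2 * m" using True by (simp add: samples_def m_def)
    have u: "u = 100 * (1 + 4 * m) ^ 3" by (simp add: u_def s)
    also have "\<dots> = 100 + 1200 * m + 4800 * m\<^sup>2 + 6400 * m ^ 3"
      by (simp add: power3_eq_cube power2_eq_square algebra_simps)
    finally have u': "u = 100 + 1200 * m + 4800 * m\<^sup>2 + 6400 * m ^ 3" .
    have "n * (27 + 21 * m) \<le> m\<^sup>2 * (27 + 21 * m)" using m by (intro mult_right_mono) (auto simp: m_def)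
    also have "\<dots> = 27 * m\<^sup>2 + 21 * m ^ 3" by (simp add: power3_eq_cube power2_eq_square algebra_simps)
    finally have tP: "4 + (15 + 3 * bits \<delta> + n * (27 + 21 * m)) \<le> u"
      using m(6) unfolding u' m_def[symmetric] by linarith
    have tS: "4 + (19 + 9 * m) \<le> u" unfolding u' by linarith
    have S: "computes ?S u (input n \<epsilon> \<delta> [] []) (\<lambda>c. (reg c 0, reg c 1)) (return_pmf (real (2 * m), real (2 * m)))"
    proof -
      let ?R = "nth0 [real n, \<epsilon>, \<delta>, 0, 0]" and ?M = "nth0 []"
      have "wp ?M sample_size_cmd (19 + 9 * m) (\<lambda>R'. R' 0 = real (2 * m) \<and> R' 1 = real (2 * m)) (?R(6 := 2, 5 := 1 / 2))"
        unfolding m_def by (rule wp_sample_size_cmd[OF n eps d(1) True]) (auto simp: nth0_def)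
      from run_program_main[OF _ this tS, of "Const 0 0"] True
      obtain R' where R': "R' 0 = real (2 * m)" "R' 1 = real (2 * m)"
        "halted ?S (conf (9 + code_length sample_size_cmd) R' ?M)"
        "run ?S u (conf 0 ?R ?M) = return_pmf (conf (9 + code_length sample_size_cmd) R' ?M)"
        by (auto simp: nth0_def)
      then show ?thesis by (simp add: computes_def input_def)
    qed
    have P: "computes ?P u (input n \<epsilon> \<delta> xs ys) (\<lambda>c. reg c 0 = 1) (test n \<epsilon> \<delta> xs ys)"
      if len: "length xs = 2 * m" "length ys = 2 * m" for xs ys
    proof -
      let ?R = "nth0 [real n, \<epsilon>, \<delta>, real (2 * m), real (2 * m)]" and ?M = "nth0 (map real xs @ map real ys)"
      have "wp ?M test_cmd (15 + 3 * bits \<delta> + n * (27 + 21 * m)) (\<lambda>R'. R' 0 = 1 \<longleftrightarrow> accepts n m (bits \<delta>) (xs @ ys))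
          (?R(6 := 2, 5 := 1 / 2))"
      proof (rule wp_test_cmd[OF _ _ _ _ d(1) True refl])
        show "?M l = real ((xs @ ys) ! l)" if "l < 4 * m" for l
          using that len by (simp add: nth0_def nth_append)
      qed (use n m(1) len in \<open>auto simp: nth0_def m_def\<close>)
      from run_program_main[OF _ this tP, of "Flip 0"] True
      obtain R' where R': "R' 0 = 1 \<longleftrightarrow> accepts n m (bits \<delta>) (xs @ ys)"
        "halted ?P (conf (9 + code_length test_cmd) R' ?M)"
        "run ?P u (conf 0 ?R ?M) = return_pmf (conf (9 + code_length test_cmd) R' ?M)"
        by (auto simp: nth0_def)
      then show ?thesis using True by (simp add: computes_def input_def test_def len m_def[symmetric])
    qed
    have u_eq: "100 * (1 + 2 * m + 2 * m) ^ 3 = u" by (simp add: u_def s)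
    show ?thesis unfolding s u_eq using S P by blast
  next
    case False
    then have s: "samples n \<epsilon> \<delta> = 0" by (simp add: samples_def)
    let ?R = "nth0 [real n, \<epsilon>, \<delta>, 0, 0]"
    have R2: "\<not> ?R 2 < 1 / 2" using False by (simp add: nth0_def)
    have halt: "halted (program I c) (conf (9 + code_length c) R' M)" for I c R' M
      by (simp add: halted_def program_def length_branch)
    have t: "test n \<epsilon> \<delta> [] [] = bernoulli_pmf (1/2)" using False by (simp add: test_def)
    have 1: "run ?S 100 (conf 0 ?R (nth0 [])) = map_pmf (\<lambda>x. conf (9 + code_length sample_size_cmd)
        (?R(6 := 2, 5 := 1 / 2, 0 := 0, 1 := 0, 7 := 0, 8 := 1)) (nth0 [])) (return_pmf ())"
      by (rule run_program_alternative) (use R2 in auto)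
    have 2: "run ?P 100 (conf 0 ?R (nth0 [])) = map_pmf (\<lambda>x. conf (9 + code_length test_cmd)
        (?R(6 := 2, 5 := 1 / 2, 0 := of_bool x, 1 := 0, 7 := 0, 8 := 1)) (nth0 [])) (bernoulli_pmf (1/2))"
      by (rule run_program_alternative) (use R2 in auto)
    show ?thesis
      unfolding s using 1 2 by (auto simp: computes_def input_def halt t map_pmf_comp o_def)
  qed
  then show ?thesis
    unfolding computationally_efficient_def Let_def
    by (intro exI[of _ ?S] exI[of _ ?P] exI[of _ 100] exI[of _ 3]) auto
qed

theorem theorem1p2:
  shows "\<exists>C > 0.
    (\<exists>a b A. computationally_efficient a b A \<and>
       (\<forall>n \<ge> 1. \<forall>\<epsilon> \<in> {0<..<1}. \<forall>\<delta> \<in> {0<..<1}.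
          closeness_tester n \<epsilon> \<delta> (a n \<epsilon> \<delta>) (b n \<epsilon> \<delta>) (A n \<epsilon> \<delta>) \<and>
          real (a n \<epsilon> \<delta> + b n \<epsilon> \<delta>) \<le> C * sample_bound n \<epsilon> \<delta>)) \<and>
    (\<forall>\<epsilon>\<^sub>0 < 1. \<forall>\<delta>\<^sub>0 < 1/2. \<exists>c > 0. c \<le> C \<and>
       (\<forall>n \<ge> 2. \<forall>\<epsilon> \<in> {0<..\<epsilon>\<^sub>0}. \<forall>\<delta> \<in> {0<..\<delta>\<^sub>0}. \<forall>a b A.
          closeness_tester n \<epsilon> \<delta> a b A \<longrightarrow> real (a + b) \<ge> c * sample_bound n \<epsilon> \<delta>))"
proof (intro exI[of _ "28000 :: real"] conjI)
  show "\<exists>a b A. computationally_efficient a b A \<and>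
       (\<forall>n \<ge> 1. \<forall>\<epsilon> \<in> {0<..<1}. \<forall>\<delta> \<in> {0<..<1}.
          closeness_tester n \<epsilon> \<delta> (a n \<epsilon> \<delta>) (b n \<epsilon> \<delta>) (A n \<epsilon> \<delta>) \<and>
          real (a n \<epsilon> \<delta> + b n \<epsilon> \<delta>) \<le> 28000 * sample_bound n \<epsilon> \<delta>)"
  proof (intro exI[of _ samples] exI[of _ test] conjI allI impI ballI test_efficient)
    fix n :: nat and \<epsilon> \<delta> :: real
    assume *: "1 \<le> n" "\<epsilon> \<in> {0<..<1}" "\<delta> \<in> {0<..<1}"
    show "closeness_tester n \<epsilon> \<delta> (samples n \<epsilon> \<delta>) (samples n \<epsilon> \<delta>) (test n \<epsilon> \<delta>)"
      by (rule test_is_tester) (use * in auto)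
    show "real (samples n \<epsilon> \<delta> + samples n \<epsilon> \<delta>) \<le> 28000 * sample_bound n \<epsilon> \<delta>"
      by (rule samples_le) (use * in auto)
  qed
  show "\<forall>\<epsilon>\<^sub>0 < 1. \<forall>\<delta>\<^sub>0 < 1/2. \<exists>c > 0. c \<le> 28000 \<and>
       (\<forall>n \<ge> 2. \<forall>\<epsilon> \<in> {0<..\<epsilon>\<^sub>0}. \<forall>\<delta> \<in> {0<..\<delta>\<^sub>0}. \<forall>a b A.
          closeness_tester n \<epsilon> \<delta> a b A \<longrightarrow> real (a + b) \<ge> c * sample_bound n \<epsilon> \<delta>)"
  proof (intro allI impI)
    fix \<epsilon>\<^sub>0 \<delta>\<^sub>0 :: real assume lt: "\<epsilon>\<^sub>0 < 1" "\<delta>\<^sub>0 < 1/2"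
    obtain c where c: "0 < c" "\<forall>n \<ge> 2. \<forall>\<epsilon> \<in> {0<..\<epsilon>\<^sub>0}. \<forall>\<delta> \<in> {0<..\<delta>\<^sub>0}. \<forall>a b A.
        closeness_tester n \<epsilon> \<delta> a b A \<longrightarrow> c * sample_bound n \<epsilon> \<delta> \<le> real (a + b)"
      using tester_lower_bound[OF lt] by blast
    \<comment> \<open>The minimum with 28000 secures \<open>c \<le> C\<close>.\<close>
    have "min c 28000 * sample_bound n \<epsilon> \<delta> \<le> real (a + b)"
      if "2 \<le> n" "\<epsilon> \<in> {0<..\<epsilon>\<^sub>0}" "\<delta> \<in> {0<..\<delta>\<^sub>0}" "closeness_tester n \<epsilon> \<delta> a b A" for n \<epsilon> \<delta> a b A
    proof -
      have "0 \<le> sample_bound n \<epsilon> \<delta>"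
        unfolding sample_bound_def using that(2,3) lt
        by (intro add_nonneg_nonneg divide_nonneg_nonneg mult_nonneg_nonneg) auto
      then have "min c 28000 * sample_bound n \<epsilon> \<delta> \<le> c * sample_bound n \<epsilon> \<delta>"
        by (intro mult_right_mono) auto
      also have "\<dots> \<le> real (a + b)" using c(2) that by blast
      finally show ?thesis .
    qed
    then show "\<exists>c > 0. c \<le> 28000 \<and>
       (\<forall>n \<ge> 2. \<forall>\<epsilon> \<in> {0<..\<epsilon>\<^sub>0}. \<forall>\<delta> \<in> {0<..\<delta>\<^sub>0}. \<forall>a b A.
          closeness_tester n \<epsilon> \<delta> a b A \<longrightarrow> real (a + b) \<ge> c * sample_bound n \<epsilon> \<delta>)"
      using c(1) by (intro exI[of _ "min c 28000"]) auto
  qed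
qed simp

end
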